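(* Let $K\subset\mathbb{C}^n$ be a nonpluripolar compact set and let $Q\in C(K)$. Then for any $\mu\in\mathcal{M}(K)$, $$\log\overline W(\mu)=\log\underline W(\mu)=\inf_{v\in C(K)}\Bigl[\log\bar\delta^{v}(K)+\int_K v\,d\mu\Bigr]$$ and $$\log\overline W^Q(\mu)=\log\underline W^Q(\mu)=\inf_{v\in C(K)}\Bigl[\log\bar\delta^{v}(K)+\int_K v\,d\mu\Bigr]-\int_K Q\,d\mu .$$
   Context: $\mathcal{M}(K)$ is the space of Borel probability measures on the compact set $K$, with the weak-* topology; $C(K)$ is the space of real-valued continuous functions on $K$. Convention: $\log 0=-\infty$. For $k=1,2,\dots$ let $\mathcal{P}_k$ be the space of holomorphic polynomials on $\mathbb{C}^n$ of degree at most $k$, $N_k=\dim\mathcal{P}_k=\binom{n+k}{k}$, and let $e_1,\dots,e_{N_k}$ be the standard monomial basis of $\mathcal{P}_k$. Put $$VDM_k(x_1,\dots,x_{N_k})=\det[e_i(x_j)]_{i,j=1,\dots,N_k},$$ $$VDM_k^Q(x_1,\dots,x_{N_k})=VDM_k(x_1,\dots,x_{N_k})\,e^{-kQ(x_1)}\cdots e^{-kQ(x_{N_k})}.$$ The (normalized) weighted transfinite diameter of $K$ with respect to a weight $v$ is $$\bar\delta^{v}(K):=\lim_{k\to\infty}\Bigl(\max_{x_1,\dots,x_{N_k}\in K}|VDM_k^{v}(x_1,\dots,x_{N_k})|\Bigr)^{1/(kN_k)};$$ for $K$ nonpluripolar and $v\in C(K)$ this limit is known to exist and to be positive. For $G\subset\mathcal{M}(K)$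 and $s\ge1$ let $\tilde G_s:=\{\mathbf{a}=(a_1,\dots,a_s)\in K^s:\frac1s\sum_{j=1}^s\delta_{a_j}\in G\}$, and $$W_k(G):=\sup\{|VDM_k(\mathbf{a})|^{1/(kN_k)}:\mathbf{a}\in\tilde G_{N_k}\},\qquad W_k^Q(G):=\sup\{|VDM^Q_k(\mathbf{a})|^{1/(kN_k)}:\mathbf{a}\in\tilde G_{N_k}\}$$ (the sup of the empty set is $0$). Define $$\overline W(\mu):=\inf_{G\ni\mu}\limsup_{k\to\infty}W_k(G),\qquad \underline W(\mu):=\inf_{G\ni\mu}\liminf_{k\to\infty}W_k(G),$$ $$\overline W^Q(\mu):=\inf_{G\ni\mu}\limsup_{k\to\infty}W^Q_k(G),\qquad \underline W^Q(\mu):=\inf_{G\ni\mu}\liminf_{k\to\infty}W^Q_k(G),$$ where the infima are over all (open) neighborhoods $G$ of $\mu$ in $\mathcal{M}(K)$. *)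

theory Defs
  imports "HOL-Probability.Probability" "Jordan_Normal_Form.Determinant"
begin

text \<open>Subharmonic functions take values in \<open>[-\<infinity>, \<infinity>)\<close>; the constant \<open>-\<infinity>\<close> is allowed. The circle
  mean is the difference of the integrals of the positive and negative parts (\<^const>\<open>e2ennreal\<close>
  truncates at 0). For an upper semicontinuous function with values in \<open>[-\<infinity>, \<infinity>)\<close> the positive part
  has a finite integral, so the difference is never of the form \<open>\<infinity> - \<infinity>\<close>.\<close>

definition circle_mean :: "(complex \<Rightarrow> ereal) \<Rightarrow> complex \<Rightarrow> real \<Rightarrow> ereal" where
  "circle_mean u a r =
     (enn2ereal (\<integral>\<^sup>+\<theta>\<in>{0..2*pi}. e2ennreal (u (a + of_real r * cis \<theta>)) \<partial>lborel)
      - enn2ereal (\<integral>\<^sup>+\<theta>\<in>{0..2*pi}. e2ennreal (- u (a + of_real r * cis \<theta>)) \<partial>lborel))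
     / ereal (2 * pi)"

definition usc_on :: "'a::topological_space set \<Rightarrow> ('a \<Rightarrow> ereal) \<Rightarrow> bool" where
  "usc_on S u \<longleftrightarrow> (\<forall>c. openin (top_of_set S) {z \<in> S. u z < c})"

definition subharmonic_on :: "complex set \<Rightarrow> (complex \<Rightarrow> ereal) \<Rightarrow> bool" where
  "subharmonic_on S u \<longleftrightarrow>
     open S \<and> (\<forall>z\<in>S. u z < \<infinity>) \<and> usc_on S u \<and>
     (\<forall>a r. r > 0 \<and> cball a r \<subseteq> S \<longrightarrow> u a \<le> circle_mean u a r)"

text \<open>Plurisubharmonic: upper semicontinuous, and subharmonic (possibly \<open>-\<infinity>\<close>) along every
  complex line.\<close>

definition plurisubharmonic_on :: "(complex ^ 'n) set \<Rightarrow> (complex ^ 'n \<Rightarrow> ereal) \<Rightarrow> bool" where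
  "plurisubharmonic_on S u \<longleftrightarrow>
     open S \<and> (\<forall>z\<in>S. u z < \<infinity>) \<and> usc_on S u \<and>
     (\<forall>a b. subharmonic_on {\<zeta>. a + \<zeta> *s b \<in> S} (\<lambda>\<zeta>. u (a + \<zeta> *s b)))"

text \<open>The global form; by Josefson's theorem it agrees with the local one.\<close>

definition pluripolar :: "(complex ^ 'n) set \<Rightarrow> bool" where
  "pluripolar E \<longleftrightarrow>
     (\<exists>u. plurisubharmonic_on UNIV u \<and> (\<exists>z. u z \<noteq> -\<infinity>) \<and> (\<forall>z\<in>E. u z = -\<infinity>))"


text \<open>\<open>\<M>(K)\<close>: Borel probability measures with underlying space \<open>K\<close>.\<close>

definition prob_measures :: "'a::topological_space set \<Rightarrow> 'a measure set" where
  "prob_measures K = {\<mu>. prob_space \<mu> \<and> sets \<mu> = sets (restrict_space borel K)}"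

definition weak_star_topology :: "'a::topological_space set \<Rightarrow> 'a measure topology" where
  "weak_star_topology K = topology_generated_by
     {{\<mu> \<in> prob_measures K. (LINT x|\<mu>. f x) \<in> U} | (f :: 'a \<Rightarrow> real) U.
        continuous_on K f \<and> open U}"

definition empirical_measure ::
    "'a::topological_space set \<Rightarrow> nat \<Rightarrow> (nat \<Rightarrow> 'a) \<Rightarrow> 'a measure" where
  "empirical_measure K s a = measure_of K (sets (restrict_space borel K))
     (\<lambda>A. (\<Sum>j<s. emeasure (return (restrict_space borel K) (a j)) A) / of_nat s)"

definition configurations ::
    "'a::topological_space set \<Rightarrow> 'a measure set \<Rightarrow> nat \<Rightarrow> (nat \<Rightarrow> 'a) set" where
  "configurations K G s = {a \<in> {..<s} \<rightarrow>\<^sub>E K. empirical_measure K s a \<in> G}"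

lemma empirical_measure_in_prob_measures:
  assumes "s > 0" and "\<And>j. j < s \<Longrightarrow> a j \<in> K"
  shows "empirical_measure K s a \<in> prob_measures K"
    and "A \<in> sets (restrict_space borel K) \<Longrightarrow>
           emeasure (empirical_measure K s a) A = (\<Sum>j<s. indicator A (a j)) / of_nat s"
proof -
  let ?B = "restrict_space borel K"
  let ?f = "\<lambda>A. (\<Sum>j<s. emeasure (return ?B (a j)) A) / of_nat s"
  have sp: "space ?B = K" by (simp add: space_restrict_space)
  have sa: "sigma_algebra K (sets ?B)" using sets.sigma_algebra_axioms[of ?B] sp by simp
  have pow: "sets ?B \<subseteq> Pow K" using sets.space_closed[of ?B] sp by simp
  have ca: "countably_additive (sets ?B) ?f"
  proof (rule countably_additiveI)
    fix A :: "nat \<Rightarrow> 'a set"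
    assume A: "range A \<subseteq> sets ?B" "disjoint_family A" "\<Union> (range A) \<in> sets ?B"
    have "(\<Sum>i. ?f (A i)) = (\<Sum>i. \<Sum>j<s. emeasure (return ?B (a j)) (A i)) / of_nat s"
      by (simp add: divide_ennreal_def)
    also have "(\<Sum>i. \<Sum>j<s. emeasure (return ?B (a j)) (A i))
        = (\<Sum>j<s. \<Sum>i. emeasure (return ?B (a j)) (A i))"
      by (rule suminf_sum) simp
    also have "\<dots> = (\<Sum>j<s. emeasure (return ?B (a j)) (\<Union> (range A)))"
      using A by (intro sum.cong refl suminf_emeasure) auto
    finally show "(\<Sum>i. ?f (A i)) = ?f (\<Union> (range A))" .
  qed
  have em: "emeasure (empirical_measure K s a) A = ?f A" if "A \<in> sets ?B" for A
    unfolding empirical_measure_def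
    by (rule emeasure_measure_of_sigma[OF sa _ ca that]) (simp add: positive_def)
  show em': "emeasure (empirical_measure K s a) A = (\<Sum>j<s. indicator A (a j)) / of_nat s"
    if "A \<in> sets ?B" for A
    using em[OF that] that by simp
  have st: "sets (empirical_measure K s a) = sets ?B"
    unfolding empirical_measure_def using sa pow
    by (simp add: sigma_algebra.sigma_sets_eq)
  then have sp': "space (empirical_measure K s a) = K" using sets_eq_imp_space_eq[OF st] sp by simp
  have "K \<in> sets ?B" using sets.top[of ?B] sp by simp
  then have "emeasure (empirical_measure K s a) K = of_nat s / of_nat s"
    using em' assms(2) by simp
  also have "\<dots> = 1" using assms(1)
    by (intro ennreal_divide_self) (auto simp: ennreal_of_nat_eq_real_of_nat)
  finally show "empirical_measure K s a \<in> prob_measures K"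
    unfolding prob_measures_def using st sp' by (auto intro!: prob_spaceI)
qed

definition multi_indices :: "nat \<Rightarrow> ('n::finite \<Rightarrow> nat) set" where
  "multi_indices k = {\<alpha>. (\<Sum>i\<in>UNIV. \<alpha> i) \<le> k}"

definition poly_dim :: "'n::finite itself \<Rightarrow> nat \<Rightarrow> nat" where
  "poly_dim _ k = (CARD('n) + k) choose k"

lemma card_multi_indices:
  "card (multi_indices k :: ('n::finite \<Rightarrow> nat) set) = poly_dim TYPE('n) k"
proof -
  let ?m = "CARD('n)"
  let ?L = "{l :: nat list. length l = Suc ?m \<and> sum_list l = k}"
  obtain h :: "nat \<Rightarrow> 'n" where h: "bij_betw h {0..<?m} UNIV"
    using ex_bij_betw_nat_finite[of "UNIV :: 'n set"] by auto
  define F where "F = (\<lambda>\<alpha> :: 'n \<Rightarrow> nat. (k - (\<Sum>i\<in>UNIV. \<alpha> i)) # map (\<lambda>j. \<alpha> (h j)) [0..<?m])"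
  have sm: "sum_list (map (\<lambda>j. \<alpha> (h j)) [0..<?m]) = (\<Sum>i\<in>UNIV. \<alpha> i)" for \<alpha> :: "'n \<Rightarrow> nat"
    using sum.reindex_bij_betw[OF h, of \<alpha>] by (simp add: interv_sum_list_conv_sum_set_nat)
  have "bij_betw F (multi_indices k) ?L"
  proof (rule bij_betwI')
    fix \<alpha> \<beta> :: "'n \<Rightarrow> nat"
    have "\<alpha> = \<beta>" if *: "F \<alpha> = F \<beta>"
    proof
      fix i
      obtain j where "j < ?m" "i = h j" using h unfolding bij_betw_def by force
      with * show "\<alpha> i = \<beta> i" unfolding F_def by simp
    qed
    then show "(F \<alpha> = F \<beta>) = (\<alpha> = \<beta>)" by auto
  next
    fix \<alpha> :: "'n \<Rightarrow> nat" assume "\<alpha> \<in> multi_indices k"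
    then show "F \<alpha> \<in> ?L" unfolding F_def multi_indices_def by (simp add: sm)
  next
    fix l :: "nat list" assume "l \<in> ?L"
    then obtain x xs where l: "l = x # xs" "length xs = ?m" "x + sum_list xs = k"
      by (cases l) auto
    define g where "g = inv_into {0..<?m} h"
    have gh: "g (h j) = j" if "j < ?m" for j
      using h that unfolding g_def bij_betw_def by (simp add: inv_into_f_f)
    let ?\<alpha> = "\<lambda>i. xs ! g i"
    have m: "map (\<lambda>j. ?\<alpha> (h j)) [0..<?m] = xs"
      using l(2) by (intro nth_equalityI) (auto simp: gh)
    then have "sum_list xs = (\<Sum>i\<in>UNIV. ?\<alpha> i)" using sm[of ?\<alpha>] by simp
    then have "?\<alpha> \<in> multi_indices k \<and> l = F ?\<alpha>"
      using l m unfolding multi_indices_def F_def by auto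
    then show "\<exists>\<alpha>\<in>multi_indices k. l = F \<alpha>" by blast
  qed
  then have "card (multi_indices k :: ('n \<Rightarrow> nat) set) = card ?L"
    by (rule bij_betw_same_card)
  also have "\<dots> = (k + Suc ?m - 1) choose k" by (rule card_length_sum_list)
  finally show ?thesis unfolding poly_dim_def by (simp add: add.commute)
qed

text \<open>The monomials of degree at most \<open>k\<close>, in an arbitrary but fixed order, indexed from 0.
  Another order changes the determinant below at most by a sign.\<close>

definition monomial_basis :: "nat \<Rightarrow> nat \<Rightarrow> complex ^ 'n \<Rightarrow> complex" where
  "monomial_basis k i z =
     (\<Prod>l\<in>UNIV. vec_nth z l ^ (from_nat_into (multi_indices k) i :: 'n::finite \<Rightarrow> nat) l)"

definition VDM :: "nat \<Rightarrow> (nat \<Rightarrow> complex ^ 'n) \<Rightarrow> complex" where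
  "VDM k x = Determinant.det
     (Matrix.mat (poly_dim TYPE('n::finite) k) (poly_dim TYPE('n) k)
        (\<lambda>(i, j). monomial_basis k i (x j)))"

definition weighted_VDM ::
    "(complex ^ 'n \<Rightarrow> real) \<Rightarrow> nat \<Rightarrow> (nat \<Rightarrow> complex ^ 'n) \<Rightarrow> complex" where
  "weighted_VDM Q k x =
     VDM k x * (\<Prod>j<poly_dim TYPE('n::finite) k. of_real (exp (- real k * Q (x j))))"

text \<open>The supremum is a maximum when \<open>K\<close> is compact and nonempty and \<open>v\<close> is continuous on \<open>K\<close>.\<close>

definition weighted_transfinite_diameter ::
    "(complex ^ 'n) set \<Rightarrow> (complex ^ 'n \<Rightarrow> real) \<Rightarrow> real" where
  "weighted_transfinite_diameter K v = lim (\<lambda>k.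
     (SUP x \<in> {..<poly_dim TYPE('n::finite) k} \<rightarrow>\<^sub>E K. cmod (weighted_VDM v k x))
       powr (1 / (real k * real (poly_dim TYPE('n) k))))"

text \<open>In \<^typ>\<open>ennreal\<close> the supremum of the empty set is 0.\<close>

definition W_sup :: "(complex ^ 'n) set \<Rightarrow> nat \<Rightarrow> (complex ^ 'n) measure set \<Rightarrow> ennreal" where
  "W_sup K k G =
     (SUP a \<in> configurations K G (poly_dim TYPE('n::finite) k).
        ennreal (cmod (VDM k a) powr (1 / (real k * real (poly_dim TYPE('n) k)))))"

definition weighted_W_sup ::
    "(complex ^ 'n) set \<Rightarrow> (complex ^ 'n \<Rightarrow> real) \<Rightarrow> nat \<Rightarrow> (complex ^ 'n) measure set \<Rightarrow> ennreal" where
  "weighted_W_sup K Q k G =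
     (SUP a \<in> configurations K G (poly_dim TYPE('n::finite) k).
        ennreal (cmod (weighted_VDM Q k a) powr (1 / (real k * real (poly_dim TYPE('n) k)))))"

definition W_upper :: "(complex ^ 'n) set \<Rightarrow> (complex ^ 'n) measure \<Rightarrow> ennreal" where
  "W_upper K \<mu> = (INF G \<in> {G. openin (weak_star_topology K) G \<and> \<mu> \<in> G}.
     limsup (\<lambda>k. W_sup K k G))"

definition W_lower :: "(complex ^ 'n) set \<Rightarrow> (complex ^ 'n) measure \<Rightarrow> ennreal" where
  "W_lower K \<mu> = (INF G \<in> {G. openin (weak_star_topology K) G \<and> \<mu> \<in> G}.
     liminf (\<lambda>k. W_sup K k G))"

definition weighted_W_upper ::
    "(complex ^ 'n) set \<Rightarrow> (complex ^ 'n \<Rightarrow> real) \<Rightarrow> (complex ^ 'n) measure \<Rightarrow> ennreal" where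
  "weighted_W_upper K Q \<mu> = (INF G \<in> {G. openin (weak_star_topology K) G \<and> \<mu> \<in> G}.
     limsup (\<lambda>k. weighted_W_sup K Q k G))"

definition weighted_W_lower ::
    "(complex ^ 'n) set \<Rightarrow> (complex ^ 'n \<Rightarrow> real) \<Rightarrow> (complex ^ 'n) measure \<Rightarrow> ennreal" where
  "weighted_W_lower K Q \<mu> = (INF G \<in> {G. openin (weak_star_topology K) G \<and> \<mu> \<in> G}.
     liminf (\<lambda>k. weighted_W_sup K Q k G))"

definition ext_log :: "ennreal \<Rightarrow> ereal" where
  "ext_log x = (if x = 0 then -\<infinity> else if x = \<infinity> then \<infinity> else ereal (ln (enn2real x)))"

end

theory Submission
  imports Defs "Jordan_Normal_Form.Schur_Decomposition" "HOL-Real_Asymp.Real_Asymp"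
begin

text \<open>
  Write \<open>F\<^sub>k(v)\<close> for the maximum over \<open>a \<in> K\<^sup>N\<close> of \<open>ln |VDM\<^sub>k\<^sup>v(a)| / (k N\<^sub>k)\<close>. The limit \<open>F\<close> of \<open>F\<^sub>k\<close> exists because
  \<open>max |VDM\<^sub>k\<^sup>v|\<close> is, up to a factor \<open>N\<^sub>k!\<close>, the product of the Chebyshev constants of the monomials of
  degree at most \<open>k\<close>, and the logarithms of these constants are subadditive in degree and exponent.
  The upper bound for \<open>W\<close> holds because \<open>VDM\<^sub>k\<^sup>Q\<close> and \<open>VDM\<^sub>k\<^sup>v\<close> differ by a factor that depends only on the
  empirical measure.

  For the lower bound fix test functions \<open>f\<^sub>1, \<dots>, f\<^sub>m\<close> and minimize
  \<open>v \<mapsto> F\<^sub>k(v) + \<integral> v d\<mu>\<close> over \<open>v = \<Sum> l\<^sub>i f\<^sub>i\<close> in a large box, where \<open>F\<^sub>k\<close> is replaced by the logarithm of the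
  partition function \<open>\<Sum>\<^sub>a |VDM\<^sub>k\<^sup>v(a)|\<^sup>2\<close> over the tuples from a finite union of almost optimal configurations.
  At the minimizer the determinantal point process with weights \<open>|VDM\<^sub>k\<^sup>v(a)|\<^sup>2\<close> has means \<open>\<integral> f\<^sub>i d\<mu>\<close> up to a
  small error. Linear statistics of a determinantal process of \<open>N\<close> points concentrate on the scale \<open>\<surd>N\<close>,
  so a typical configuration has empirical measure near \<open>\<mu>\<close>, while its weight is at least that of the
  minimum up to factors \<open>e\<^sup>o\<^sup>(\<^sup>k\<^sup>N\<^sup>)\<close>. No differentiability of \<open>F\<close> is needed.
\<close>

text \<open>A finite set of almost optimal configurations does the work of a Bernstein-Markov
  measure. The sum over tuples from X and the squared maximum differ by a factor of order at most
  \<open>card X ^ N\<close>. Since \<open>card X\<close> grows polynomially in k, the cost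
  \<open>ln (card X) / (2 k)\<close> tends to 0.

  A finite grid replaces differentiation: comparing the minimizer with one neighbour, by a one-sided
  exponential moment bound, already pins the mean. The obstacle is a minimizer on the boundary of
  the grid. There the defect of the mean enters the lower bound for the determinant multiplied by
  the size of the box, and the a priori upper bound for the determinant on K makes the defect small
  once the box is large.

  The limit follows Zaharjuta's comparison with Chebyshev constants, but no directional constants
  are formed. Only sums over all multi-indices of degree at most k are needed, and Fekete's
  subadditivity argument is run on these sums directly.\<close>

section \<open>Determinantal point processes\<close>

definition mat_trace :: "complex mat \<Rightarrow> complex" where
  "mat_trace A = (\<Sum>i<dim_row A. A $$ (i, i))"

lemma mat_mult_index:
  assumes "A \<in> carrier_mat n n" "B \<in> carrier_mat n n" "i < n" "j < n"
  shows "(A * B) $$ (i, j) = (\<Sum>l<n. A $$ (i, l) * B $$ (l, j))"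
  using assms by (auto simp: scalar_prod_def atLeast0LessThan)

lemma mat_trace_comm:
  assumes "A \<in> carrier_mat n n" "B \<in> carrier_mat n n"
  shows "mat_trace (A * B) = mat_trace (B * A)"
proof -
  have "mat_trace (A * B) = (\<Sum>i<n. \<Sum>l<n. A $$ (i, l) * B $$ (l, i))"
    using assms mat_mult_index[OF assms] unfolding mat_trace_def by auto
  also have "\<dots> = (\<Sum>l<n. \<Sum>i<n. A $$ (i, l) * B $$ (l, i))" by (rule sum.swap)
  also have "\<dots> = mat_trace (B * A)"
    using assms mat_mult_index[OF assms(2,1)] unfolding mat_trace_def by (auto simp: mult.commute)
  finally show ?thesis .
qed

text \<open>Determinant and trace are read off one triangular Schur form, so the same list of
  eigenvalues serves both. This is what allows the product of the eigenvalues to be compared with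
  their sum.\<close>

lemma det_trace_eigenvalues:
  assumes A: "(A :: complex mat) \<in> carrier_mat n n"
  obtains es where "length es = n" "Determinant.det A = prod_list es" "mat_trace A = sum_list es"
    "\<And>e. e \<in> set es \<Longrightarrow> eigenvalue A e"
proof -
  from char_poly_factorized[OF A] obtain es where es: "char_poly A = (\<Prod>a\<leftarrow>es. [:- a, 1:])"
    and len: "length es = n" by auto
  obtain B P Q where s: "schur_decomposition A es = (B, P, Q)" by (cases "schur_decomposition A es") auto
  from schur_decomposition[OF A es s] have w: "similar_mat_wit A B P Q" and u: "upper_triangular B"
    and d: "diag_mat B = es" by auto
  from similar_mat_witD2[OF A w] have c: "B \<in> carrier_mat n n" "P \<in> carrier_mat n n" "Q \<in> carrier_mat n n"
    and QP: "Q * P = 1\<^sub>m n" and AB: "A = P * B * Q" by auto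
  have "Determinant.det A = Determinant.det B" using w det_similar unfolding similar_mat_def by blast
  also have "\<dots> = prod_list es" using det_upper_triangular[OF u c(1)] d by simp
  finally have 1: "Determinant.det A = prod_list es" .
  have "mat_trace A = mat_trace (B * Q * P)"
    using mat_trace_comm[of P n "B * Q"] c AB by (simp add: assoc_mult_mat[of P n n B n Q n])
  also have "B * Q * P = B" using c QP by (simp add: assoc_mult_mat[of B n n Q n P n])
  also have "mat_trace B = sum_list es"
    using c d[symmetric] unfolding mat_trace_def diag_mat_def
    by (simp add: interv_sum_list_conv_sum_set_nat atLeast0LessThan)
  finally have 2: "mat_trace A = sum_list es" .
  have 3: "eigenvalue A e" if "e \<in> set es" for e
    unfolding eigenvalue_root_char_poly[OF A] es using that by (auto simp: poly_prod_list prod_list_zero_iff)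
  show ?thesis using that[OF len 1 2 3] by blast
qed

section \<open>Gram matrices and log-concavity of their determinants\<close>

definition gram :: "nat \<Rightarrow> (nat \<Rightarrow> 'a \<Rightarrow> complex) \<Rightarrow> 'a set \<Rightarrow> ('a \<Rightarrow> real) \<Rightarrow> complex mat" where
  "gram N \<phi> X w = mat N N (\<lambda>(i, j). \<Sum>x\<in>X. of_real (w x) * \<phi> i x * cnj (\<phi> j x))"

lemma gram_carrier[simp]: "gram N \<phi> X w \<in> carrier_mat N N" by (simp add: gram_def)

lemma gram_mult_vec:
  assumes "v \<in> carrier_vec N" "i < N"
  shows "vec_index (gram N \<phi> X w *\<^sub>v v) i =
    (\<Sum>x\<in>X. of_real (w x) * \<phi> i x * (\<Sum>j<N. cnj (\<phi> j x) * vec_index v j))"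
proof -
  have "vec_index (gram N \<phi> X w *\<^sub>v v) i =
      (\<Sum>j<N. (\<Sum>x\<in>X. of_real (w x) * \<phi> i x * cnj (\<phi> j x)) * vec_index v j)"
    using assms by (auto simp: gram_def scalar_prod_def atLeast0LessThan)
  also have "\<dots> = (\<Sum>x\<in>X. \<Sum>j<N. of_real (w x) * \<phi> i x * cnj (\<phi> j x) * vec_index v j)"
    unfolding sum_distrib_right by (rule sum.swap)
  finally show ?thesis by (simp add: sum_distrib_left mult.assoc)
qed

text \<open>The source of all positivity: for nonnegative \<open>w\<close> the form is a sum of
  weighted squares. The eigenvalues below are quotients of two such forms.\<close>

lemma gram_quadratic_form:
  assumes "v \<in> carrier_vec N"
  shows "(\<Sum>i<N. cnj (vec_index v i) * vec_index (gram N \<phi> X w *\<^sub>v v) i) =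
    of_real (\<Sum>x\<in>X. w x * (cmod (\<Sum>j<N. cnj (\<phi> j x) * vec_index v j))\<^sup>2)"
proof -
  let ?L = "\<lambda>x. \<Sum>j<N. cnj (\<phi> j x) * vec_index v j"
  have cnj_sq: "cnj z * z = of_real ((cmod z)\<^sup>2)" for z
    by (metis complex_norm_square mult.commute)
  have "(\<Sum>i<N. cnj (vec_index v i) * vec_index (gram N \<phi> X w *\<^sub>v v) i) =
      (\<Sum>i<N. \<Sum>x\<in>X. of_real (w x) * (cnj (cnj (\<phi> i x) * vec_index v i)) * ?L x)"
    using assms by (intro sum.cong refl) (simp add: gram_mult_vec sum_distrib_left mult_ac)
  also have "\<dots> = (\<Sum>x\<in>X. \<Sum>i<N. of_real (w x) * (cnj (cnj (\<phi> i x) * vec_index v i)) * ?L x)"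
    by (rule sum.swap)
  also have "\<dots> = (\<Sum>x\<in>X. of_real (w x) * (cnj (?L x) * ?L x))"
    by (intro sum.cong refl) (simp add: sum_distrib_left sum_distrib_right mult_ac)
  also have "\<dots> = of_real (\<Sum>x\<in>X. w x * (cmod (?L x))\<^sup>2)"
    by (simp only: cnj_sq of_real_sum of_real_mult)
  finally show ?thesis .
qed

text \<open>The inequality \<open>ln r \<le> r - 1\<close> for each factor, written so that zero
  factors are allowed.\<close>

lemma prod_list_le_exp:
  fixes rs :: "real list"
  assumes "\<And>r. r \<in> set rs \<Longrightarrow> r \<ge> 0"
  shows "0 \<le> prod_list rs \<and> prod_list rs \<le> exp (sum_list rs - real (length rs))"
  using assms
proof (induction rs)
  case (Cons r rs)
  have "r \<le> exp (r - 1)" using exp_ge_add_one_self[of "r - 1"] by simp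
  then have "r * prod_list rs \<le> exp (r - 1) * exp (sum_list rs - real (length rs))"
    using Cons by (intro mult_mono) auto
  then show ?case using Cons by (simp add: exp_add[symmetric] algebra_simps)
qed simp

text \<open>Log-concavity of \<open>w \<mapsto> det (gram w)\<close>: its graph lies below the tangent at \<open>w\<close>, because the
  eigenvalues of \<open>(gram w)\<^sup>-\<^sup>1 * gram w'\<close> are real and nonnegative. Here \<open>w x * \<beta> x\<close> is the probability
  that the determinantal point process of \<open>w\<close> hits \<open>x\<close>.\<close>

lemma det_gram_tangent:
  fixes \<phi> :: "nat \<Rightarrow> 'a \<Rightarrow> complex" and w :: "'a \<Rightarrow> real"
  assumes w: "\<And>x. x \<in> X \<Longrightarrow> w x \<ge> 0"
    and nz: "Determinant.det (gram N \<phi> X w) \<noteq> 0" and fin: "finite X"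
  obtains \<beta> :: "'a \<Rightarrow> real" where "\<And>x. x \<in> X \<Longrightarrow> \<beta> x \<ge> 0" "(\<Sum>x\<in>X. w x * \<beta> x) = real N"
    "\<And>w'. (\<And>x. x \<in> X \<Longrightarrow> w' x \<ge> 0) \<Longrightarrow>
      cmod (Determinant.det (gram N \<phi> X w')) \<le>
        cmod (Determinant.det (gram N \<phi> X w)) * exp ((\<Sum>x\<in>X. w' x * \<beta> x) - real N)"
proof -
  let ?M = "gram N \<phi> X w"
  have M: "?M \<in> carrier_mat N N" by simp
  define B where "B = inverse (Determinant.det ?M) \<cdot>\<^sub>m adj_mat ?M"
  have B: "B \<in> carrier_mat N N" unfolding B_def using adj_mat(1)[OF M] by simp
  have MB: "?M * B = 1\<^sub>m N"
    unfolding B_def using adj_mat(1,2)[OF M] nz mult_smult_distrib[OF M adj_mat(1)[OF M]]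
    by (intro eq_matI) auto
  have BM: "B * ?M = 1\<^sub>m N"
    unfolding B_def using adj_mat(1,3)[OF M] nz mult_smult_assoc_mat[OF adj_mat(1)[OF M] M]
    by (intro eq_matI) auto
  \<comment> \<open>\<open>L x v\<close> pairs \<open>v\<close> with the values at \<open>x\<close>,
    and \<open>b x\<close> is the Christoffel-Darboux kernel of the weight \<open>w\<close> on the
    diagonal.\<close>
  define L where "L = (\<lambda>x v. \<Sum>j<N. cnj (\<phi> j x) * vec_index v j)"
  define b where "b = (\<lambda>x. L x (B *\<^sub>v vec N (\<lambda>i. \<phi> i x)))"
  define q where "q = (\<lambda>v. \<Sum>x\<in>X. w x * (cmod (L x v))\<^sup>2)"
  have q0: "q v \<ge> 0" for v unfolding q_def using w by (auto intro!: sum_nonneg)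
  \<comment> \<open>The vector \<open>u = B *\<^sub>v \<phi>(x)\<close> solves
    \<open>?M *\<^sub>v u = \<phi>(x)\<close>. Hence the quadratic form of \<open>?M\<close> at
    \<open>u\<close> is the conjugate of \<open>b x\<close>, and \<open>b x\<close> is real and
    nonnegative.\<close>
  have bq: "b x = of_real (q (B *\<^sub>v vec N (\<lambda>i. \<phi> i x)))" for x
  proof -
    let ?v = "vec N (\<lambda>i. \<phi> i x)" and ?u = "B *\<^sub>v vec N (\<lambda>i. \<phi> i x)"
    have u: "?u \<in> carrier_vec N" using B by simp
    have "?M *\<^sub>v ?u = ?v" using MB assoc_mult_mat_vec[OF M B, of ?v] by simp
    then have "of_real (q ?u) = (\<Sum>i<N. cnj (vec_index ?u i) * \<phi> i x)"
      using gram_quadratic_form[OF u, of \<phi> X w] by (simp add: q_def L_def)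
    also have "\<dots> = cnj (b x)" unfolding b_def L_def by (simp add: mult.commute)
    finally show ?thesis by (metis complex_cnj_cnj complex_cnj_complex_of_real)
  qed
  define \<beta> where "\<beta> = (\<lambda>x. Re (b x))"
  have b\<beta>: "b x = of_real (\<beta> x)" for x by (simp add: \<beta>_def bq)
  have \<beta>0: "\<beta> x \<ge> 0" for x by (simp add: \<beta>_def bq q0)
  \<comment> \<open>This trace is the derivative of the logarithm of the determinant at
    \<open>w\<close> in the direction \<open>w'\<close>; the \<open>\<beta> x\<close> are its
    coefficients.\<close>
  have tr: "mat_trace (B * gram N \<phi> X w') = of_real (\<Sum>x\<in>X. w' x * \<beta> x)" for w'
  proof -
    have "mat_trace (B * gram N \<phi> X w') =
        (\<Sum>i<N. \<Sum>j<N. \<Sum>x\<in>X. of_real (w' x) * (cnj (\<phi> i x) * (B $$ (i, j) * \<phi> j x)))"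
    proof -
      have "mat_trace (B * gram N \<phi> X w') = (\<Sum>i<N. (B * gram N \<phi> X w') $$ (i, i))"
        using B unfolding mat_trace_def by simp
      also have "\<dots> = (\<Sum>i<N. \<Sum>j<N. B $$ (i, j) * gram N \<phi> X w' $$ (j, i))"
        by (intro sum.cong refl mat_mult_index[OF B gram_carrier]) auto
      finally show ?thesis by (simp add: gram_def sum_distrib_left mult_ac)
    qed
    also have "\<dots> = (\<Sum>i<N. \<Sum>x\<in>X. \<Sum>j<N. of_real (w' x) * (cnj (\<phi> i x) * (B $$ (i, j) * \<phi> j x)))"
      by (intro sum.cong refl sum.swap)
    also have "\<dots> = (\<Sum>x\<in>X. \<Sum>i<N. \<Sum>j<N. of_real (w' x) * (cnj (\<phi> i x) * (B $$ (i, j) * \<phi> j x)))"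
      by (rule sum.swap)
    also have "\<dots> = (\<Sum>x\<in>X. of_real (w' x) * b x)"
      unfolding b_def L_def using B
      by (intro sum.cong refl) (auto simp: scalar_prod_def atLeast0LessThan sum_distrib_left intro!: sum.cong)
    finally show ?thesis by (simp add: b\<beta>)
  qed
  have "of_real (\<Sum>x\<in>X. w x * \<beta> x) = (of_nat N :: complex)"
    unfolding tr[symmetric] BM by (simp add: mat_trace_def)
  then have sum: "(\<Sum>x\<in>X. w x * \<beta> x) = real N" using of_real_eq_iff[where 'a=complex] by (metis of_real_of_nat_eq)
  have main: "cmod (Determinant.det (gram N \<phi> X w')) \<le>
        cmod (Determinant.det ?M) * exp ((\<Sum>x\<in>X. w' x * \<beta> x) - real N)"
    if w': "\<And>x. x \<in> X \<Longrightarrow> w' x \<ge> 0" for w'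
  proof -
    let ?M' = "gram N \<phi> X w'"
    have M': "?M' \<in> carrier_mat N N" by simp
    have BM': "B * ?M' \<in> carrier_mat N N" using B by simp
    obtain es where es: "length es = N" "Determinant.det (B * ?M') = prod_list es"
      "mat_trace (B * ?M') = sum_list es" "\<And>e. e \<in> set es \<Longrightarrow> eigenvalue (B * ?M') e"
      using det_trace_eigenvalues[OF BM'] by blast
    \<comment> \<open>An eigenvector of \<open>B * ?M'\<close> satisfies
      \<open>?M' *\<^sub>v v = e \<cdot>\<^sub>v (?M *\<^sub>v v)\<close>, so \<open>e\<close> is a
      quotient of two nonnegative quadratic forms.\<close>
    have ev: "e = of_real (Re e) \<and> Re e \<ge> 0" if "e \<in> set es" for e
    proof -
      from es(4)[OF that] obtain v where v: "v \<in> carrier_vec N" "v \<noteq> 0\<^sub>v N" "B * ?M' *\<^sub>v v = e \<cdot>\<^sub>v v"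
        unfolding eigenvalue_def eigenvector_def using B by auto
      have v'c: "?M' *\<^sub>v v \<in> carrier_vec N" using v(1) by (meson M' mult_mat_vec_carrier)
      have "?M' *\<^sub>v v = (?M * B) *\<^sub>v (?M' *\<^sub>v v)" using v'c MB by simp
      also have "\<dots> = ?M *\<^sub>v (B *\<^sub>v (?M' *\<^sub>v v))" using assoc_mult_mat_vec[OF M B v'c] by simp
      also have "\<dots> = ?M *\<^sub>v (e \<cdot>\<^sub>v v)" using v(3) assoc_mult_mat_vec[OF B M' v(1)] by simp
      also have "\<dots> = e \<cdot>\<^sub>v (?M *\<^sub>v v)" using mult_mat_vec[OF M v(1)] by simp
      finally have eq: "?M' *\<^sub>v v = e \<cdot>\<^sub>v (?M *\<^sub>v v)" .
      have dm: "dim_vec (?M *\<^sub>v v) = N" by (simp add: gram_def)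
      have 1: "of_real (\<Sum>x\<in>X. w' x * (cmod (L x v))\<^sup>2) = e * of_real (q v)"
      proof -
        have "of_real (\<Sum>x\<in>X. w' x * (cmod (L x v))\<^sup>2) =
            (\<Sum>i<N. cnj (vec_index v i) * vec_index (e \<cdot>\<^sub>v (?M *\<^sub>v v)) i)"
          unfolding L_def gram_quadratic_form[OF v(1), symmetric] eq ..
        also have "\<dots> = (\<Sum>i<N. e * (cnj (vec_index v i) * vec_index (?M *\<^sub>v v) i))"
          by (intro sum.cong refl) (subst index_smult_vec(1), use dm in auto)
        also have "\<dots> = e * of_real (q v)"
          unfolding sum_distrib_left[symmetric] gram_quadratic_form[OF v(1)] q_def L_def ..
        finally show ?thesis .
      qed
      \<comment> \<open>If the form vanished, every term with positive weight would vanish, and then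
        \<open>?M\<close> would annihilate \<open>v\<close>, against invertibility.\<close>
      have "q v \<noteq> 0"
      proof
        assume "q v = 0"
        then have z: "w x * (cmod (L x v))\<^sup>2 = 0" if "x \<in> X" for x
          using that fin w unfolding q_def by (subst (asm) sum_nonneg_eq_0_iff) auto
        have "?M *\<^sub>v v = 0\<^sub>v N"
        proof (intro eq_vecI)
          fix i assume i: "i < dim_vec (0\<^sub>v N :: complex vec)"
          have "vec_index (?M *\<^sub>v v) i = (\<Sum>x\<in>X. of_real (w x) * \<phi> i x * L x v)"
            using gram_mult_vec[OF v(1), of i \<phi> X w] i by (simp add: L_def)
          also have "\<dots> = 0" using z by (intro sum.neutral) auto
          finally show "vec_index (?M *\<^sub>v v) i = vec_index (0\<^sub>v N) i" using i by simp
        qed (simp add: gram_def)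
        then have "B * ?M *\<^sub>v v = 0\<^sub>v N" using assoc_mult_mat_vec[OF B M v(1)] B
          by (auto intro!: eq_vecI simp: scalar_prod_def)
        then show False using BM v by simp
      qed
      then have "e = of_real ((\<Sum>x\<in>X. w' x * (cmod (L x v))\<^sup>2) / q v)" using 1 by (simp add: field_simps)
      moreover have "(\<Sum>x\<in>X. w' x * (cmod (L x v))\<^sup>2) / q v \<ge> 0"
        using q0 w' by (auto intro!: divide_nonneg_nonneg sum_nonneg)
      ultimately show ?thesis by (metis Re_complex_of_real)
    qed
    define rs where "rs = map Re es"
    have er: "es = map of_real rs" unfolding rs_def using ev by (auto simp: o_def intro!: map_idI[symmetric])
    have rl: "prod_list es = of_real (prod_list rs)" "sum_list es = of_real (sum_list rs)"
      unfolding er by (induction rs) auto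
    have r0: "r \<ge> 0" if "r \<in> set rs" for r using that ev unfolding rs_def by auto
    have "of_real (sum_list rs) = (of_real (\<Sum>x\<in>X. w' x * \<beta> x) :: complex)"
      using es(3) rl(2) tr[of w'] by simp
    then have sl: "sum_list rs = (\<Sum>x\<in>X. w' x * \<beta> x)" using of_real_eq_iff by blast
    have le: "0 \<le> prod_list rs" "prod_list rs \<le> exp ((\<Sum>x\<in>X. w' x * \<beta> x) - real N)"
      using prod_list_le_exp[of rs] r0 sl es(1) er by auto
    have "?M' = ?M * (B * ?M')" using assoc_mult_mat[OF M B M'] MB left_mult_one_mat[OF M'] by simp
    then have "Determinant.det ?M' = Determinant.det ?M * of_real (prod_list rs)"
      using det_mult[OF M BM'] es(2) rl(1) by simp
    then show ?thesis using le by (simp add: norm_mult mult_left_mono)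
  qed
  show ?thesis using that[of \<beta>] \<beta>0 sum main by blast
qed

section \<open>Partition functions as determinants\<close>

lemma permutes_lessThan: "p permutes {..<N} \<Longrightarrow> i < N \<Longrightarrow> p i < (N :: nat)"
  using permutes_in_image[of p "{..<N}" i] by simp

lemma vandermonde_permute:
  assumes p: "p permutes {0..<N}"
  shows "Determinant.det (mat N N (\<lambda>(i, j). \<phi> i (a (p j)))) =
    signof p * Determinant.det (mat N N (\<lambda>(i, j). \<phi> i (a j) :: complex))"
proof -
  let ?A = "mat N N (\<lambda>(i, j). \<phi> i (a j))" and ?At = "mat N N (\<lambda>(j, i). \<phi> i (a j))"
  have lt: "p i < N" if "i < N" for i using permutes_in_image[OF p, of i] that by simp
  have "Determinant.det (mat N N (\<lambda>(i, j). \<phi> i (a (p j)))) =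
      Determinant.det (mat N N (\<lambda>(j, i). ?At $$ (p j, i)))"
    by (subst det_transpose[symmetric, of _ N]) (auto simp: lt intro!: arg_cong[of _ _ Determinant.det] eq_matI)
  also have "\<dots> = signof p * Determinant.det ?At" by (rule det_permute_rows[OF _ p]) simp
  also have "Determinant.det ?At = Determinant.det ?A"
    by (subst det_transpose[symmetric, of _ N]) (auto intro!: arg_cong[of _ _ Determinant.det] eq_matI)
  finally show ?thesis .
qed

text \<open>A Cauchy-Binet formula. One of the two determinant factors is expanded over
  permutations, and relabelling the tuple shows that all \<open>N!\<close> terms agree. In the
  remaining term, expanding the conjugate factor lets the sum over tuples split into
  \<open>N\<close> sums over \<open>X\<close>.\<close>

lemma andreief:
  fixes \<phi> :: "nat \<Rightarrow> 'a \<Rightarrow> complex" and w :: "'a \<Rightarrow> real"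
  assumes fin: "finite X"
  shows "(\<Sum>a\<in>{..<N} \<rightarrow>\<^sub>E X. of_real ((cmod (Determinant.det (mat N N (\<lambda>(i, j). \<phi> i (a j)))))\<^sup>2
      * (\<Prod>j<N. w (a j)))) = fact N * Determinant.det (gram N \<phi> X w)"
proof -
  let ?P = "{p. p permutes {0..<N}}" and ?E = "{..<N} \<rightarrow>\<^sub>E X"
  define D where "D = (\<lambda>a. Determinant.det (mat N N (\<lambda>(i, j). \<phi> i (a j))))"
  define W where "W = (\<lambda>a. of_real (\<Prod>j<N. w (a j)) :: complex)"
  have Dl: "D a = (\<Sum>p\<in>?P. signof p * (\<Prod>i<N. \<phi> i (a (p i))))" for a
  proof -
    have "D a = (\<Sum>p\<in>?P. signof p * (\<Prod>i=0..<N. (mat N N (\<lambda>(i, j). \<phi> i (a j))) $$ (i, p i)))"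
      unfolding D_def by (rule det_def') simp
    also have "\<dots> = (\<Sum>p\<in>?P. signof p * (\<Prod>i<N. \<phi> i (a (p i))))"
      unfolding atLeast0LessThan
      by (intro sum.cong refl arg_cong2[of _ _ _ _ "(*)"] prod.cong) (auto simp: permutes_lessThan)
    finally show ?thesis .
  qed
  have perm: "bij_betw (\<lambda>a. restrict (a \<circ> p) {..<N}) ?E ?E" if p: "p permutes {0..<N}" for p
  proof -
    let ?r = "\<lambda>p a. restrict (a \<circ> p) {..<N} :: nat \<Rightarrow> 'a"
    let ?q = "Hilbert_Choice.inv p"
    note ip = permutes_inv[OF p]
    have lt: "p i < N" "?q i < N" if "i < N" for i
      using permutes_in_image[OF p, of i] permutes_in_image[OF ip, of i] that by auto
    have pq: "p (?q i) = i" "?q (p i) = i" for i using permutes_inverses[OF p] by auto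
    have m: "?r p \<in> ?E \<rightarrow> ?E" "?r ?q \<in> ?E \<rightarrow> ?E" using lt by (auto simp: PiE_iff)
    have 1: "?r ?q (?r p x) = x" if "x \<in> ?E" for x
    proof
      fix i show "?r ?q (?r p x) i = x i"
        using that lt pq by (cases "i < N") (auto simp: PiE_iff extensional_def)
    qed
    have 2: "?r p (?r ?q x) = x" if "x \<in> ?E" for x
    proof
      fix i show "?r p (?r ?q x) i = x i"
        using that lt pq by (cases "i < N") (auto simp: PiE_iff extensional_def)
    qed
    show ?thesis by (intro bij_betwI[where g = "?r ?q"] m 1 2)
  qed
  have csg: "cnj (signof p) = (signof p :: complex)" for p :: "nat \<Rightarrow> nat" by (simp add: sign_def)
  have Dperm: "D (restrict (a \<circ> p) {..<N}) = signof p * D a" if p: "p permutes {0..<N}" for a p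
  proof -
    have "D (restrict (a \<circ> p) {..<N}) = Determinant.det (mat N N (\<lambda>(i, j). \<phi> i (a (p j))))"
      unfolding D_def by (auto intro!: arg_cong[of _ _ Determinant.det] eq_matI)
    then show ?thesis using vandermonde_permute[OF p, of \<phi> a] by (simp add: D_def)
  qed
  have Wperm: "W (restrict (a \<circ> p) {..<N}) = W a" if p: "p permutes {0..<N}" for a p
  proof -
    have "(\<Prod>j<N. w (restrict (a \<circ> p) {..<N} j)) = (\<Prod>j<N. w (a (p j)))" by simp
    also have "\<dots> = (\<Prod>j<N. w (a j))"
      using prod.permute[OF p, of "\<lambda>j. w (a j)"] by (simp add: atLeast0LessThan o_def)
    finally show ?thesis unfolding W_def by simp
  qed
  \<comment> \<open>The contribution of the identity permutation to the expansion of the first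
    factor.\<close>
  define T where "T = (\<Sum>a\<in>?E. (\<Prod>i<N. \<phi> i (a i)) * cnj (D a) * W a)"
  have "(\<Sum>a\<in>?E. of_real ((cmod (D a))\<^sup>2 * (\<Prod>j<N. w (a j)))) = (\<Sum>a\<in>?E. D a * cnj (D a) * W a)"
    unfolding W_def of_real_mult complex_norm_square ..
  also have "\<dots> = (\<Sum>a\<in>?E. \<Sum>p\<in>?P. signof p * (\<Prod>i<N. \<phi> i (a (p i))) * cnj (D a) * W a)"
    by (subst (1) Dl) (simp add: sum_distrib_right)
  also have "\<dots> = (\<Sum>p\<in>?P. \<Sum>a\<in>?E. signof p * (\<Prod>i<N. \<phi> i (a (p i))) * cnj (D a) * W a)"
    by (rule sum.swap)
  \<comment> \<open>Relabelling the tuples in \<open>T\<close> by \<open>p\<close> makes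
    \<open>cnj (D a)\<close> contribute \<open>signof p\<close>, exactly the sign in the
    expansion.\<close>
  also have "\<dots> = (\<Sum>p\<in>?P. T)"
  proof (intro sum.cong refl)
    fix p assume "p \<in> ?P"
    then have p: "p permutes {0..<N}" by simp
    have "T = (\<Sum>a\<in>?E. (\<Prod>i<N. \<phi> i (restrict (a \<circ> p) {..<N} i)) * cnj (D (restrict (a \<circ> p) {..<N}))
        * W (restrict (a \<circ> p) {..<N}))"
      unfolding T_def by (rule sum.reindex_bij_betw[OF perm[OF p], symmetric])
    also have "\<dots> = (\<Sum>a\<in>?E. signof p * (\<Prod>i<N. \<phi> i (a (p i))) * cnj (D a) * W a)"
      unfolding Dperm[OF p] Wperm[OF p] by (simp add: csg mult_ac del: o_apply) (simp add: o_def)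
    finally show "(\<Sum>a\<in>?E. signof p * (\<Prod>i<N. \<phi> i (a (p i))) * cnj (D a) * W a) = T" ..
  qed
  also have "\<dots> = fact N * T" using card_permutations[OF refl, of "{0..<N}"] by simp
  also have "T = Determinant.det (gram N \<phi> X w)"
  proof -
    have Dt: "cnj (D a) = (\<Sum>p\<in>?P. signof p * (\<Prod>i<N. cnj (\<phi> (p i) (a i))))" for a
    proof -
      \<comment> \<open>The expansion over columns, so that both determinant factors are indexed by
        the position \<open>i\<close> of the point \<open>a i\<close>.\<close>
      have "D a = (\<Sum>p\<in>?P. signof p * (\<Prod>i=0..<N. (mat N N (\<lambda>(i, j). \<phi> i (a j))) $$ (p i, i)))"
        unfolding D_def by (subst mat_det_left_def[of _ N]) simp_all
      also have "\<dots> = (\<Sum>p\<in>?P. signof p * (\<Prod>i<N. \<phi> (p i) (a i)))"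
        unfolding atLeast0LessThan
        by (intro sum.cong refl arg_cong2[of _ _ _ _ "(*)"] prod.cong) (auto simp: permutes_lessThan)
      finally show ?thesis by (simp add: csg)
    qed
    have "T = (\<Sum>a\<in>?E. \<Sum>p\<in>?P. signof p * (\<Prod>i<N. of_real (w (a i)) * \<phi> i (a i) * cnj (\<phi> (p i) (a i))))"
      unfolding T_def Dt W_def
      by (intro sum.cong refl)
        (simp add: sum_distrib_left sum_distrib_right prod.distrib mult_ac)
    also have "\<dots> = (\<Sum>p\<in>?P. signof p * (\<Sum>a\<in>?E. \<Prod>i<N. of_real (w (a i)) * \<phi> i (a i) * cnj (\<phi> (p i) (a i))))"
      by (subst sum.swap) (simp add: sum_distrib_left)
    also have "\<dots> = (\<Sum>p\<in>?P. signof p * (\<Prod>i<N. \<Sum>x\<in>X. of_real (w x) * \<phi> i x * cnj (\<phi> (p i) x)))"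
      using fin by (subst prod_sum_PiE) auto
    also have "\<dots> = (\<Sum>p\<in>?P. signof p * (\<Prod>i=0..<N. gram N \<phi> X w $$ (i, p i)))"
      unfolding atLeast0LessThan gram_def
      by (intro sum.cong refl arg_cong2[of _ _ _ _ "(*)"] prod.cong) (auto simp: permutes_lessThan)
    also have "\<dots> = Determinant.det (gram N \<phi> X w)" by (rule det_def'[symmetric]) simp
    finally show ?thesis .
  qed
  finally show ?thesis unfolding D_def .
qed

text \<open>\<open>p\<close> is the intensity of the process with weight \<open>w\<close>, and the
  right-hand side is the value for a Poisson process of the same intensity, which dominates. It is
  the tangent bound at \<open>w\<close> for the weight \<open>w x * e x\<close>.\<close>

lemma determinantal_exponential_moments:
  fixes \<phi> :: "nat \<Rightarrow> 'a \<Rightarrow> complex" and w :: "'a \<Rightarrow> real" and N :: nat and X :: "'a set"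
  defines "Z \<equiv> \<lambda>u. \<Sum>a\<in>{..<N} \<rightarrow>\<^sub>E X. (cmod (Determinant.det (mat N N (\<lambda>(i, j). \<phi> i (a j)))))\<^sup>2 * (\<Prod>j<N. u (a j))"
  assumes fin: "finite X" and w: "\<And>x. x \<in> X \<Longrightarrow> w x \<ge> 0" and nz: "Z w \<noteq> 0"
  obtains p :: "'a \<Rightarrow> real" where "\<And>x. x \<in> X \<Longrightarrow> p x \<ge> 0" "(\<Sum>x\<in>X. p x) = real N"
    "\<And>e. (\<And>x. x \<in> X \<Longrightarrow> e x \<ge> 0) \<Longrightarrow>
      Z (\<lambda>x. w x * e x) \<le> Z w * exp (\<Sum>x\<in>X. p x * (e x - 1))"
proof -
  have Zg: "of_real (Z u) = fact N * Determinant.det (gram N \<phi> X u)" for u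
    using andreief[OF fin, of N \<phi> u] unfolding Z_def of_real_sum .
  have Zc: "Z u = fact N * cmod (Determinant.det (gram N \<phi> X u))" if "\<And>x. x \<in> X \<Longrightarrow> u x \<ge> 0" for u
  proof -
    have "Z u \<ge> 0" unfolding Z_def using that
      by (intro sum_nonneg mult_nonneg_nonneg prod_nonneg) (auto simp: PiE_iff)
    then have "Z u = cmod (of_real (Z u))" by simp
    then show ?thesis unfolding Zg by (simp add: norm_mult)
  qed
  have "Determinant.det (gram N \<phi> X w) \<noteq> 0" using Zg[of w] nz by auto
  from det_gram_tangent[OF w this fin] obtain \<beta> where \<beta>: "\<And>x. x \<in> X \<Longrightarrow> \<beta> x \<ge> 0"
    "(\<Sum>x\<in>X. w x * \<beta> x) = real N"
    "\<And>w'. (\<And>x. x \<in> X \<Longrightarrow> w' x \<ge> 0) \<Longrightarrow>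
      cmod (Determinant.det (gram N \<phi> X w')) \<le>
        cmod (Determinant.det (gram N \<phi> X w)) * exp ((\<Sum>x\<in>X. w' x * \<beta> x) - real N)"
    by blast
  show ?thesis
  proof (rule that[of "\<lambda>x. w x * \<beta> x"])
    show "w x * \<beta> x \<ge> 0" if "x \<in> X" for x using w \<beta>(1) that by simp
    show "(\<Sum>x\<in>X. w x * \<beta> x) = real N" by (rule \<beta>(2))
    fix e :: "'a \<Rightarrow> real" assume e: "\<And>x. x \<in> X \<Longrightarrow> e x \<ge> 0"
    have we: "w x * e x \<ge> 0" if "x \<in> X" for x using w e that by simp
    have "(\<Sum>x\<in>X. w x * e x * \<beta> x) - real N = (\<Sum>x\<in>X. w x * \<beta> x * (e x - 1))"
      unfolding \<beta>(2)[symmetric] by (simp add: sum_subtractf[symmetric] algebra_simps)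
    then show "Z (\<lambda>x. w x * e x) \<le> Z w * exp (\<Sum>x\<in>X. w x * \<beta> x * (e x - 1))"
      using \<beta>(3)[of "\<lambda>x. w x * e x"] Zc[of "\<lambda>x. w x * e x"] Zc[of w] we w by (simp add: mult.assoc)
  qed
qed

section \<open>Concentration of linear statistics\<close>

lemma exp_le_quadratic: "exp u \<le> 1 + u + u\<^sup>2" if "\<bar>u\<bar> \<le> 1" for u :: real
proof (cases "u \<ge> 0")
  case True
  then show ?thesis using exp_bound[of u] that by simp
next
  case False
  define y where "y = - u"
  have y: "y > 0" "u = - y" using False by (auto simp: y_def)
  have "1 + y + y\<^sup>2 / 2 \<le> exp y" using exp_lower_Taylor_quadratic[of y] y by simp
  \<comment> \<open>Taking reciprocals turns the claim for negative \<open>u\<close> into a lower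
    bound for \<open>exp y\<close>. The product has only nonnegative terms besides 1.\<close>
  moreover have "1 \<le> (1 - y + y\<^sup>2) * (1 + y + y\<^sup>2 / 2)"
  proof -
    have "(1 - y + y\<^sup>2) * (1 + y + y\<^sup>2 / 2) = 1 + (y\<^sup>2 + y ^ 3 + y ^ 4) / 2"
      by (simp add: field_simps power2_eq_square power3_eq_cube power4_eq_xxxx)
    then show ?thesis using y by (simp add: add_nonneg_nonneg)
  qed
  moreover have "1 - y + y\<^sup>2 \<ge> 0"
  proof -
    have "1 - y + y\<^sup>2 = (y - 1/2)\<^sup>2 + 3/4" by (simp add: power2_eq_square algebra_simps)
    then show ?thesis by simp
  qed
  ultimately have "1 \<le> (1 - y + y\<^sup>2) * exp y" by (meson mult_left_mono order_trans)
  then have "1 / exp y \<le> 1 - y + y\<^sup>2" by (subst pos_divide_le_eq) simp_all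
  then show ?thesis using y by (simp add: exp_minus inverse_eq_divide)
qed

text \<open>\<open>y i\<close> is the mean of the \<open>i\<close>-th statistic per point. By
  Chernoff's bound each of the \<open>2 * m\<close> one-sided deviations beyond
  \<open>\<delta>\<close> carries at most the fraction \<open>exp (- N * \<delta>^2 / 4)\<close> of
  the total weight. The assumption \<open>large\<close> leaves half of the weight on good tuples, of
  which there are at most \<open>card X ^ N\<close>, so one of them is heavy.\<close>

lemma determinantal_selection:
  fixes \<phi> :: "nat \<Rightarrow> 'a \<Rightarrow> complex" and w :: "'a \<Rightarrow> real" and N m :: nat and X :: "'a set"
    and f :: "nat \<Rightarrow> 'a \<Rightarrow> real"
  defines "W \<equiv> \<lambda>u a. (cmod (Determinant.det (mat N N (\<lambda>(i, j). \<phi> i (a j)))))\<^sup>2 * (\<Prod>j<N. u (a j))"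
  defines "Z \<equiv> \<lambda>u. \<Sum>a\<in>{..<N} \<rightarrow>\<^sub>E X. W u a"
  assumes fin: "finite X" and w: "\<And>x. x \<in> X \<Longrightarrow> w x \<ge> 0" and nz: "Z w > 0" and N: "N > 0"
    and f: "\<And>i x. i < m \<Longrightarrow> x \<in> X \<Longrightarrow> \<bar>f i x\<bar> \<le> 1" and \<delta>: "0 < \<delta>" "\<delta> \<le> 1"
    and large: "2 * real m * exp (- real N * \<delta>\<^sup>2 / 4) \<le> 1 / 2"
  obtains y a where
    "\<And>i u. i < m \<Longrightarrow> \<bar>u\<bar> \<le> 1 \<Longrightarrow> Z (\<lambda>x. w x * exp (u * f i x)) \<le> Z w * exp (real N * (u * y i + u\<^sup>2))"
    "a \<in> {..<N} \<rightarrow>\<^sub>E X" "\<And>i. i < m \<Longrightarrow> \<bar>(\<Sum>j<N. f i (a j)) / real N - y i\<bar> \<le> \<delta>"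
    "W w a \<ge> Z w / (2 * real (card X) ^ N)"
proof -
  let ?E = "{..<N} \<rightarrow>\<^sub>E X"
  have "(\<Sum>a\<in>?E. (cmod (Determinant.det (mat N N (\<lambda>(i, j). \<phi> i (a j)))))\<^sup>2 * (\<Prod>j<N. w (a j))) \<noteq> 0"
    using nz unfolding Z_def W_def by simp
  from determinantal_exponential_moments[OF fin w this]
  obtain p where p: "\<And>x. x \<in> X \<Longrightarrow> p x \<ge> 0" "(\<Sum>x\<in>X. p x) = real N"
    "\<And>e. (\<And>x. x \<in> X \<Longrightarrow> e x \<ge> 0) \<Longrightarrow> Z (\<lambda>x. w x * e x) \<le> Z w * exp (\<Sum>x\<in>X. p x * (e x - 1))"
    unfolding Z_def W_def by blast
  define y where "y = (\<lambda>i. (\<Sum>x\<in>X. p x * f i x) / real N)"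
  have moment: "Z (\<lambda>x. w x * exp (u * f i x)) \<le> Z w * exp (real N * (u * y i + u\<^sup>2))" if i: "i < m" and u: "\<bar>u\<bar> \<le> 1" for i u
  proof -
    have "(\<Sum>x\<in>X. p x * (exp (u * f i x) - 1)) \<le> (\<Sum>x\<in>X. p x * (u * f i x + u\<^sup>2))"
    proof (intro sum_mono mult_left_mono p(1))
      fix x assume x: "x \<in> X"
      have "\<bar>u * f i x\<bar> \<le> 1" using u f[OF i x] by (simp add: abs_mult mult_le_one)
      then have "exp (u * f i x) - 1 \<le> u * f i x + (u * f i x)\<^sup>2" using exp_le_quadratic[of "u * f i x"] by simp
      also have "(u * f i x)\<^sup>2 \<le> u\<^sup>2"
        using f[OF i x] by (simp add: power_mult_distrib mult_left_le abs_square_le_1)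
      finally show "exp (u * f i x) - 1 \<le> u * f i x + u\<^sup>2" by simp
    qed
    also have "\<dots> = u * (\<Sum>x\<in>X. p x * f i x) + u\<^sup>2 * (\<Sum>x\<in>X. p x)"
      by (simp add: distrib_left sum.distrib sum_distrib_left sum_distrib_right mult_ac)
    also have "\<dots> = real N * (u * y i + u\<^sup>2)" using N p(2) by (simp add: y_def field_simps)
    finally have "exp (\<Sum>x\<in>X. p x * (exp (u * f i x) - 1)) \<le> exp (real N * (u * y i + u\<^sup>2))" by simp
    then show ?thesis using p(3)[of "\<lambda>x. exp (u * f i x)"] nz by (meson exp_ge_zero less_imp_le mult_left_mono order_trans)
  qed
  have W0: "W w a \<ge> 0" if "a \<in> ?E" for a
    unfolding W_def using that w by (intro mult_nonneg_nonneg prod_nonneg) (auto simp: PiE_iff)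
  \<comment> \<open>The sign \<open>s\<close>, which is 1 or -1, treats deviations above and below
    \<open>y i\<close> together.\<close>
  define bad where "bad = (\<lambda>(i, s). {a \<in> ?E. s * (\<Sum>j<N. f i (a j)) > s * real N * y i + real N * \<delta>})"
  have finE: "finite ?E" using fin by (intro finite_PiE) auto
  have badle: "(\<Sum>a\<in>bad (i, s). W w a) \<le> Z w * exp (- real N * \<delta>\<^sup>2 / 4)" if i: "i < m" and s: "\<bar>s\<bar> = 1" for i s
  proof -
    \<comment> \<open>This choice minimizes the Chernoff exponent
      \<open>N * (u^2 - \<bar>u\<bar> * \<delta>)\<close>.\<close>
    let ?u = "s * (\<delta> / 2)"
    let ?c = "exp (- (\<delta> / 2) * (s * real N * y i + real N * \<delta>))"
    have "(\<Sum>a\<in>bad (i, s). W w a) \<le> (\<Sum>a\<in>?E. W (\<lambda>x. w x * exp (?u * f i x)) a * ?c)"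
    proof (rule sum_le_included[where i = id])
      show "\<forall>a\<in>bad (i, s). \<exists>b\<in>?E. id b = a \<and> W w a \<le> W (\<lambda>x. w x * exp (?u * f i x)) b * ?c"
      proof
        fix a assume a: "a \<in> bad (i, s)"
        then have aE: "a \<in> ?E" by (simp add: bad_def)
        have Wa: "W (\<lambda>x. w x * exp (?u * f i x)) a = W w a * exp (?u * (\<Sum>j<N. f i (a j)))"
          unfolding W_def prod.distrib sum_distrib_left by (simp add: exp_sum)
        have "\<delta> / 2 * (s * real N * y i + real N * \<delta>) \<le> \<delta> / 2 * (s * (\<Sum>j<N. f i (a j)))"
          using a \<delta> by (intro mult_left_mono) (auto simp: bad_def)
        then have "1 \<le> exp (?u * (\<Sum>j<N. f i (a j))) * ?c"
          unfolding exp_add[symmetric] by (simp add: algebra_simps)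
        then have "W w a * 1 \<le> W w a * (exp (?u * (\<Sum>j<N. f i (a j))) * ?c)" by (intro mult_left_mono W0 aE)
        then have "W w a \<le> W (\<lambda>x. w x * exp (?u * f i x)) a * ?c"
          by - (unfold Wa, simp only: mult_1_right mult.assoc)
        then show "\<exists>b\<in>?E. id b = a \<and> W w a \<le> W (\<lambda>x. w x * exp (?u * f i x)) b * ?c"
          using aE unfolding id_apply by blast
      qed
      show "\<forall>a\<in>?E. 0 \<le> W (\<lambda>x. w x * exp (?u * f i x)) a * ?c"
        unfolding W_def using w by (auto intro!: mult_nonneg_nonneg prod_nonneg simp: PiE_iff)
    qed (use finE in \<open>auto simp: bad_def\<close>)
    also have "\<dots> = Z (\<lambda>x. w x * exp (?u * f i x)) * ?c" by (simp add: Z_def sum_distrib_right)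
    also have "\<dots> \<le> Z w * exp (real N * (?u * y i + ?u\<^sup>2)) * ?c"
      using \<delta> s by (intro mult_right_mono moment i) (auto simp: abs_mult)
    also have "\<dots> = Z w * exp (real N * (?u * y i + ?u\<^sup>2) + - (\<delta> / 2) * (s * real N * y i + real N * \<delta>))"
      by (simp only: mult.assoc exp_add)
    also have "real N * (?u * y i + ?u\<^sup>2) + - (\<delta> / 2) * (s * real N * y i + real N * \<delta>) = - real N * \<delta>\<^sup>2 / 4"
    proof -
      have "s\<^sup>2 = 1" using s by (simp add: abs_square_eq_1)
      then have "?u\<^sup>2 = \<delta>\<^sup>2 / 4" by (simp only: power_mult_distrib power_divide) simp
      then show ?thesis by (simp only:) (simp add: field_simps power2_eq_square)
    qed
    finally show ?thesis .
  qed
  define I where "I = {..<m} \<times> {1, -1 :: real}"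
  define good where "good = ?E - (\<Union>c\<in>I. bad c)"
  have cardI: "card I = 2 * m" "finite I" by (auto simp: I_def card_cartesian_product)
  have "(\<Sum>a\<in>(\<Union>c\<in>I. bad c). W w a) \<le> (\<Sum>c\<in>I. \<Sum>a\<in>bad c. W w a)"
  proof -
    have "(\<Sum>a\<in>(\<Union>c\<in>I. bad c). W w a) \<le> (\<Sum>q\<in>Sigma I bad. W w (snd q))"
      by (rule sum_le_included[where i = snd]) (use cardI(2) finE W0 in \<open>auto simp: bad_def split: prod.splits\<close>)
    also have "\<dots> = (\<Sum>c\<in>I. \<Sum>a\<in>bad c. W w a)"
      using cardI(2) finE by (subst sum.Sigma) (auto simp: bad_def split_beta)
    finally show ?thesis .
  qed
  also have "\<dots> \<le> (\<Sum>c\<in>I. Z w * exp (- real N * \<delta>\<^sup>2 / 4))"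
    by (intro sum_mono) (use badle in \<open>auto simp: I_def\<close>)
  also have "\<dots> = Z w * (2 * real m * exp (- real N * \<delta>\<^sup>2 / 4))" by (simp add: cardI)
  also have "\<dots> \<le> Z w * (1 / 2)" using large nz by (intro mult_left_mono) auto
  finally have badsum: "(\<Sum>a\<in>(\<Union>c\<in>I. bad c). W w a) \<le> Z w / 2" by simp
  have "(\<Union>c\<in>I. bad c) \<subseteq> ?E" by (auto simp: bad_def)
  from sum.subset_diff[OF this finE, of "W w"] badsum
  have goodsum: "(\<Sum>a\<in>good. W w a) \<ge> Z w / 2" unfolding good_def Z_def by linarith
  have "\<exists>a\<in>good. W w a \<ge> Z w / (2 * real (card X) ^ N)"
  proof (rule ccontr)
    assume neg: "\<not> ?thesis"
    have gE: "good \<subseteq> ?E" by (auto simp: good_def)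
    have fg: "finite good" using finite_subset[OF gE finE] .
    have "good \<noteq> {}" using goodsum nz by auto
    then have cg: "card good > 0" using fg by (simp add: card_gt_0_iff)
    have "card good \<le> card ?E" by (rule card_mono[OF finE gE])
    also have "\<dots> = card X ^ N" by (simp add: card_PiE)
    finally have le: "real (card good) \<le> real (card X) ^ N" by (metis of_nat_le_iff of_nat_power)
    have "(\<Sum>a\<in>good. W w a) < (\<Sum>a\<in>good. Z w / (2 * real (card X) ^ N))"
      using neg fg \<open>good \<noteq> {}\<close> by (intro sum_strict_mono) (auto simp: not_le)
    also have "\<dots> = (Z w / 2) * (real (card good) / real (card X) ^ N)" by simp
    also have "\<dots> \<le> (Z w / 2) * 1"
      using le nz cg by (intro mult_left_mono) (auto simp: divide_le_eq_1)
    finally show False using goodsum by simp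
  qed
  then obtain a where a: "a \<in> good" "W w a \<ge> Z w / (2 * real (card X) ^ N)" by blast
  have aE: "a \<in> ?E" using a by (simp add: good_def)
  have "\<bar>(\<Sum>j<N. f i (a j)) / real N - y i\<bar> \<le> \<delta>" if i: "i < m" for i
  proof -
    have "a \<notin> bad (i, 1)" "a \<notin> bad (i, -1)" using a(1) i by (auto simp: good_def I_def)
    then have "(\<Sum>j<N. f i (a j)) \<le> real N * (y i + \<delta>)" "(\<Sum>j<N. f i (a j)) \<ge> real N * (y i - \<delta>)"
      using aE by (auto simp: bad_def not_less algebra_simps)
    then have "(\<Sum>j<N. f i (a j)) / real N \<le> y i + \<delta>" "(\<Sum>j<N. f i (a j)) / real N \<ge> y i - \<delta>"
      using N by (auto simp: divide_le_eq le_divide_eq mult.commute)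
    then show ?thesis by linarith
  qed
  from that[OF moment aE this a(2)] show ?thesis .
qed

section \<open>Subadditive functions on chains\<close>

text \<open>Passing from \<open>x\<close> to \<open>x + 1\<close> shifts the window of summation:
  \<open>x div q\<close> is lost and \<open>(x + q) div q\<close>, larger by one, is gained.\<close>

lemma hermite_identity: "(\<Sum>i<q. (x + i) div q) = (x :: nat)" if "q > 0"
proof (induction x)
  case 0
  show ?case by simp
next
  case (Suc x)
  have "(\<Sum>i<q. (Suc x + i) div q) + x div q = (\<Sum>i<Suc q. (x + i) div q)"
    unfolding sum.lessThan_Suc_shift by (simp add: add.commute)
  also have "\<dots> = x + (x + q) div q" using Suc by simp
  finally show ?case using that by simp
qed

text \<open>Partial sums turn multi-indices of degree at most \<open>k\<close> into these chains. In
  this form \<open>(S + i) div q\<close> again obeys the right bound, whereas dividing the entries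
  of a multi-index separately can exceed the degree bound.\<close>

definition mono_chains :: "nat \<Rightarrow> nat \<Rightarrow> (nat \<Rightarrow> nat) set" where
  "mono_chains n k = {S \<in> {..<n} \<rightarrow>\<^sub>E {..k}. mono_on {..<n} S}"

text \<open>Chains away from all walls: \<open>q * T l + c l - i\<close> is again such a chain for
  all remainders \<open>c\<close> and shifts \<open>i < q\<close>, so preimages under division can
  be counted exactly.\<close>

definition strict_chains :: "nat \<Rightarrow> nat \<Rightarrow> (nat \<Rightarrow> nat) set" where
  "strict_chains n k = {S \<in> {..<n} \<rightarrow>\<^sub>E {0<..<k}. strict_mono_on {..<n} S}"

lemma finite_mono_chains[simp]: "finite (mono_chains n k)" "finite (strict_chains n k)"
  unfolding mono_chains_def strict_chains_def by (auto intro!: finite_PiE)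

lemma strict_chains_subset: "strict_chains n k \<subseteq> mono_chains n k"
  unfolding mono_chains_def strict_chains_def by (force simp: strict_mono_on_imp_mono_on PiE_iff)

text \<open>Terms outside the image are nonpositive, so dropping them can only raise the sum. The
  comparisons between different heights below have this form.\<close>

lemma sum_le_injection:
  assumes "inj_on f I" "f ` I \<subseteq> J" "finite J" "\<And>S. S \<in> J \<Longrightarrow> g S \<le> (0 :: real)"
    and "\<And>S. S \<in> I \<Longrightarrow> g (f S) \<le> h S"
  shows "sum g J \<le> sum h I"
proof -
  have "sum g J = sum g (J - f ` I) + sum g (f ` I)" by (rule sum.subset_diff) (use assms in auto)
  also have "\<dots> \<le> sum g (f ` I)" using sum_nonpos[of "J - f ` I" g] assms(4) by simp
  also have "\<dots> = (\<Sum>S\<in>I. g (f S))" using assms(1) by (simp add: sum.reindex)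
  also have "\<dots> \<le> sum h I" by (intro sum_mono assms(5))
  finally show ?thesis .
qed

text \<open>\<open>a k S\<close> stands for the logarithm of a Chebyshev constant, shifted by a
  multiple of \<open>k\<close> that makes it nonpositive.\<close>

locale subadditive_on_chains =
  fixes n :: nat and a :: "nat \<Rightarrow> (nat \<Rightarrow> nat) \<Rightarrow> real"
  assumes nonpos: "S \<in> mono_chains n k \<Longrightarrow> a k S \<le> 0"
    and subadditive: "S \<in> mono_chains n k \<Longrightarrow> T \<in> mono_chains n l \<Longrightarrow>
      a (k + l) (\<lambda>i\<in>{..<n}. S i + T i) \<le> a k S + a l T"
begin

definition total :: "nat \<Rightarrow> real" where "total k = (\<Sum>S\<in>mono_chains n k. a k S)"
definition strict_total :: "nat \<Rightarrow> real" where "strict_total k = (\<Sum>S\<in>strict_chains n k. a k S)"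

lemma total_le_strict_total: "total k \<le> strict_total k"
proof -
  have "total k = (\<Sum>S\<in>mono_chains n k - strict_chains n k. a k S) + strict_total k"
    unfolding total_def strict_total_def by (rule sum.subset_diff) (use strict_chains_subset in auto)
  moreover have "(\<Sum>S\<in>mono_chains n k - strict_chains n k. a k S) \<le> 0"
    by (intro sum_nonpos) (auto intro: nonpos)
  ultimately show ?thesis by simp
qed

lemma inj_shift: "inj_on (\<lambda>S. \<lambda>i\<in>{..<n}. S i + (c i :: nat)) (mono_chains n k)"
proof (rule inj_onI)
  fix S T assume S: "S \<in> mono_chains n k" and T: "T \<in> mono_chains n k"
    and e: "(\<lambda>i\<in>{..<n}. S i + c i) = (\<lambda>i\<in>{..<n}. T i + c i)"
  show "S = T"
  proof
    fix i show "S i = T i" using fun_cong[OF e, of i] S T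
      by (cases "i < n") (auto simp: mono_chains_def PiE_iff extensional_def)
  qed
qed

text \<open>Raising the height by one costs the value at the zero chain of height 1, which is
  nonpositive.\<close>

lemma strict_total_Suc_le: "strict_total (Suc k) \<le> strict_total k"
  unfolding strict_total_def
proof (rule sum_le_injection)
  let ?f = "\<lambda>S. \<lambda>i\<in>{..<n}. S i + (\<lambda>_. 0 :: nat) i"
  show "inj_on ?f (strict_chains n k)" 
    by (rule inj_on_subset[OF inj_shift[of "\<lambda>_. 0" k] strict_chains_subset])
  show "?f ` strict_chains n k \<subseteq> strict_chains n (Suc k)"
    by (auto simp: strict_chains_def strict_mono_on_def PiE_iff less_SucI)
  fix S assume S: "S \<in> strict_chains n k"
  have z: "(\<lambda>i\<in>{..<n}. 0) \<in> mono_chains n (Suc 0)" by (auto simp: mono_chains_def mono_on_def)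
  have "?f S = (\<lambda>i\<in>{..<n}. S i + (\<lambda>i\<in>{..<n}. 0) i)" by auto
  then have "a (Suc k) (?f S) \<le> a k S + a (Suc 0) (\<lambda>i\<in>{..<n}. 0)"
    using subadditive[OF subsetD[OF strict_chains_subset S] z] by simp
  then show "a (Suc k) (?f S) \<le> a k S" using nonpos[OF z] by linarith
next
  show "a (Suc k) S \<le> 0" if "S \<in> strict_chains n (Suc k)" for S
    using nonpos subsetD[OF strict_chains_subset that] by blast
qed simp

lemma strict_total_antimono: "k \<le> l \<Longrightarrow> strict_total l \<le> strict_total k"
  by (rule lift_Suc_antimono_le[of strict_total]) (rule strict_total_Suc_le)

text \<open>Adding the chain \<open>1, ..., n\<close> makes a monotone chain strict and positive.
  The shift is \<open>Suc n\<close> because the top value \<open>k + n\<close> must stay strictly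
  below the new height.\<close>

lemma strict_total_le_total: "strict_total (k + Suc n) \<le> total k"
  unfolding strict_total_def total_def
proof (rule sum_le_injection)
  let ?f = "\<lambda>S. \<lambda>i\<in>{..<n}. S i + Suc i"
  show "inj_on ?f (mono_chains n k)" by (rule inj_shift)
  show "?f ` mono_chains n k \<subseteq> strict_chains n (k + Suc n)"
    by (auto simp: strict_chains_def mono_chains_def strict_mono_on_def mono_on_def PiE_iff
      intro!: add_le_less_mono)
  fix S assume S: "S \<in> mono_chains n k"
  have z: "(\<lambda>i\<in>{..<n}. Suc i) \<in> mono_chains n (Suc n)" by (auto simp: mono_chains_def mono_on_def)
  have "?f S = (\<lambda>i\<in>{..<n}. S i + (\<lambda>i\<in>{..<n}. Suc i) i)" by auto
  then have "a (k + Suc n) (?f S) \<le> a k S + a (Suc n) (\<lambda>i\<in>{..<n}. Suc i)"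
    using subadditive[OF S z] by simp
  then show "a (k + Suc n) (?f S) \<le> a k S" using nonpos[OF z] by linarith
next
  show "a (k + Suc n) S \<le> 0" if "S \<in> strict_chains n (k + Suc n)" for S
    using nonpos subsetD[OF strict_chains_subset that] by blast
qed simp

lemma subadditive_sum:
  assumes "\<And>i. i < q \<Longrightarrow> S i \<in> mono_chains n m"
  shows "(\<lambda>l\<in>{..<n}. \<Sum>i<q. S i l) \<in> mono_chains n (q * m) \<and>
    a (q * m) (\<lambda>l\<in>{..<n}. \<Sum>i<q. S i l) \<le> a 0 (\<lambda>l\<in>{..<n}. 0) + (\<Sum>i<q. a m (S i))"
  using assms
proof (induction q)
  case 0
  show ?case by (auto simp: mono_chains_def mono_on_def)
next
  case (Suc q)
  let ?T = "\<lambda>l\<in>{..<n}. \<Sum>i<q. S i l"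
  have IH: "?T \<in> mono_chains n (q * m) \<and> a (q * m) ?T \<le> a 0 (\<lambda>l\<in>{..<n}. 0) + (\<Sum>i<q. a m (S i))"
    by (rule Suc.IH) (use Suc.prems in auto)
  then have T: "?T \<in> mono_chains n (q * m)" ..
  have Sq: "S q \<in> mono_chains n m" using Suc.prems by simp
  have e: "(\<lambda>l\<in>{..<n}. \<Sum>i<Suc q. S i l) = (\<lambda>l\<in>{..<n}. ?T l + S q l)" by auto
  have "(\<lambda>l\<in>{..<n}. ?T l + S q l) \<in> mono_chains n (q * m + m)"
    using T Sq by (auto simp: mono_chains_def mono_on_def PiE_iff intro!: add_mono)
  moreover have "a (q * m) ?T \<le> a 0 (\<lambda>l\<in>{..<n}. 0) + (\<Sum>i<q. a m (S i))" using IH ..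
  moreover have "a (q * m + m) (\<lambda>l\<in>{..<n}. ?T l + S q l) \<le> a (q * m) ?T + a m (S q)"
    by (rule subadditive[OF T Sq])
  ultimately show ?case
    unfolding e mult_Suc add.commute[of m] sum.lessThan_Suc[of "\<lambda>i. a m (S i)"] by argo
qed

text \<open>Every chain \<open>S\<close> of height \<open>q m\<close> is the sum of the \<open>q\<close> chains \<open>(S + i) div q\<close> of height \<open>m\<close>,
  and for each \<open>i\<close> every strict chain of height \<open>m\<close> arises from exactly \<open>q ^ n\<close> strict chains.\<close>

lemma strict_total_mult_le:
  assumes q: "q > 0"
  shows "strict_total (q * m) \<le> real q ^ Suc n * strict_total m"
proof -
  define S' where "S' = (\<lambda>S i. \<lambda>l\<in>{..<n}. (S l + i) div q)"
  have S'm: "S' S i \<in> mono_chains n m" if S: "S \<in> strict_chains n (q * m)" and i: "i < q" for S i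
  proof -
    have "(S l + i) div q \<le> m" if "l < n" for l
    proof -
      have "S l < q * m" using S that by (auto simp: strict_chains_def PiE_iff)
      then have "S l + i < q * Suc m" using i by simp
      then have "(S l + i) div q < Suc m" by (simp add: less_mult_imp_div_less mult.commute)
      then show ?thesis by simp
    qed
    moreover have "mono_on {..<n} S"
      using S by (auto simp: strict_chains_def intro: strict_mono_on_imp_mono_on)
    ultimately show ?thesis unfolding S'_def mono_chains_def
      by (auto simp: mono_on_def intro!: div_le_mono add_mono)
  qed
  have le: "a (q * m) S \<le> (\<Sum>i<q. a m (S' S i))" if S: "S \<in> strict_chains n (q * m)" for S
  proof -
    have "(\<lambda>l\<in>{..<n}. \<Sum>i<q. S' S i l) = S"
    proof
      fix l show "(\<lambda>l\<in>{..<n}. \<Sum>i<q. S' S i l) l = S l"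
        using S hermite_identity[OF q, of "S l"]
        by (cases "l < n") (auto simp: S'_def strict_chains_def PiE_iff extensional_def)
    qed
    moreover have "a 0 (\<lambda>l\<in>{..<n}. 0) \<le> 0" by (rule nonpos) (auto simp: mono_chains_def mono_on_def)
    ultimately show ?thesis using subadditive_sum[of q "S' S" m] S'm[OF S] by auto
  qed
  have fibre: "(\<Sum>S\<in>strict_chains n (q * m). a m (S' S i)) \<le> real q ^ n * strict_total m" if i: "i < q" for i
  proof -
    let ?I = "strict_chains n m \<times> ({..<n} \<rightarrow>\<^sub>E {..<q})"
    \<comment> \<open>The chain with \<open>S + i = q * T + c\<close>: quotients \<open>T\<close>,
      remainders \<open>c\<close>.\<close>
    define f where "f = (\<lambda>(T, c). \<lambda>l\<in>{..<n}. q * T l + c l - i)"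
    \<comment> \<open>\<open>T l > 0\<close> and \<open>i < q\<close> make the natural subtraction
      exact and its result positive; \<open>T l < m\<close> keeps it below
      \<open>q * m\<close>.\<close>
    have pos: "q * T l + c l - i + i = q * T l + c l" "(q * T l + c l) div q = T l" "(q * T l + c l) mod q = c l"
      "0 < q * T l + c l - i" "q * T l + c l - i < q * m"
      if "T \<in> strict_chains n m" "c \<in> {..<n} \<rightarrow>\<^sub>E {..<q}" "l < n" for T c l
    proof -
      have T: "0 < T l" "T l < m" and c: "c l < q" using that by (auto simp: strict_chains_def PiE_iff)
      have "q \<le> q * T l" using T by simp
      moreover have "q * T l + q \<le> q * m" using mult_le_mono2[of "Suc (T l)" m q] T by simp
      ultimately show "q * T l + c l - i + i = q * T l + c l" "0 < q * T l + c l - i"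
        "q * T l + c l - i < q * m" using i c by linarith+
      show "(q * T l + c l) div q = T l" using c q by (simp add: add.commute)
      show "(q * T l + c l) mod q = c l" using c by simp
    qed
    \<comment> \<open>Quotient chains that touch a wall or fail to be strict have nonpositive terms
      and are dropped.\<close>
    have "(\<Sum>S\<in>strict_chains n (q * m). a m (S' S i)) \<le> (\<Sum>(T, c)\<in>?I. a m T)"
    proof (rule sum_le_injection[where f = f])
      show "inj_on f ?I"
      proof (rule inj_onI)
        fix P P' assume PI: "P \<in> ?I" "P' \<in> ?I" "f P = f P'"
        obtain T c where P1: "P = (T, c)" by (cases P)
        obtain T' c' where P2: "P' = (T', c')" by (cases P')
        note P = P1 P2
        have A: "T \<in> strict_chains n m" "c \<in> {..<n} \<rightarrow>\<^sub>E {..<q}"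
          "T' \<in> strict_chains n m" "c' \<in> {..<n} \<rightarrow>\<^sub>E {..<q}" and e: "f (T, c) = f (T', c')"
          using PI unfolding P mem_Sigma_iff by blast+
        have "T l = T' l \<and> c l = c' l" for l
        proof (cases "l < n")
          case True
          then have "q * T l + c l - i = q * T' l + c' l - i" using fun_cong[OF e, of l] by (simp add: f_def)
          then have "q * T l + c l - i + i = q * T' l + c' l - i + i" by (simp only:)
          then have "q * T l + c l = q * T' l + c' l"
            unfolding pos(1)[OF A(1,2) True] pos(1)[OF A(3,4) True] .
          then show ?thesis using pos(2,3)[OF A(1,2) True] pos(2,3)[OF A(3,4) True] by metis
        next
          case False
          then show ?thesis using A by (auto simp: strict_chains_def PiE_iff extensional_def)
        qed
        then show "P = P'" unfolding P by auto
      qed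
      show "f ` ?I \<subseteq> strict_chains n (q * m)"
      proof (rule image_subsetI)
        fix P assume PI: "P \<in> ?I"
        obtain T c where P: "P = (T, c)" by (cases P)
        have A: "T \<in> strict_chains n m" "c \<in> {..<n} \<rightarrow>\<^sub>E {..<q}"
          using PI unfolding P mem_Sigma_iff by blast+
        have "q * T l + c l - i < q * T l' + c l' - i" if "l < l'" "l' < n" for l l'
        proof -
          have "Suc (T l) \<le> T l'" using A that by (fastforce simp: strict_chains_def strict_mono_on_def Suc_le_eq)
          then have "q * Suc (T l) \<le> q * T l'" by (rule mult_le_mono2)
          moreover have "c l < q" using A that by (auto simp: PiE_iff)
          ultimately have "q * T l + c l < q * T l' + c l'" by simp
          moreover have "i \<le> q * T l + c l" using pos(4)[OF A, of l] that by simp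
          ultimately show ?thesis by linarith
        qed
        then show "f P \<in> strict_chains n (q * m)"
          using pos(4,5)[OF A] by (auto simp: P strict_chains_def f_def strict_mono_on_def)
      qed
      show "a m (S' S i) \<le> 0" if "S \<in> strict_chains n (q * m)" for S using nonpos S'm[OF that i] by blast
      fix P assume "P \<in> ?I"
      moreover obtain T c where P: "P = (T, c)" by (cases P)
      ultimately have A: "T \<in> strict_chains n m" "c \<in> {..<n} \<rightarrow>\<^sub>E {..<q}"
        unfolding P mem_Sigma_iff by blast+
      have "S' (f P) i = T"
      proof
        fix l show "S' (f P) i l = T l"
        proof (cases "l < n")
          case True
          then have "S' (f P) i l = (q * T l + c l - i + i) div q" by (simp add: S'_def f_def P)
          then show ?thesis unfolding pos(1)[OF A True] pos(2)[OF A True] .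
        next
          case False
          then show ?thesis using A(1) by (auto simp: S'_def strict_chains_def PiE_iff extensional_def)
        qed
      qed
      then show "a m (S' (f P) i) \<le> (case P of (T, c) \<Rightarrow> a m T)" using P by simp
    qed simp
    also have "(\<Sum>(T, c)\<in>?I. a m T) = (\<Sum>T\<in>strict_chains n m. \<Sum>c\<in>{..<n} \<rightarrow>\<^sub>E {..<q}. a m T)"
      by (rule sum.cartesian_product[symmetric])
    also have "\<dots> = real q ^ n * strict_total m"
      by (simp add: strict_total_def card_PiE sum_distrib_left)
    finally show ?thesis .
  qed
  have "strict_total (q * m) \<le> (\<Sum>S\<in>strict_chains n (q * m). \<Sum>i<q. a m (S' S i))"
    unfolding strict_total_def by (intro sum_mono le)
  also have "\<dots> = (\<Sum>i<q. \<Sum>S\<in>strict_chains n (q * m). a m (S' S i))" by (rule sum.swap)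
  also have "\<dots> \<le> (\<Sum>i<q. real q ^ n * strict_total m)" by (intro sum_mono fibre) auto
  finally show ?thesis by (simp add: mult.assoc)
qed

text \<open>Fekete's argument: \<open>k\<close> is rounded down to the multiple
  \<open>k div m * m\<close>, where the multiplicative bound applies, and monotonicity discards the
  remainder.\<close>

lemma strict_total_eventually_le:
  assumes m: "m > 0" and e: "e > 0"
  shows "\<forall>\<^sub>F k in sequentially. strict_total k / real k ^ Suc n < strict_total m / real m ^ Suc n + e"
proof -
  let ?b = "strict_total m / real m ^ Suc n"
  have "(\<lambda>k. real (k div m) * real m / real k) \<longlonglongrightarrow> 1"
  proof (rule tendsto_sandwich)
    show "(\<lambda>k. 1 - real m / real k) \<longlonglongrightarrow> 1" by real_asymp
    show "\<forall>\<^sub>F k in sequentially. 1 - real m / real k \<le> real (k div m) * real m / real k"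
    proof (rule eventually_mono[OF eventually_gt_at_top[of 0]])
      fix k :: nat assume k: "k > 0"
      have "k < (k div m) * m + m" using dividend_less_div_times[OF m, of k] by simp
      then have "real k - real m \<le> real (k div m) * real m"
        by (metis less_imp_le of_nat_add of_nat_le_iff of_nat_mult le_diff_eq diff_le_eq)
      then have "(real k - real m) / real k \<le> real (k div m) * real m / real k" by (rule divide_right_mono) simp
      then show "1 - real m / real k \<le> real (k div m) * real m / real k" using k by (simp add: diff_divide_distrib)
    qed
    show "\<forall>\<^sub>F k in sequentially. real (k div m) * real m / real k \<le> 1"
    proof (rule eventually_mono[OF eventually_gt_at_top[of 0]])
      fix k :: nat assume k: "k > 0"
      have "real (k div m) * real m \<le> real k" by (metis div_times_less_eq_dividend of_nat_le_iff of_nat_mult)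
      then show "real (k div m) * real m / real k \<le> 1" using k by (simp add: divide_le_eq)
    qed
  qed simp
  then have "(\<lambda>k. (real (k div m) * real m / real k) ^ Suc n * ?b) \<longlonglongrightarrow> 1 ^ Suc n * ?b"
    by (intro tendsto_intros)
  then have "\<forall>\<^sub>F k in sequentially. (real (k div m) * real m / real k) ^ Suc n * ?b < ?b + e"
    using e by (intro order_tendstoD(2)[where y = "1 ^ Suc n * ?b"]) auto
  then show ?thesis using eventually_ge_at_top[of m]
  proof eventually_elim
    case (elim k)
    have q: "k div m > 0" using elim(2) m by (simp add: div_greater_zero_iff)
    have "strict_total k \<le> strict_total (k div m * m)" by (rule strict_total_antimono) simp
    also have "\<dots> \<le> real (k div m) ^ Suc n * strict_total m" by (rule strict_total_mult_le[OF q])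
    finally have "strict_total k / real k ^ Suc n \<le> real (k div m) ^ Suc n * strict_total m / real k ^ Suc n"
      by (rule divide_right_mono) simp
    also have "\<dots> = (real (k div m) * real m / real k) ^ Suc n * ?b"
      using m by (simp add: power_mult_distrib power_divide del: power_Suc)
    finally show ?case using elim(1) by linarith
  qed
qed

text \<open>The normalized strict totals converge to their infimum or to minus infinity, and
  \<open>total k\<close> lies between \<open>strict_total (k + Suc n)\<close> and
  \<open>strict_total k\<close>.\<close>

lemma total_limit:
  "(\<exists>L. (\<lambda>k. total k / real k ^ Suc n) \<longlonglongrightarrow> L) \<or>
    filterlim (\<lambda>k. total k / real k ^ Suc n) at_bot sequentially"
proof -
  let ?b = "\<lambda>k. strict_total k / real k ^ Suc n" and ?t = "\<lambda>k. total k / real k ^ Suc n"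
  have tb: "?t k \<le> ?b k" for k using total_le_strict_total by (intro divide_right_mono) auto
  show ?thesis
  proof (cases "bdd_below (?b ` {0<..})")
    case True
    define L where "L = Inf (?b ` {0<..})"
    have Lb: "L \<le> ?b k" if "k > 0" for k unfolding L_def using that True by (intro cINF_lower) auto
    have bL: "?b \<longlonglongrightarrow> L"
    proof (rule order_tendstoI)
      fix u assume "u < L"
      then show "\<forall>\<^sub>F k in sequentially. u < ?b k"
        using Lb by (intro eventually_mono[OF eventually_gt_at_top[of 0]]) (auto intro: less_le_trans)
    next
      fix u assume u: "L < u"
      then obtain m where m: "m > 0" "?b m < u"
        unfolding L_def using True by (subst (asm) cINF_less_iff) auto
      show "\<forall>\<^sub>F k in sequentially. ?b k < u"
        using strict_total_eventually_le[OF m(1), of "u - ?b m"] m(2) by simp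
    qed
    have lower: "(\<lambda>k. ?b (k + Suc n) * (real (k + Suc n) / real k) ^ Suc n) \<longlonglongrightarrow> L * 1 ^ Suc n"
    proof (intro tendsto_intros)
      show "(\<lambda>k. ?b (k + Suc n)) \<longlonglongrightarrow> L" using bL by (rule LIMSEQ_ignore_initial_segment)
      show "(\<lambda>k. real (k + Suc n) / real k) \<longlonglongrightarrow> 1" by real_asymp
    qed
    have "?t \<longlonglongrightarrow> L"
    proof (rule tendsto_sandwich[OF _ _ _ bL])
      show "(\<lambda>k. ?b (k + Suc n) * (real (k + Suc n) / real k) ^ Suc n) \<longlonglongrightarrow> L" using lower by simp
      show "\<forall>\<^sub>F k in sequentially. ?t k \<le> ?b k" using tb by simp
      have "?b (k + Suc n) * (real (k + Suc n) / real k) ^ Suc n \<le> ?t k" for k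
      proof -
        have "?b (k + Suc n) * (real (k + Suc n) / real k) ^ Suc n = strict_total (k + Suc n) / real k ^ Suc n"
          by (simp add: power_divide del: power_Suc of_nat_add of_nat_Suc)
        also have "\<dots> \<le> ?t k" using strict_total_le_total by (intro divide_right_mono) auto
        finally show ?thesis .
      qed
      then show "\<forall>\<^sub>F k in sequentially. ?b (k + Suc n) * (real (k + Suc n) / real k) ^ Suc n \<le> ?t k" by simp
    qed
    then show ?thesis by blast
  next
    case False
    have "filterlim ?t at_bot sequentially"
    proof (subst filterlim_at_bot, rule allI)
      fix u
      have "\<exists>m>0. ?b m < u - 1"
      proof (rule ccontr)
        assume *: "\<not> (\<exists>m>0. ?b m < u - 1)"
        have "u - 1 \<le> ?b m" if "m \<in> {0<..}" for m
          using * that by (metis greaterThan_iff not_less)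
        then have "bdd_below (?b ` {0<..})" by (intro bdd_belowI2[where m = "u - 1"])
        with False show False ..
      qed
      then obtain m where m: "m > 0" "?b m < u - 1" by blast
      from strict_total_eventually_le[OF m(1), of 1]
      have ev: "\<forall>\<^sub>F k in sequentially. ?b k < ?b m + 1" by simp
      show "\<forall>\<^sub>F k in sequentially. ?t k \<le> u"
        using ev
      proof eventually_elim
        case (elim k)
        then show ?case using tb[of k] m(2) by linarith
      qed
    qed
    then show ?thesis by blast
  qed
qed

end

section \<open>Fekete points and Chebyshev constants\<close>

definition vandermonde :: "nat \<Rightarrow> (nat \<Rightarrow> 'a \<Rightarrow> complex) \<Rightarrow> (nat \<Rightarrow> 'a) \<Rightarrow> complex" where
  "vandermonde s \<phi> x = Determinant.det (mat s s (\<lambda>(i, j). \<phi> i (x j)))"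

lemma vandermonde_cong: "(\<And>j. j < s \<Longrightarrow> x j = y j) \<Longrightarrow> vandermonde s \<phi> x = vandermonde s \<phi> y"
  unfolding vandermonde_def by (intro arg_cong[of _ _ Determinant.det] eq_matI) auto

text \<open>Adding multiples of the other rows to the last one is harmless: by the off-diagonal
  entries of \<open>A * adj A\<close>, those rows pair to zero with the cofactors of the last
  row.\<close>

lemma vandermonde_expand_row:
  "vandermonde (Suc s) \<phi> x = (\<Sum>j<Suc s. (\<phi> s (x j) + (\<Sum>i<s. c i * \<phi> i (x j))) *
     ((-1) ^ (s + j) * vandermonde s \<phi> (\<lambda>l. x (if l < j then l else Suc l))))"
proof -
  let ?A = "mat (Suc s) (Suc s) (\<lambda>(i, j). \<phi> i (x j))"
  have A: "?A \<in> carrier_mat (Suc s) (Suc s)" by simp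
  have cof: "cofactor ?A s j = (-1) ^ (s + j) * vandermonde s \<phi> (\<lambda>l. x (if l < j then l else Suc l))"
    if "j < Suc s" for j
    unfolding cofactor_def vandermonde_def mat_delete_def
    using that by (intro arg_cong2[of _ _ _ _ "(*)"] refl arg_cong[of _ _ Determinant.det] eq_matI) auto
  have z: "(\<Sum>j<Suc s. \<phi> i (x j) * cofactor ?A s j) = 0" if "i < s" for i
  proof -
    have "(\<Sum>j<Suc s. \<phi> i (x j) * cofactor ?A s j) = (?A * adj_mat ?A) $$ (i, s)"
      using that unfolding adj_mat_def by (simp add: scalar_prod_def atLeast0LessThan)
    then show ?thesis using adj_mat(2)[OF A] that by simp
  qed
  have "vandermonde (Suc s) \<phi> x = (\<Sum>j<Suc s. \<phi> s (x j) * cofactor ?A s j)"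
    unfolding vandermonde_def by (subst laplace_expansion_row[OF A, of s]) auto
  also have "\<dots> = (\<Sum>j<Suc s. \<phi> s (x j) * cofactor ?A s j) + (\<Sum>i<s. c i * (\<Sum>j<Suc s. \<phi> i (x j) * cofactor ?A s j))"
    using z by simp
  also have "(\<Sum>i<s. c i * (\<Sum>j<Suc s. \<phi> i (x j) * cofactor ?A s j))
      = (\<Sum>j<Suc s. (\<Sum>i<s. c i * \<phi> i (x j)) * cofactor ?A s j)"
    unfolding sum_distrib_left sum_distrib_right by (subst sum.swap) (simp add: mult.assoc)
  also have "(\<Sum>j<Suc s. \<phi> s (x j) * cofactor ?A s j) + (\<Sum>j<Suc s. (\<Sum>i<s. c i * \<phi> i (x j)) * cofactor ?A s j)
      = (\<Sum>j<Suc s. (\<phi> s (x j) + (\<Sum>i<s. c i * \<phi> i (x j))) * cofactor ?A s j)"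
    by (simp only: distrib_right sum.distrib)
  also have "\<dots> = (\<Sum>j<Suc s. (\<phi> s (x j) + (\<Sum>i<s. c i * \<phi> i (x j))) *
     ((-1) ^ (s + j) * vandermonde s \<phi> (\<lambda>l. x (if l < j then l else Suc l))))"
    by (intro sum.cong refl arg_cong2[of _ _ _ _ "(*)"] cof) auto
  finally show ?thesis .
qed

text \<open>The cofactors along the last column do not involve the last node.\<close>

lemma vandermonde_expand_column:
  obtains c where "\<And>y. vandermonde (Suc s) \<phi> (x(s := y)) = vandermonde s \<phi> x * \<phi> s y + (\<Sum>i<s. c i * \<phi> i y)"
proof -
  let ?A = "\<lambda>y. mat (Suc s) (Suc s) (\<lambda>(i, j). \<phi> i ((x(s := y)) j))"
  have del: "mat_delete (?A y) i s = mat_delete (?A (x s)) i s" if "i \<le> s" for i y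
    unfolding mat_delete_def using that by (intro eq_matI) auto
  have cof: "cofactor (?A y) i s = cofactor (?A (x s)) i s" if "i \<le> s" for i y
    unfolding cofactor_def del[OF that, of y] ..
  have cs: "cofactor (?A (x s)) s s = vandermonde s \<phi> x"
    unfolding cofactor_def vandermonde_def mat_delete_def
    by (simp add: mult_2[symmetric]) (intro arg_cong[of _ _ Determinant.det] eq_matI, auto)
  have "vandermonde (Suc s) \<phi> (x(s := y)) =
      vandermonde s \<phi> x * \<phi> s y + (\<Sum>i<s. cofactor (?A (x s)) i s * \<phi> i y)" for y
  proof -
    have "vandermonde (Suc s) \<phi> (x(s := y)) = (\<Sum>i<Suc s. ?A y $$ (i, s) * cofactor (?A y) i s)"
      unfolding vandermonde_def by (rule laplace_expansion_column) auto
    also have "\<dots> = (\<Sum>i<Suc s. cofactor (?A (x s)) i s * \<phi> i y)"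
    proof (rule sum.cong[OF refl])
      fix i assume i: "i \<in> {..<Suc s}"
      then have "cofactor (?A y) i s = cofactor (?A (x s)) i s" by (intro cof) simp
      then show "?A y $$ (i, s) * cofactor (?A y) i s = cofactor (?A (x s)) i s * \<phi> i y"
        using i by (simp only:) simp
    qed
    also have "\<dots> = cofactor (?A (x s)) s s * \<phi> s y + (\<Sum>i<s. cofactor (?A (x s)) i s * \<phi> i y)"
      unfolding sum.lessThan_Suc by (rule add.commute)
    finally show ?thesis unfolding cs .
  qed
  then show ?thesis by (rule that)
qed

section \<open>Weighted sup norms\<close>

definition wbdd :: "'a set \<Rightarrow> ('a \<Rightarrow> real) \<Rightarrow> ('a \<Rightarrow> complex) \<Rightarrow> bool" where
  "wbdd K w f \<longleftrightarrow> bdd_above ((\<lambda>x. cmod (f x) * w x) ` K)"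

text \<open>The supremum of an unbounded set of reals is unspecified, so \<open>wbdd\<close>
  accompanies \<open>wnorm\<close>.\<close>

definition wnorm :: "'a set \<Rightarrow> ('a \<Rightarrow> real) \<Rightarrow> ('a \<Rightarrow> complex) \<Rightarrow> real" where
  "wnorm K w f = (SUP x\<in>K. cmod (f x) * w x)"

lemma wnorm_upper: "wbdd K w f \<Longrightarrow> x \<in> K \<Longrightarrow> cmod (f x) * w x \<le> wnorm K w f"
  unfolding wnorm_def wbdd_def by (rule cSUP_upper)

lemma wbddI: "(\<And>x. x \<in> K \<Longrightarrow> cmod (f x) * w x \<le> B) \<Longrightarrow> wbdd K w f"
  unfolding wbdd_def by (rule bdd_aboveI2)

lemma wbdd_add:
  assumes "\<And>x. x \<in> K \<Longrightarrow> w x \<ge> 0" "wbdd K w f" "wbdd K w g"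
  shows "wbdd K w (\<lambda>x. f x + g x)"
proof (rule wbddI)
  fix x assume x: "x \<in> K"
  have "cmod (f x + g x) * w x \<le> (cmod (f x) + cmod (g x)) * w x"
    using assms(1)[OF x] norm_triangle_ineq by (intro mult_right_mono) auto
  also have "\<dots> \<le> wnorm K w f + wnorm K w g"
    using wnorm_upper[OF assms(2) x] wnorm_upper[OF assms(3) x] by (simp add: distrib_right)
  finally show "cmod (f x + g x) * w x \<le> wnorm K w f + wnorm K w g" .
qed

lemma wbdd_cmult: "wbdd K w f \<Longrightarrow> wbdd K w (\<lambda>x. c * f x)"
  using wnorm_upper[of K w f]
  by (intro wbddI[where B = "cmod c * wnorm K w f"]) (auto simp: norm_mult mult.assoc intro: mult_left_mono)

lemma wbdd_sum:
  assumes "\<And>x. x \<in> K \<Longrightarrow> w x \<ge> 0" "\<And>i. i \<in> I \<Longrightarrow> wbdd K w (f i)"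
  shows "wbdd K w (\<lambda>x. \<Sum>i\<in>I. f i x)"
  using assms(2)
proof (induction I rule: infinite_finite_induct)
  case (insert i I)
  then show ?case using wbdd_add[OF assms(1), where f = "f i" and g = "\<lambda>x. \<Sum>i\<in>I. f i x"] by simp
qed (auto intro: wbddI[where B = 0])

lemma wnorm_nonneg:
  assumes "K \<noteq> {}" "\<And>x. x \<in> K \<Longrightarrow> w x \<ge> 0" "wbdd K w f"
  shows "wnorm K w f \<ge> 0"
proof -
  obtain x where x: "x \<in> K" using assms(1) by auto
  have "0 \<le> cmod (f x) * w x" using assms(2)[OF x] by simp
  also have "\<dots> \<le> wnorm K w f" by (rule wnorm_upper[OF assms(3) x])
  finally show ?thesis .
qed

section \<open>Fekete maxima and products of Chebyshev constants\<close>

locale weighted_system =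
  fixes K :: "'a set" and w :: "'a \<Rightarrow> real" and \<phi> :: "nat \<Rightarrow> 'a \<Rightarrow> complex"
  assumes nonempty: "K \<noteq> {}" and weight_nonneg: "x \<in> K \<Longrightarrow> w x \<ge> 0"
    and bounded: "wbdd K w (\<phi> i)"
begin

definition monic :: "nat \<Rightarrow> (nat \<Rightarrow> complex) \<Rightarrow> 'a \<Rightarrow> complex" where
  "monic s c x = \<phi> s x + (\<Sum>i<s. c i * \<phi> i x)"

definition chebyshev :: "nat \<Rightarrow> real" where
  "chebyshev s = (INF c. wnorm K w (monic s c))"

definition weighted_vandermonde :: "nat \<Rightarrow> (nat \<Rightarrow> 'a) \<Rightarrow> real" where
  "weighted_vandermonde s x = cmod (vandermonde s \<phi> x) * (\<Prod>j<s. w (x j))"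

definition fekete :: "nat \<Rightarrow> real" where
  "fekete s = (SUP x\<in>{..<s} \<rightarrow>\<^sub>E K. weighted_vandermonde s x)"

lemma wbdd_monic: "wbdd K w (monic s c)"
  unfolding monic_def by (intro wbdd_add wbdd_sum wbdd_cmult bounded weight_nonneg)

lemma wnorm_monic_nonneg: "wnorm K w (monic s c) \<ge> 0"
  by (intro wnorm_nonneg nonempty weight_nonneg wbdd_monic)

lemma chebyshev_le: "chebyshev s \<le> wnorm K w (monic s c)"
  unfolding chebyshev_def using wnorm_monic_nonneg by (intro cINF_lower bdd_belowI2) auto

lemma chebyshev_nonneg: "chebyshev s \<ge> 0"
  unfolding chebyshev_def using wnorm_monic_nonneg by (intro cINF_greatest) auto

lemma weighted_vandermonde_nonneg: "x \<in> {..<s} \<rightarrow>\<^sub>E K \<Longrightarrow> weighted_vandermonde s x \<ge> 0"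
  unfolding weighted_vandermonde_def by (intro mult_nonneg_nonneg prod_nonneg) (auto intro: weight_nonneg)

text \<open>Expansion along the last row, with that row replaced by the values of any monic
  function. Each of the \<open>Suc s\<close> minors belongs to the remaining \<open>s\<close>
  points.\<close>

lemma weighted_vandermonde_Suc_le:
  assumes x: "x \<in> {..<Suc s} \<rightarrow>\<^sub>E K" and C: "\<And>y. y \<in> {..<s} \<rightarrow>\<^sub>E K \<Longrightarrow> weighted_vandermonde s y \<le> C"
  shows "weighted_vandermonde (Suc s) x \<le> real (Suc s) * wnorm K w (monic s c) * C"
proof -
  define y where "y = (\<lambda>j. \<lambda>l\<in>{..<s}. x (if l < j then l else Suc l))"
  have xK: "x j \<in> K" if "j < Suc s" for j using x that by (auto simp: PiE_iff)
  have y: "y j \<in> {..<s} \<rightarrow>\<^sub>E K" for j unfolding y_def using xK by auto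
  have wprod: "(\<Prod>l<Suc s. w (x l)) = w (x j) * (\<Prod>l<s. w (y j l))" if j: "j < Suc s" for j
  proof -
    have "(\<Prod>l<s. w (y j l)) = (\<Prod>l<s. w (x (if l < j then l else Suc l)))" unfolding y_def by simp
    also have "\<dots> = (\<Prod>l\<in>{..<Suc s} - {j}. w (x l))"
    proof (rule prod.reindex_bij_betw)
      show "bij_betw (\<lambda>l. if l < j then l else Suc l) {..<s} ({..<Suc s} - {j})"
        by (rule bij_betwI[where g = "\<lambda>l. if l < j then l else l - 1"]) (use j in \<open>auto split: if_splits\<close>)
    qed
    finally show ?thesis using j by (simp add: prod.remove[of "{..<Suc s}" j] del: prod.lessThan_Suc)
  qed
  have "weighted_vandermonde (Suc s) x \<le> (\<Sum>j<Suc s. cmod (monic s c (x j)) * cmod (vandermonde s \<phi> (y j))) * (\<Prod>l<Suc s. w (x l))"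
  proof -
    have v: "vandermonde s \<phi> (\<lambda>l. x (if l < j then l else Suc l)) = vandermonde s \<phi> (y j)" for j
      by (rule vandermonde_cong) (simp add: y_def)
    have "cmod (vandermonde (Suc s) \<phi> x) \<le> (\<Sum>j<Suc s. cmod (monic s c (x j)) * cmod (vandermonde s \<phi> (y j)))"
      unfolding vandermonde_expand_row[of s \<phi> x c] v
      by (rule order_trans[OF norm_sum]) (intro sum_mono, simp add: norm_mult monic_def norm_power)
    then show ?thesis unfolding weighted_vandermonde_def
      using xK weight_nonneg by (intro mult_right_mono prod_nonneg) auto
  qed
  also have "\<dots> = (\<Sum>j<Suc s. (cmod (monic s c (x j)) * w (x j)) * weighted_vandermonde s (y j))"
    unfolding sum_distrib_right weighted_vandermonde_def
    by (intro sum.cong refl) (use wprod in simp)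
  also have "\<dots> \<le> (\<Sum>j<Suc s. wnorm K w (monic s c) * C)"
    using xK y C weight_nonneg
    by (intro sum_mono mult_mono wnorm_upper wbdd_monic wnorm_monic_nonneg weighted_vandermonde_nonneg) auto
  finally show ?thesis by simp
qed

text \<open>\<open>K\<close> carries no topology here; boundedness comes from the same recursion
  that estimates the supremum.\<close>

lemma bdd_above_weighted_vandermonde: "bdd_above (weighted_vandermonde s ` ({..<s} \<rightarrow>\<^sub>E K))"
proof (induction s)
  case (Suc s)
  then obtain C where "\<And>y. y \<in> {..<s} \<rightarrow>\<^sub>E K \<Longrightarrow> weighted_vandermonde s y \<le> C" unfolding bdd_above_def by auto
  from weighted_vandermonde_Suc_le[OF _ this] show ?case by (rule bdd_aboveI2)
qed simp

lemma fekete_upper: "x \<in> {..<s} \<rightarrow>\<^sub>E K \<Longrightarrow> weighted_vandermonde s x \<le> fekete s"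
  unfolding fekete_def by (rule cSUP_upper[OF _ bdd_above_weighted_vandermonde])

lemma fekete_leI: "(\<And>x. x \<in> {..<s} \<rightarrow>\<^sub>E K \<Longrightarrow> weighted_vandermonde s x \<le> C) \<Longrightarrow> fekete s \<le> C"
  unfolding fekete_def using nonempty by (intro cSUP_least) (auto simp: PiE_eq_empty_iff)

lemma fekete_nonneg: "fekete s \<ge> 0"
proof -
  obtain x where "x \<in> {..<s} \<rightarrow>\<^sub>E K" using nonempty by (meson PiE_eq_empty_iff ex_in_conv)
  then show ?thesis using weighted_vandermonde_nonneg fekete_upper order_trans by blast
qed

lemma fekete_Suc_le: "fekete (Suc s) \<le> real (Suc s) * chebyshev s * fekete s"
proof -
  have "fekete (Suc s) \<le> real (Suc s) * wnorm K w (monic s c) * fekete s" for c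
    by (intro fekete_leI weighted_vandermonde_Suc_le fekete_upper)
  show ?thesis
  proof (cases "fekete s = 0")
    case True
    then show ?thesis using \<open>\<And>c. fekete (Suc s) \<le> _\<close> by simp
  next
    case False
    then have pos: "real (Suc s) * fekete s > 0" using fekete_nonneg[of s] by simp
    have "fekete (Suc s) / (real (Suc s) * fekete s) \<le> chebyshev s"
      unfolding chebyshev_def
      using \<open>\<And>c. fekete (Suc s) \<le> _\<close> pos by (intro cINF_greatest) (auto simp: pos_divide_le_eq mult_ac)
    then show ?thesis using pos by (simp add: pos_divide_le_eq mult_ac)
  qed
qed

text \<open>For fixed nodes with nonzero determinant, dividing by it makes the next determinant a
  monic function of the new node, with norm at least the Chebyshev constant.\<close>

lemma fekete_Suc_ge: "chebyshev s * fekete s \<le> fekete (Suc s)"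
proof -
  have main: "chebyshev s * weighted_vandermonde s x \<le> fekete (Suc s)" if x: "x \<in> {..<s} \<rightarrow>\<^sub>E K" for x
  proof (cases "weighted_vandermonde s x = 0")
    case True
    then show ?thesis using fekete_nonneg by simp
  next
    case False
    then have D: "vandermonde s \<phi> x \<noteq> 0" by (auto simp: weighted_vandermonde_def)
    have pos: "weighted_vandermonde s x > 0" using False weighted_vandermonde_nonneg[OF x] by simp
    obtain c where c: "\<And>y. vandermonde (Suc s) \<phi> (x(s := y)) = vandermonde s \<phi> x * \<phi> s y + (\<Sum>i<s. c i * \<phi> i y)"
      using vandermonde_expand_column by blast
    define d where "d = (\<lambda>i. c i / vandermonde s \<phi> x)"
    have c': "vandermonde (Suc s) \<phi> (x(s := y)) = vandermonde s \<phi> x * monic s d y" for y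
      unfolding c monic_def d_def using D by (simp add: distrib_left sum_distrib_left)
    have "cmod (monic s d y) * w y \<le> fekete (Suc s) / weighted_vandermonde s x" if y: "y \<in> K" for y
    proof -
      have "x(s := y) \<in> {..<Suc s} \<rightarrow>\<^sub>E K" using x y by (auto simp: PiE_iff extensional_def)
      then have "weighted_vandermonde (Suc s) (x(s := y)) \<le> fekete (Suc s)" by (rule fekete_upper)
      moreover have "(\<Prod>j<s. w ((x(s := y)) j)) = (\<Prod>j<s. w (x j))" by (intro prod.cong) auto
      ultimately have "weighted_vandermonde s x * (cmod (monic s d y) * w y) \<le> fekete (Suc s)"
        unfolding weighted_vandermonde_def c' by (simp add: norm_mult mult_ac)
      then show ?thesis using pos by (simp add: pos_le_divide_eq mult.commute)
    qed
    then have "wnorm K w (monic s d) \<le> fekete (Suc s) / weighted_vandermonde s x"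
      unfolding wnorm_def using nonempty by (intro cSUP_least) auto
    then have "chebyshev s \<le> fekete (Suc s) / weighted_vandermonde s x" using chebyshev_le order_trans by blast
    then show ?thesis using pos by (simp add: pos_le_divide_eq)
  qed
  show ?thesis
  proof (cases "chebyshev s = 0")
    case True
    then show ?thesis using fekete_nonneg by simp
  next
    case False
    then have pos: "chebyshev s > 0" using chebyshev_nonneg[of s] by simp
    have "fekete s \<le> fekete (Suc s) / chebyshev s"
      using main pos by (intro fekete_leI) (simp add: pos_le_divide_eq mult.commute)
    then show ?thesis using pos by (simp add: pos_le_divide_eq mult.commute)
  qed
qed

lemma fekete_0: "fekete 0 = 1"
  by (simp add: fekete_def weighted_vandermonde_def vandermonde_def)

text \<open>Both recursions telescope. The factorial is harmless because
  \<open>ln (fact N) \<le> N * ln N\<close> and \<open>ln N / k\<close> tends to 0.\<close>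

lemma fekete_chebyshev_bounds:
  "(\<Prod>i<s. chebyshev i) \<le> fekete s" "fekete s \<le> fact s * (\<Prod>i<s. chebyshev i)"
proof (induction s)
  case 0
  {
    case 1 show ?case by (simp add: fekete_0)
  next
    case 2 show ?case by (simp add: fekete_0)
  }
next
  case (Suc s)
  {
    case 1
    show ?case using mult_left_mono[OF Suc(1) chebyshev_nonneg[of s]] fekete_Suc_ge[of s]
      by (simp add: mult.commute)
  next
    case 2
    have "real (Suc s) * chebyshev s \<ge> 0" using chebyshev_nonneg by (simp del: of_nat_Suc)
    from order_trans[OF fekete_Suc_le mult_left_mono[OF Suc(2) this]]
    show ?case by (simp add: mult_ac)
  }
qed

end

section \<open>Convergence of the transfinite diameters\<close>

definition monomial :: "('n::finite \<Rightarrow> nat) \<Rightarrow> complex ^ 'n \<Rightarrow> complex" where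
  "monomial \<alpha> z = (\<Prod>l\<in>UNIV. vec_nth z l ^ \<alpha> l)"

lemma monomial_add: "monomial (\<lambda>i. \<alpha> i + \<beta> i) z = monomial \<alpha> z * monomial \<beta> z"
  by (simp add: monomial_def power_add prod.distrib)

lemma cmod_monomial_le:
  assumes "\<And>l. cmod (vec_nth z l) \<le> R" "R \<ge> 1" "\<alpha> \<in> multi_indices k"
  shows "cmod (monomial \<alpha> z) \<le> R ^ k"
proof -
  have "cmod (monomial \<alpha> z) \<le> (\<Prod>l\<in>UNIV. R ^ \<alpha> l)"
    unfolding monomial_def prod_norm[symmetric] norm_power
    by (intro prod_mono conjI power_mono assms(1)) auto
  also have "\<dots> = R ^ (\<Sum>l\<in>UNIV. \<alpha> l)" by (rule power_sum[symmetric])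
  also have "\<dots> \<le> R ^ k" using assms by (intro power_increasing) (auto simp: multi_indices_def)
  finally show ?thesis .
qed

lemma poly_dim_pos: "poly_dim TYPE('n::finite) k > 0"
  by (simp add: poly_dim_def)

lemma finite_multi_indices[simp]: "finite (multi_indices k :: ('n::finite \<Rightarrow> nat) set)"
  using card_multi_indices[where ?'n = 'n, of k] poly_dim_pos[where ?'n = 'n, of k] by (intro card_ge_0_finite) simp

lemma multi_indices_add:
  "\<alpha> \<in> multi_indices k \<Longrightarrow> \<beta> \<in> multi_indices l \<Longrightarrow> (\<lambda>i. \<alpha> i + \<beta> i) \<in> multi_indices (k + l)"
  by (simp add: multi_indices_def sum.distrib)

text \<open>A monomial order: sort the multi-indices by \<open>\<Prod> p\<^sub>l ^ \<alpha> l\<close> for distinct primes \<open>p\<^sub>l\<close>.\<close>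

lemma ex_monomial_order:
  "\<exists>m :: ('n::finite \<Rightarrow> nat) \<Rightarrow> nat. inj m \<and> (\<forall>\<alpha> \<beta>. m (\<lambda>i. \<alpha> i + \<beta> i) = m \<alpha> * m \<beta>) \<and> (\<forall>\<alpha>. m \<alpha> > 0)"
proof -
  define h where "h = (to_nat :: 'n \<Rightarrow> nat)"
  have h: "inj h" unfolding h_def by (rule inj_to_nat)
  define p where "p = (\<lambda>l. enumerate {p :: nat. prime p} (h l))"
  have pr: "prime (p l)" for l unfolding p_def using enumerate_in_set[OF primes_infinite] by blast
  have pinj: "inj p"
    unfolding p_def using h strict_mono_enumerate[OF primes_infinite]
    by (auto simp: inj_def strict_mono_eq)
  define m where "m = (\<lambda>\<alpha> :: 'n \<Rightarrow> nat. \<Prod>l\<in>UNIV. p l ^ \<alpha> l)"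
  have mult: "multiplicity (p l) (m \<alpha>) = \<alpha> l" for l \<alpha>
  proof -
    have "m \<alpha> = (\<Prod>q\<in>range p. q ^ \<alpha> (Hilbert_Choice.inv p q))"
      unfolding m_def by (subst prod.reindex[OF pinj]) (simp add: inv_f_f[OF pinj])
    then have "multiplicity (p l) (m \<alpha>) = (if p l \<in> range p then \<alpha> (Hilbert_Choice.inv p (p l)) else 0)"
      using pr by (simp only:) (intro multiplicity_prod_prime_powers, auto)
    then show ?thesis by (simp add: inv_f_f[OF pinj])
  qed
  have "inj m" by (rule injI) (metis mult ext)
  moreover have "m (\<lambda>i. \<alpha> i + \<beta> i) = m \<alpha> * m \<beta>" for \<alpha> \<beta>
    by (simp add: m_def power_add prod.distrib)
  moreover have "m \<alpha> > 0" for \<alpha> unfolding m_def using pr prime_gt_0_nat by (auto intro!: prod_pos)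
  ultimately show ?thesis by blast
qed

lemma le_INF_mult:
  fixes F :: "'b \<Rightarrow> real" and G :: "'c \<Rightarrow> real"
  assumes "A \<noteq> {}" "B \<noteq> {}" "\<And>f. f \<in> A \<Longrightarrow> F f \<ge> 0" "\<And>g. g \<in> B \<Longrightarrow> G g \<ge> 0"
    and "\<And>f g. f \<in> A \<Longrightarrow> g \<in> B \<Longrightarrow> y \<le> F f * G g"
  shows "y \<le> (INF f\<in>A. F f) * (INF g\<in>B. G g)"
proof -
  have step: "y \<le> (INF f\<in>A. F f) * c"
    if "c \<ge> 0" "\<And>f. f \<in> A \<Longrightarrow> y \<le> F f * c" "A \<noteq> {}" for c and A :: "'d set" and F :: "'d \<Rightarrow> real"
  proof (cases "c = 0")
    case True
    then show ?thesis using that by auto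
  next
    case False
    then have "y / c \<le> (INF f\<in>A. F f)" using that by (intro cINF_greatest) (auto simp: pos_divide_le_eq)
    then show ?thesis using that False by (simp add: pos_divide_le_eq)
  qed
  have F0: "(INF f\<in>A. F f) \<ge> 0" using assms by (intro cINF_greatest) auto
  have "y \<le> (INF f\<in>A. F f) * G g" if "g \<in> B" for g using step[of "G g" A F] assms that by blast
  then show ?thesis using step[of "INF f\<in>A. F f" B G] assms F0 by (simp add: mult.commute)
qed

section \<open>Chebyshev constants of a weighted compact set\<close>

definition max_VDM :: "(complex ^ 'n) set \<Rightarrow> (complex ^ 'n \<Rightarrow> real) \<Rightarrow> nat \<Rightarrow> real" where
  "max_VDM K v k = (SUP x \<in> {..<poly_dim TYPE('n::finite) k} \<rightarrow>\<^sub>E K. cmod (weighted_VDM v k x))"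

text \<open>Comparing values of \<open>key\<close> gives a total order on multi-indices compatible
  with addition, that is, a monomial order.\<close>

locale weighted_compact =
  fixes K :: "(complex ^ 'n::finite) set" and v :: "complex ^ 'n \<Rightarrow> real" and R C :: real
    and key :: "('n \<Rightarrow> nat) \<Rightarrow> nat"
  assumes nonempty: "K \<noteq> {}" and R: "R \<ge> 1" "z \<in> K \<Longrightarrow> cmod (vec_nth z l) \<le> R"
    and C: "C \<ge> 0" "z \<in> K \<Longrightarrow> \<bar>v z\<bar> \<le> C"
    and key: "inj key" "key (\<lambda>i. \<alpha> i + \<beta> i) = key \<alpha> * key \<beta>" "key \<alpha> > 0"
begin

definition weight :: "nat \<Rightarrow> complex ^ 'n \<Rightarrow> real" where
  "weight k z = exp (- real k * v z)"

text \<open>The threshold is a number, so that \<open>Suc (key \<alpha>)\<close> admits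
  \<open>monomial \<alpha>\<close> itself and one product rule covers leading and lower
  terms.\<close>

definition lower_span :: "nat \<Rightarrow> nat \<Rightarrow> (complex ^ 'n \<Rightarrow> complex) set" where
  "lower_span k t = range (\<lambda>c z. \<Sum>\<beta>\<in>{\<beta> \<in> multi_indices k. key \<beta> < t}. c \<beta> * monomial \<beta> z)"

definition monic_polys :: "nat \<Rightarrow> ('n \<Rightarrow> nat) \<Rightarrow> (complex ^ 'n \<Rightarrow> complex) set" where
  "monic_polys k \<alpha> = (\<lambda>g z. monomial \<alpha> z + g z) ` lower_span k (key \<alpha>)"

text \<open>The order need not be graded, so competitors may contain monomials of degree above that
  of \<open>\<alpha>\<close>, up to \<open>k\<close>. The constant depends on \<open>k\<close>
  through this span and through the weight, and it is submultiplicative in the pair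
  \<open>(k, \<alpha>)\<close>.\<close>

definition cheb_const :: "nat \<Rightarrow> ('n \<Rightarrow> nat) \<Rightarrow> real" where
  "cheb_const k \<alpha> = (INF f\<in>monic_polys k \<alpha>. wnorm K (weight k) f)"

lemma weight_pos: "weight k z > 0" by (simp add: weight_def)

lemma weight_le: "z \<in> K \<Longrightarrow> weight k z \<le> exp C ^ k"
proof -
  assume "z \<in> K"
  then have "- v z \<le> C" using C(2)[of z] by linarith
  then have "real k * - v z \<le> real k * C" by (rule mult_left_mono) simp
  then show ?thesis by (simp add: weight_def exp_of_nat_mult[symmetric])
qed

lemma monomial_bound:
  assumes "\<alpha> \<in> multi_indices k" "z \<in> K"
  shows "cmod (monomial \<alpha> z) * weight k z \<le> (R * exp C) ^ k"
  unfolding power_mult_distrib using assms R C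
  by (intro mult_mono cmod_monomial_le weight_le) (auto simp: weight_def)

lemma wbdd_monomial: "wbdd K (weight k) (monomial \<alpha>)"
proof -
  define l where "l = (\<Sum>i\<in>UNIV. \<alpha> i)"
  have "cmod (monomial \<alpha> z) * weight k z \<le> R ^ l * exp C ^ k" if "z \<in> K" for z
    using that R by (intro mult_mono cmod_monomial_le weight_le) (auto simp: weight_def l_def multi_indices_def)
  then show ?thesis by (rule wbddI)
qed

lemma weighted_system_monomials: "weighted_system K (weight k) (\<lambda>i. monomial (e i))"
  by unfold_locales (use nonempty wbdd_monomial weight_pos[THEN less_imp_le] in auto)

text \<open>\<open>\<beta>\<close> may repeat values, since different pairs of monomials can have
  the same product; their coefficients are collected.\<close>

lemma lower_spanI:
  assumes "finite I" "\<And>i. i \<in> I \<Longrightarrow> \<beta> i \<in> multi_indices k" "\<And>i. i \<in> I \<Longrightarrow> key (\<beta> i) < t"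
  shows "(\<lambda>z. \<Sum>i\<in>I. c i * monomial (\<beta> i) z) \<in> lower_span k t"
proof -
  let ?J = "{\<beta> \<in> multi_indices k. key \<beta> < t}"
  have "(\<Sum>i\<in>I. c i * monomial (\<beta> i) z) =
      (\<Sum>\<gamma>\<in>?J. (\<Sum>i\<in>{i \<in> I. \<beta> i = \<gamma>}. c i) * monomial \<gamma> z)" for z
  proof -
    have "(\<Sum>i\<in>I. c i * monomial (\<beta> i) z) = (\<Sum>\<gamma>\<in>?J. \<Sum>i\<in>{i \<in> I. \<beta> i = \<gamma>}. c i * monomial (\<beta> i) z)"
      using assms by (intro sum.group[symmetric]) auto
    then show ?thesis by (simp add: sum_distrib_right)
  qed
  then show ?thesis unfolding lower_span_def by (intro range_eqI ext)
qed

lemma lower_span_add: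
  assumes "f \<in> lower_span k t" "g \<in> lower_span k t"
  shows "(\<lambda>z. f z + g z) \<in> lower_span k t"
proof -
  obtain c d where "f = (\<lambda>z. \<Sum>\<beta>\<in>{\<beta> \<in> multi_indices k. key \<beta> < t}. c \<beta> * monomial \<beta> z)"
    "g = (\<lambda>z. \<Sum>\<beta>\<in>{\<beta> \<in> multi_indices k. key \<beta> < t}. d \<beta> * monomial \<beta> z)"
    using assms unfolding lower_span_def by blast
  then have "(\<lambda>z. f z + g z) = (\<lambda>z. \<Sum>\<beta>\<in>{\<beta> \<in> multi_indices k. key \<beta> < t}. (c \<beta> + d \<beta>) * monomial \<beta> z)"
    by (simp add: distrib_right sum.distrib)
  then show ?thesis unfolding lower_span_def by (intro range_eqI[where x = "\<lambda>\<beta>. c \<beta> + d \<beta>"])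
qed

text \<open>The inequalities \<open>key \<le> s\<close> and \<open>key < t\<close> multiply to a
  strict one; \<open>s > 0\<close> is what keeps it strict.\<close>

lemma lower_span_mult:
  assumes "f \<in> lower_span k (Suc s)" "g \<in> lower_span l t" "s > 0"
  shows "(\<lambda>z. f z * g z) \<in> lower_span (k + l) (s * t)"
proof -
  let ?A = "{\<beta> \<in> multi_indices k. key \<beta> < Suc s}" and ?B = "{\<beta> \<in> multi_indices l. key \<beta> < t}"
  obtain c d where fg: "f = (\<lambda>z. \<Sum>\<beta>\<in>?A. c \<beta> * monomial \<beta> z)" "g = (\<lambda>z. \<Sum>\<beta>\<in>?B. d \<beta> * monomial \<beta> z)"
    using assms unfolding lower_span_def by blast
  have "(\<lambda>z. f z * g z) = (\<lambda>z. \<Sum>p\<in>?A \<times> ?B. (c (fst p) * d (snd p)) * monomial (\<lambda>i. fst p i + snd p i) z)"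
    unfolding fg sum_product sum.cartesian_product monomial_add
    by (intro ext sum.cong refl) (simp add: split_beta mult_ac)
  also have "\<dots> \<in> lower_span (k + l) (s * t)"
  proof (rule lower_spanI)
    fix p assume p: "p \<in> ?A \<times> ?B"
    then show "(\<lambda>i. fst p i + snd p i) \<in> multi_indices (k + l)" by (auto intro: multi_indices_add)
    have "key (fst p) \<le> s" "key (snd p) < t" using p by auto
    then have "key (fst p) * key (snd p) < s * t"
      using assms(3) by (meson le_less_trans mult_le_mono1 mult_less_mono2)
    then show "key (\<lambda>i. fst p i + snd p i) < s * t" by (simp add: key(2))
  qed simp
  finally show ?thesis .
qed

lemma monomial_in_lower_span: "\<alpha> \<in> multi_indices k \<Longrightarrow> key \<alpha> < t \<Longrightarrow> monomial \<alpha> \<in> lower_span k t"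
  using lower_spanI[of "{()}" "\<lambda>_. \<alpha>" k t "\<lambda>_. 1"] by simp

lemma zero_in_lower_span: "(\<lambda>z. 0) \<in> lower_span k t"
  using lower_spanI[of "{}"] by simp

lemma lower_span_mono: "s \<le> t \<Longrightarrow> f \<in> lower_span k s \<Longrightarrow> f \<in> lower_span k t"
proof -
  assume st: "s \<le> t" and "f \<in> lower_span k s"
  then obtain c where f: "f = (\<lambda>z. \<Sum>\<beta>\<in>{\<beta> \<in> multi_indices k. key \<beta> < s}. c \<beta> * monomial \<beta> z)"
    unfolding lower_span_def by blast
  show ?thesis unfolding f using st by (intro lower_spanI) auto
qed

lemma monic_polys_mult:
  assumes \<alpha>: "\<alpha> \<in> multi_indices k" "\<beta> \<in> multi_indices l" and f: "f \<in> monic_polys k \<alpha>" and g: "g \<in> monic_polys l \<beta>"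
  shows "(\<lambda>z. f z * g z) \<in> monic_polys (k + l) (\<lambda>i. \<alpha> i + \<beta> i)"
proof -
  obtain f' g' where f': "f' \<in> lower_span k (key \<alpha>)" "f = (\<lambda>z. monomial \<alpha> z + f' z)"
    and g': "g' \<in> lower_span l (key \<beta>)" "g = (\<lambda>z. monomial \<beta> z + g' z)"
    using f g unfolding monic_polys_def by blast
  have 1: "(\<lambda>z. monomial \<alpha> z * g' z) \<in> lower_span (k + l) (key \<alpha> * key \<beta>)"
    using \<alpha> g' key(3) by (intro lower_span_mult monomial_in_lower_span) auto
  have "(\<lambda>z. monomial \<beta> z * f' z) \<in> lower_span (l + k) (key \<beta> * key \<alpha>)"
    using \<alpha> f' key(3) by (intro lower_span_mult monomial_in_lower_span) auto
  then have 2: "(\<lambda>z. monomial \<beta> z * f' z) \<in> lower_span (k + l) (key \<alpha> * key \<beta>)"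
    by (simp add: add.commute mult.commute)
  have 3: "(\<lambda>z. f' z * g' z) \<in> lower_span (k + l) (key \<alpha> * key \<beta>)"
    using f' g' key(3) by (intro lower_span_mult lower_span_mono[of "key \<alpha>" "Suc (key \<alpha>)"]) auto
  let ?h = "\<lambda>z. monomial \<alpha> z * g' z + (monomial \<beta> z * f' z + f' z * g' z)"
  have "?h \<in> lower_span (k + l) (key \<alpha> * key \<beta>)" by (intro lower_span_add 1 2 3)
  moreover have "(\<lambda>z. f z * g z) = (\<lambda>z. monomial (\<lambda>i. \<alpha> i + \<beta> i) z + ?h z)"
    unfolding f' g' monomial_add by (simp add: algebra_simps)
  ultimately show ?thesis unfolding monic_polys_def key(2) by (intro image_eqI[where x = ?h])
qed

lemma wbdd_monic_polys: "f \<in> monic_polys k \<alpha> \<Longrightarrow> wbdd K (weight k) f"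
  unfolding monic_polys_def lower_span_def using weight_pos less_imp_le
  by (auto intro!: wbdd_add wbdd_sum wbdd_cmult wbdd_monomial)

lemma wnorm_monic_polys_nonneg: "f \<in> monic_polys k \<alpha> \<Longrightarrow> wnorm K (weight k) f \<ge> 0"
  using wnorm_nonneg[OF nonempty _ wbdd_monic_polys] weight_pos less_imp_le by metis

lemma monomial_in_monic_polys: "monomial \<alpha> \<in> monic_polys k \<alpha>"
  unfolding monic_polys_def by (rule image_eqI[OF _ zero_in_lower_span]) simp

lemma monic_polys_nonempty: "monic_polys k \<alpha> \<noteq> {}" using monomial_in_monic_polys by blast

lemma cheb_const_le: "f \<in> monic_polys k \<alpha> \<Longrightarrow> cheb_const k \<alpha> \<le> wnorm K (weight k) f"
  unfolding cheb_const_def using wnorm_monic_polys_nonneg by (intro cINF_lower bdd_belowI2) auto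

lemma cheb_const_nonneg: "cheb_const k \<alpha> \<ge> 0"
  unfolding cheb_const_def using wnorm_monic_polys_nonneg monic_polys_nonempty by (intro cINF_greatest) auto

lemma cheb_const_bound: "\<alpha> \<in> multi_indices k \<Longrightarrow> cheb_const k \<alpha> \<le> (R * exp C) ^ k"
proof -
  assume a: "\<alpha> \<in> multi_indices k"
  have "wnorm K (weight k) (monomial \<alpha>) \<le> (R * exp C) ^ k"
    unfolding wnorm_def using nonempty monomial_bound[OF a] by (intro cSUP_least) auto
  then show ?thesis using cheb_const_le[OF monomial_in_monic_polys] order_trans by blast
qed

text \<open>Products of competitors are competitors for the sum of the exponents, and the weights of
  levels \<open>k\<close> and \<open>l\<close> multiply to that of \<open>k + l\<close>.\<close>

lemma cheb_const_add:
  assumes "\<alpha> \<in> multi_indices k" "\<beta> \<in> multi_indices l"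
  shows "cheb_const (k + l) (\<lambda>i. \<alpha> i + \<beta> i) \<le> cheb_const k \<alpha> * cheb_const l \<beta>"
  unfolding cheb_const_def[of k] cheb_const_def[of l]
proof (rule le_INF_mult)
  fix f g assume f: "f \<in> monic_polys k \<alpha>" and g: "g \<in> monic_polys l \<beta>"
  have "wnorm K (weight (k + l)) (\<lambda>z. f z * g z) \<le> wnorm K (weight k) f * wnorm K (weight l) g"
    unfolding wnorm_def[of K "weight (k + l)"]
  proof (rule cSUP_least[OF nonempty])
    fix z assume z: "z \<in> K"
    have "weight (k + l) z = weight k z * weight l z"
      by (simp add: weight_def exp_add[symmetric] algebra_simps)
    then have "cmod (f z * g z) * weight (k + l) z = (cmod (f z) * weight k z) * (cmod (g z) * weight l z)"
      by (simp add: norm_mult)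
    also have "\<dots> \<le> wnorm K (weight k) f * wnorm K (weight l) g"
      using weight_pos[THEN less_imp_le]
      by (intro mult_mono wnorm_upper wbdd_monic_polys[OF f] wbdd_monic_polys[OF g]
          wnorm_monic_polys_nonneg[OF f] z) auto
    finally show "cmod (f z * g z) * weight (k + l) z \<le> wnorm K (weight k) f * wnorm K (weight l) g" .
  qed
  then show "cheb_const (k + l) (\<lambda>i. \<alpha> i + \<beta> i) \<le> wnorm K (weight k) f * wnorm K (weight l) g"
    using cheb_const_le[OF monic_polys_mult[OF assms f g]] by linarith
qed (use monic_polys_nonempty wnorm_monic_polys_nonneg in auto)

text \<open>With the monomials listed in increasing order, the functions before the
  \<open>s\<close>-th one span exactly its \<open>lower_span\<close>, so the Chebyshev constants of
  the abstract system are the \<open>cheb_const\<close>. The order used in \<open>VDM\<close>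
  changes only the sign.\<close>

lemma max_VDM_bounds:
  defines "N \<equiv> poly_dim TYPE('n)"
  shows "(\<Prod>\<alpha>\<in>multi_indices k. cheb_const k \<alpha>) \<le> max_VDM K v k"
    "max_VDM K v k \<le> fact (N k) * (\<Prod>\<alpha>\<in>multi_indices k. cheb_const k \<alpha>)"
    "\<And>x. x \<in> {..<N k} \<rightarrow>\<^sub>E K \<Longrightarrow> cmod (weighted_VDM v k x) \<le> max_VDM K v k"
proof -
  let ?M = "multi_indices k :: ('n \<Rightarrow> nat) set"
  have cardM: "card ?M = N k" unfolding N_def by (rule card_multi_indices)
  have "card (key ` ?M) = N k" using cardM key(1) by (simp add: card_image inj_on_subset)
  then obtain h where h: "bij_betw h {..<N k} (key ` ?M)" "strict_mono_on {..<N k} h"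
    using ex_bij_betw_strict_mono_card[of "key ` ?M"] by auto
  define e where "e = Hilbert_Choice.inv key \<circ> h"
  have inv: "bij_betw (Hilbert_Choice.inv key) (key ` ?M) ?M"
    using key(1) by (intro bij_betwI[where g = key]) (auto simp: inv_f_f)
  have e: "bij_betw e {..<N k} ?M" unfolding e_def by (rule bij_betw_trans[OF h(1) inv])
  have ke: "key (e i) = h i" if "i < N k" for i
  proof -
    have "h i \<in> range key" using h(1) that unfolding bij_betw_def by auto
    then show ?thesis by (simp add: e_def f_inv_into_f)
  qed
  have e_less: "bij_betw e {..<s} {\<beta> \<in> ?M. key \<beta> < key (e s)}" if s: "s < N k" for s
    unfolding bij_betw_def
  proof
    show "inj_on e {..<s}" using e s by (auto simp: bij_betw_def intro: inj_on_subset)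
    show "e ` {..<s} = {\<beta> \<in> ?M. key \<beta> < key (e s)}"
    proof (intro equalityI subsetI)
      fix \<beta> assume "\<beta> \<in> e ` {..<s}"
      then obtain i where i: "i < s" "\<beta> = e i" by auto
      then have "h i < h s" using h(2) s by (auto simp: strict_mono_on_def)
      then show "\<beta> \<in> {\<beta> \<in> ?M. key \<beta> < key (e s)}"
        using i s ke e by (auto simp: bij_betw_def)
    next
      fix \<beta> assume b: "\<beta> \<in> {\<beta> \<in> ?M. key \<beta> < key (e s)}"
      then have "\<beta> \<in> e ` {..<N k}" using e by (auto simp: bij_betw_def)
      then obtain i where i: "i < N k" "\<beta> = e i" by auto
      then have "h i < h s" using b ke s by simp
      then have "i < s" using h(2) i s by (metis lessThan_iff linorder_neqE_nat order_less_asym strict_mono_on_def order_less_irrefl)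
      then show "\<beta> \<in> e ` {..<s}" using i by auto
    qed
  qed
  interpret W: weighted_system K "weight k" "\<lambda>i. monomial (e i)" by (rule weighted_system_monomials)
  have cheb: "W.chebyshev s = cheb_const k (e s)" if s: "s < N k" for s
  proof -
    let ?J = "{\<beta> \<in> ?M. key \<beta> < key (e s)}"
    note bj = e_less[OF s]
    have "range (W.monic s) = monic_polys k (e s)"
    proof (intro equalityI subsetI)
      fix f assume "f \<in> range (W.monic s)"
      then obtain c where f: "f = W.monic s c" by auto
      have "(\<lambda>z. \<Sum>i<s. c i * monomial (e i) z) \<in> lower_span k (key (e s))"
        using bj by (intro lower_spanI) (auto simp: bij_betw_def)
      then show "f \<in> monic_polys k (e s)" unfolding f monic_polys_def W.monic_def[abs_def] by (rule rev_image_eqI) simp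
    next
      fix f assume "f \<in> monic_polys k (e s)"
      then obtain c where f: "f = (\<lambda>z. monomial (e s) z + (\<Sum>\<beta>\<in>?J. c \<beta> * monomial \<beta> z))"
        unfolding monic_polys_def lower_span_def by auto
      have "f = W.monic s (\<lambda>i. c (e i))"
        unfolding f W.monic_def[abs_def] using sum.reindex_bij_betw[OF bj, of "\<lambda>\<beta>. c \<beta> * monomial \<beta> _"] by auto
      then show "f \<in> range (W.monic s)" by auto
    qed
    then show ?thesis unfolding W.chebyshev_def cheb_const_def by (metis image_image)
  qed
  have prod_cheb: "(\<Prod>s<N k. W.chebyshev s) = (\<Prod>\<alpha>\<in>?M. cheb_const k \<alpha>)"
    using prod.reindex_bij_betw[OF e, of "cheb_const k"] cheb by simp
  have VDM: "cmod (weighted_VDM v k x) = W.weighted_vandermonde (N k) x" for x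
  proof -
    let ?f = "from_nat_into ?M"
    have f: "bij_betw ?f {..<N k} ?M" using bij_betw_from_nat_into_finite[of ?M] cardM by simp
    \<comment> \<open>\<open>p\<close> carries the increasing enumeration to the one by
      \<open>from_nat_into\<close>.\<close>
    define p where "p = (\<lambda>i. if i < N k then the_inv_into {..<N k} e (?f i) else i)"
    have "bij_betw (the_inv_into {..<N k} e \<circ> ?f) {..<N k} {..<N k}"
      by (rule bij_betw_trans[OF f bij_betw_the_inv_into[OF e]])
    then have "bij_betw p {..<N k} {..<N k}" by (rule bij_betw_cong[THEN iffD1, rotated]) (simp add: p_def)
    then have p: "p permutes {0..<N k}" unfolding atLeast0LessThan by (rule bij_imp_permutes) (simp add: p_def)
    have ep: "e (p i) = ?f i" if "i < N k" for i
      using that f_the_inv_into_f_bij_betw[OF e, of "?f i"] f by (auto simp: p_def bij_betw_def)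
    have plt: "p i < N k" if "i < N k" for i using permutes_in_image[OF p, of i] that by simp
    let ?A = "mat (N k) (N k) (\<lambda>(i, j). monomial (e i) (x j))"
    have "VDM k x = Determinant.det (mat (N k) (N k) (\<lambda>(i, j). ?A $$ (p i, j)))"
      unfolding VDM_def N_def[symmetric]
      by (intro arg_cong[of _ _ Determinant.det] eq_matI) (auto simp: monomial_basis_def plt ep monomial_def)
    also have "\<dots> = signof p * Determinant.det ?A" by (rule det_permute_rows[OF _ p]) simp
    finally have "cmod (VDM k x) = cmod (vandermonde (N k) (\<lambda>i. monomial (e i)) x)"
      by (simp add: vandermonde_def norm_mult sign_def)
    then show ?thesis
      unfolding weighted_VDM_def W.weighted_vandermonde_def N_def[symmetric] weight_def
      by (simp add: norm_mult prod_norm[symmetric])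
  qed
  have fek: "W.fekete (N k) = max_VDM K v k"
    unfolding W.fekete_def max_VDM_def N_def[symmetric] VDM ..
  show "(\<Prod>\<alpha>\<in>?M. cheb_const k \<alpha>) \<le> max_VDM K v k"
    "max_VDM K v k \<le> fact (N k) * (\<Prod>\<alpha>\<in>?M. cheb_const k \<alpha>)"
    using W.fekete_chebyshev_bounds[of "N k"] unfolding prod_cheb fek by auto
  show "cmod (weighted_VDM v k x) \<le> max_VDM K v k" if "x \<in> {..<N k} \<rightarrow>\<^sub>E K" for x
    using W.fekete_upper[OF that] unfolding VDM fek .
qed

end

section \<open>Multi-indices as chains, and the growth of the dimension\<close>

text \<open>Chains are the partial sums of multi-indices with respect to an enumeration \<open>r\<close> of the coordinates.\<close>

definition differences :: "('n \<Rightarrow> nat) \<Rightarrow> (nat \<Rightarrow> nat) \<Rightarrow> 'n \<Rightarrow> nat" where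
  "differences r S i = S (r i) - (if r i = 0 then 0 else S (r i - 1))"

text \<open>Natural subtraction is additive here because chains are monotone.\<close>

lemma differences_add:
  assumes "S \<in> mono_chains n k" "T \<in> mono_chains n l" "\<And>i. r i < n"
  shows "differences r (\<lambda>i\<in>{..<n}. S i + T i) = (\<lambda>i. differences r S i + differences r T i)"
proof
  fix i
  have "r i < n" by (rule assms(3))
  moreover have "S (r i - 1) \<le> S (r i)" "T (r i - 1) \<le> T (r i)" if "r i \<noteq> 0"
    using assms by (auto simp: mono_chains_def mono_on_def less_imp_diff_less)
  ultimately show "differences r (\<lambda>i\<in>{..<n}. S i + T i) i = differences r S i + differences r T i"
    by (auto simp: differences_def)
qed

lemma bij_betw_differences:
  fixes r :: "'n::finite \<Rightarrow> nat"
  assumes r: "bij_betw r UNIV {..<n}"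
  shows "bij_betw (differences r) (mono_chains n k) (multi_indices k)"
proof -
  define h where "h = Hilbert_Choice.inv r"
  have rh: "r (h j) = j" if "j < n" for j
    unfolding h_def using that r by (intro f_inv_into_f) (auto simp: bij_betw_def)
  have hr: "h (r i) = i" for i unfolding h_def using r by (intro inv_f_f) (auto simp: bij_betw_def)
  have rn: "r i < n" for i using r by (auto simp: bij_betw_def)
  have h: "bij_betw h {..<n} UNIV" by (intro bij_betwI[where g = r]) (use rh hr rn in auto)
  have n: "n > 0" using rn gr0I by (metis less_nat_zero_code)
  have tele: "(\<Sum>j<Suc m. differences r S (h j)) = S m" if S: "S \<in> mono_chains n k" and "m < n" for S m
    using \<open>m < n\<close>
  proof (induction m)
    case 0
    then show ?case by (simp add: differences_def rh)
  next
    case (Suc m)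
    then have "S m \<le> S (Suc m)" using S by (auto simp: mono_chains_def mono_on_def)
    then show ?case using Suc by (simp add: differences_def rh)
  qed
  have sumh: "(\<Sum>i\<in>UNIV. \<alpha> i) = (\<Sum>j<n. \<alpha> (h j))" for \<alpha> :: "'n \<Rightarrow> nat"
    using sum.reindex_bij_betw[OF h, of \<alpha>] by simp
  define g where "g = (\<lambda>\<alpha> :: 'n \<Rightarrow> nat. \<lambda>m\<in>{..<n}. \<Sum>j<Suc m. \<alpha> (h j))"
  show ?thesis
  proof (rule bij_betwI[where g = g])
    show "differences r \<in> mono_chains n k \<rightarrow> multi_indices k"
    proof
      fix S assume S: "S \<in> mono_chains n k"
      have "(\<Sum>i\<in>UNIV. differences r S i) = S (n - 1)"
        using tele[OF S, of "n - 1"] n unfolding sumh by simp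
      also have "\<dots> \<le> k" using S n by (auto simp: mono_chains_def PiE_iff)
      finally show "differences r S \<in> multi_indices k" by (simp add: multi_indices_def)
    qed
    show "g \<in> multi_indices k \<rightarrow> mono_chains n k"
    proof
      fix \<alpha> :: "'n \<Rightarrow> nat" assume a: "\<alpha> \<in> multi_indices k"
      have "(\<Sum>j<Suc m. \<alpha> (h j)) \<le> k" if "m < n" for m
      proof -
        have "(\<Sum>j<Suc m. \<alpha> (h j)) \<le> (\<Sum>j<n. \<alpha> (h j))" using that by (intro sum_mono2) auto
        then show ?thesis using a unfolding multi_indices_def sumh by simp
      qed
      then show "g \<alpha> \<in> mono_chains n k"
        by (auto simp: g_def mono_chains_def mono_on_def simp del: sum.lessThan_Suc intro!: sum_mono2)
    qed
    show "g (differences r S) = S" if S: "S \<in> mono_chains n k" for S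
    proof
      fix m show "g (differences r S) m = S m"
        using tele[OF S, of m] S
        by (cases "m < n") (auto simp: g_def mono_chains_def PiE_iff extensional_def simp del: sum.lessThan_Suc)
    qed
    show "differences r (g \<alpha>) = \<alpha>" for \<alpha>
    proof
      fix i
      have "g \<alpha> (r i) = (\<Sum>j<r i. \<alpha> (h j)) + \<alpha> i" using rn by (simp add: g_def hr)
      moreover have "(if r i = 0 then 0 else g \<alpha> (r i - 1)) = (\<Sum>j<r i. \<alpha> (h j))"
        using rn[of i] by (cases "r i") (auto simp: g_def)
      ultimately show "differences r (g \<alpha>) i = \<alpha> i" by (simp add: differences_def)
    qed
  qed
qed

text \<open>Only the positivity of the limit matters: it converts the normalization of the chain
  sums by \<open>k ^ Suc n\<close> into one by \<open>k * N\<close>.\<close>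

lemma poly_dim_asymp:
  "\<exists>c>0. (\<lambda>k. real (poly_dim TYPE('n::finite) k) / real k ^ CARD('n)) \<longlonglongrightarrow> c"
proof -
  let ?n = "CARD('n)"
  have 1: "real (poly_dim TYPE('n) k) / real k ^ ?n = (\<Prod>i=0..<?n. real (?n + k - i) / real k / real (?n - i))" if "k > 0" for k
  proof -
    have "poly_dim TYPE('n) k = (?n + k) choose ?n"
      unfolding poly_dim_def using binomial_symmetric[of k "?n + k"] by simp
    then have "real (poly_dim TYPE('n) k) = (\<Prod>i=0..<?n. real (?n + k - i) / real (?n - i))"
      by (simp only: binomial_altdef_of_nat[of ?n "?n + k"] le_add1)
    then have "real (poly_dim TYPE('n) k) / real k ^ ?n = (\<Prod>i=0..<?n. real (?n + k - i) / real (?n - i)) / (\<Prod>i=0..<?n. real k)"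
      by simp
    also have "\<dots> = (\<Prod>i=0..<?n. real (?n + k - i) / real (?n - i) / real k)" by (rule prod_dividef[symmetric])
    finally show ?thesis by (simp add: field_simps)
  qed
  have "(\<lambda>k. \<Prod>i=0..<?n. real (?n + k - i) / real k / real (?n - i)) \<longlonglongrightarrow> (\<Prod>i=0..<?n. 1 / real (?n - i))"
  proof (intro tendsto_prod tendsto_divide tendsto_const)
    fix i assume i: "i \<in> {0..<?n}"
    then have "(\<lambda>k. real (?n + k - i) / real k) = (\<lambda>k. (real (?n - i) + real k) / real k)"
      by (simp add: of_nat_diff algebra_simps)
    moreover have "(\<lambda>k. (real (?n - i) + real k) / real k) \<longlonglongrightarrow> 1" by real_asymp
    ultimately show "(\<lambda>k. real (?n + k - i) / real k) \<longlonglongrightarrow> 1" by simp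
  qed auto
  then have "(\<lambda>k. real (poly_dim TYPE('n) k) / real k ^ ?n) \<longlonglongrightarrow> (\<Prod>i=0..<?n. 1 / real (?n - i))"
    by (rule Lim_transform_eventually) (use 1 in \<open>auto intro: eventually_mono[OF eventually_gt_at_top[of 0]]\<close>)
  moreover have "(\<Prod>i=0..<?n. 1 / real (?n - i)) > 0" by (intro prod_pos) auto
  ultimately show ?thesis by blast
qed

lemma ln_poly_dim_asymp: "(\<lambda>k. ln (real (poly_dim TYPE('n::finite) k)) / real k) \<longlonglongrightarrow> 0"
proof (rule tendsto_sandwich)
  let ?n = "CARD('n)"
  show "\<forall>\<^sub>F k in sequentially. 0 \<le> ln (real (poly_dim TYPE('n) k)) / real k"
    using poly_dim_pos[where ?'n = 'n] by (auto intro!: divide_nonneg_nonneg simp: Suc_le_eq)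
  have "(\<lambda>k. ln (real ?n + real k) / real k) \<longlonglongrightarrow> 0" by real_asymp
  from tendsto_mult_left[OF this, of "real ?n"]
  show "(\<lambda>k. real ?n * (ln (real ?n + real k) / real k)) \<longlonglongrightarrow> 0" by simp
  have "ln (real (poly_dim TYPE('n) k)) / real k \<le> real ?n * (ln (real ?n + real k) / real k)" for k
  proof -
    have "poly_dim TYPE('n) k = (?n + k) choose ?n"
      unfolding poly_dim_def using binomial_symmetric[of k "?n + k"] by simp
    then have "poly_dim TYPE('n) k \<le> (?n + k) ^ ?n" using binomial_le_pow[of ?n "?n + k"] by simp
    then have "real (poly_dim TYPE('n) k) \<le> real (?n + k) ^ ?n" by (metis of_nat_le_iff of_nat_power)
    then have "ln (real (poly_dim TYPE('n) k)) \<le> ln (real (?n + k) ^ ?n)"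
      using poly_dim_pos[where ?'n = 'n, of k] by (subst ln_le_cancel_iff) auto
    also have "\<dots> = real ?n * ln (real ?n + real k)" by (simp add: ln_realpow)
    finally show ?thesis by (simp add: divide_right_mono)
  qed
  then show "\<forall>\<^sub>F k in sequentially. ln (real (poly_dim TYPE('n) k)) / real k \<le> real ?n * (ln (real ?n + real k) / real k)" by simp
qed simp

lemma (in weighted_compact) max_VDM_root_convergent:
  "convergent (\<lambda>k. max_VDM K v k powr (1 / (real k * real (poly_dim TYPE('n) k))))"
proof (cases "\<exists>k. \<exists>\<alpha>\<in>multi_indices k. cheb_const k \<alpha> = 0")
  case True
  then obtain k0 \<alpha> where a: "\<alpha> \<in> multi_indices k0" "cheb_const k0 \<alpha> = 0" by blast
  \<comment> \<open>Adding the exponent 0 at level \<open>k - k0\<close> keeps the vanishing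
    constant zero at every higher level, and with it the whole product.\<close>
  have "max_VDM K v k = 0" if "k \<ge> k0" for k
  proof -
    have z: "(\<lambda>i. 0) \<in> (multi_indices (k - k0) :: ('n \<Rightarrow> nat) set)" by (simp add: multi_indices_def)
    from cheb_const_add[OF a(1) z] have "cheb_const k \<alpha> \<le> 0" using a(2) that by simp
    then have c: "cheb_const k \<alpha> = 0" using cheb_const_nonneg[of k \<alpha>] by linarith
    have "\<alpha> \<in> multi_indices k" using a(1) that by (simp add: multi_indices_def)
    then have p: "(\<Prod>\<alpha>\<in>multi_indices k. cheb_const k \<alpha>) = 0" using c by (intro prod_zero) auto
    show ?thesis using max_VDM_bounds(1,2)[of k] unfolding p by simp
  qed
  then have "\<forall>\<^sub>F k in sequentially. 0 = max_VDM K v k powr (1 / (real k * real (poly_dim TYPE('n) k)))"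
    by (intro eventually_mono[OF eventually_ge_at_top[of k0]]) auto
  then show ?thesis by (intro convergentI[where L = 0] Lim_transform_eventually[OF tendsto_const])
next
  case False
  let ?N = "\<lambda>k. poly_dim TYPE('n) k" and ?n = "CARD('n)"
  have pos: "cheb_const k \<alpha> > 0" if "\<alpha> \<in> multi_indices k" for k \<alpha>
    using False that cheb_const_nonneg[of k \<alpha>] by fastforce
  define E where "E = R * exp C"
  have E: "E > 0" using R by (simp add: E_def)
  obtain r :: "'n \<Rightarrow> nat" where r: "bij_betw r UNIV {..<?n}"
    using ex_bij_betw_finite_nat[of "UNIV :: 'n set"] by (auto simp: atLeast0LessThan)
  have rn: "r i < ?n" for i using r by (auto simp: bij_betw_def)
  note bij = bij_betw_differences[OF r]
  have mem: "differences r S \<in> multi_indices k" if "S \<in> mono_chains ?n k" for S k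
    using bij[of k] that by (auto simp: bij_betw_def)
  \<comment> \<open>\<open>E ^ k\<close> bounds the Chebyshev constants at level \<open>k\<close>,
    so the shift makes all terms nonpositive. Over all chains it adds up to
    \<open>N * k * ln E\<close>, that is, \<open>ln E\<close> after normalization.\<close>
  define a where "a = (\<lambda>k S. ln (cheb_const k (differences r S)) - real k * ln E)"
  interpret subadditive_on_chains ?n a
  proof
    fix S k assume S: "S \<in> mono_chains ?n k"
    have "ln (cheb_const k (differences r S)) \<le> ln (E ^ k)"
      using cheb_const_bound[OF mem[OF S]] pos[OF mem[OF S]] E by (subst ln_le_cancel_iff) (auto simp: E_def)
    then show "a k S \<le> 0" using E by (simp add: a_def ln_realpow)
  next
    fix S k T l assume S: "S \<in> mono_chains ?n k" and T: "T \<in> mono_chains ?n l"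
    have e: "differences r (\<lambda>i\<in>{..<?n}. S i + T i) = (\<lambda>i. differences r S i + differences r T i)"
      by (rule differences_add[OF S T rn])
    have "ln (cheb_const (k + l) (\<lambda>i. differences r S i + differences r T i))
        \<le> ln (cheb_const k (differences r S) * cheb_const l (differences r T))"
      using cheb_const_add[OF mem[OF S] mem[OF T]] pos[OF multi_indices_add[OF mem[OF S] mem[OF T]]]
        pos[OF mem[OF S]] pos[OF mem[OF T]] by (subst ln_le_cancel_iff) auto
    then show "a (k + l) (\<lambda>i\<in>{..<?n}. S i + T i) \<le> a k S + a l T"
      using pos[OF mem[OF S]] pos[OF mem[OF T]] by (simp add: a_def e ln_mult algebra_simps)
  qed
  let ?P = "\<lambda>k. \<Prod>\<alpha>\<in>multi_indices k. cheb_const k \<alpha>"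
  have Ppos: "?P k > 0" for k by (intro prod_pos) (use pos in auto)
  have lnP: "ln (?P k) = total k + real (?N k) * (real k * ln E)" for k
  proof -
    have "ln (?P k) = (\<Sum>\<alpha>\<in>multi_indices k. ln (cheb_const k \<alpha>))" by (intro ln_prod) (auto dest: pos)
    also have "\<dots> = (\<Sum>S\<in>mono_chains ?n k. ln (cheb_const k (differences r S)))"
      by (rule sum.reindex_bij_betw[OF bij, symmetric])
    also have "\<dots> = total k + real (card (mono_chains ?n k)) * (real k * ln E)"
      unfolding total_def by (simp add: a_def sum_subtractf)
    also have "card (mono_chains ?n k) = ?N k"
      using bij_betw_same_card[OF bij[of k]] card_multi_indices[where ?'n = 'n, of k] by simp
    finally show ?thesis .
  qed
  have Vpos: "max_VDM K v k > 0" for k using max_VDM_bounds(1)[of k] Ppos[of k] by linarith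
  define L where "L = (\<lambda>k. ln (max_VDM K v k) / (real k * real (?N k)))"
  define T where "T = (\<lambda>k. total k / (real k * real (?N k)))"
  have Npos: "real (?N k) > 0" for k using poly_dim_pos[where ?'n = 'n] by simp
  have bounds: "T k + ln E \<le> L k" "L k \<le> T k + ln E + ln (real (?N k)) / real k" if k: "k > 0" for k
  proof -
    have eq: "ln (?P k) / (real k * real (?N k)) = T k + ln E"
      using k Npos[of k] by (simp add: lnP T_def field_simps)
    have "ln (?P k) \<le> ln (max_VDM K v k)"
      using max_VDM_bounds(1)[of k] Ppos Vpos by (subst ln_le_cancel_iff)
    then show "T k + ln E \<le> L k" unfolding eq[symmetric] L_def by (intro divide_right_mono) auto
    have "ln (max_VDM K v k) \<le> ln (fact (?N k) * ?P k)"
      using max_VDM_bounds(2)[of k] Ppos[of k] Vpos[of k] by (subst ln_le_cancel_iff) auto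
    also have "\<dots> = ln (fact (?N k)) + ln (?P k)" by (intro ln_mult_pos Ppos) simp
    also have "ln (fact (?N k) :: real) \<le> ln (real (?N k) ^ ?N k)"
    proof (subst ln_le_cancel_iff)
      show "(fact (?N k) :: real) \<le> real (?N k) ^ ?N k"
        using fact_le_power[of "?N k", where 'a = real] by simp
    qed (use Npos in auto)
    also have "ln (real (?N k) ^ ?N k) = real (?N k) * ln (real (?N k))" using Npos by (simp add: ln_realpow)
    finally have "L k \<le> (real (?N k) * ln (real (?N k)) + ln (?P k)) / (real k * real (?N k))"
      unfolding L_def by (intro divide_right_mono) auto
    also have "\<dots> = ln (?P k) / (real k * real (?N k)) + ln (real (?N k)) / real k"
      using k Npos[of k] by (simp add: add_divide_distrib)
    finally show "L k \<le> T k + ln E + ln (real (?N k)) / real k" unfolding eq .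
  qed
  have root: "max_VDM K v k powr (1 / (real k * real (?N k))) = exp (L k)" for k
    using Vpos[of k] by (simp add: L_def powr_def)
  obtain c where c: "c > 0" "(\<lambda>k. real (?N k) / real k ^ ?n) \<longlonglongrightarrow> c"
    using poly_dim_asymp[where ?'n = 'n] by blast
  have T: "T k = total k / real k ^ Suc ?n * inverse (real (?N k) / real k ^ ?n)" for k
    by (simp add: T_def field_simps)
  have ci: "(\<lambda>k. inverse (real (?N k) / real k ^ ?n)) \<longlonglongrightarrow> inverse c"
    using c by (intro tendsto_inverse) auto
  from total_limit show ?thesis
  proof
    assume "\<exists>L. (\<lambda>k. total k / real k ^ Suc ?n) \<longlonglongrightarrow> L"
    then obtain l where "(\<lambda>k. total k / real k ^ Suc ?n) \<longlonglongrightarrow> l" by blast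
    then have Tl: "T \<longlonglongrightarrow> l * inverse c" unfolding T[abs_def] by (intro tendsto_mult ci)
    have "L \<longlonglongrightarrow> l * inverse c + ln E"
    proof (rule tendsto_sandwich)
      show "\<forall>\<^sub>F k in sequentially. T k + ln E \<le> L k"
        using bounds(1) by (intro eventually_mono[OF eventually_gt_at_top[of 0]])
      show "\<forall>\<^sub>F k in sequentially. L k \<le> T k + ln E + ln (real (?N k)) / real k"
        using bounds(2) by (intro eventually_mono[OF eventually_gt_at_top[of 0]])
      show "(\<lambda>k. T k + ln E) \<longlonglongrightarrow> l * inverse c + ln E" by (intro tendsto_intros Tl)
      have "(\<lambda>k. T k + ln E + ln (real (?N k)) / real k) \<longlonglongrightarrow> l * inverse c + ln E + 0"
        by (intro tendsto_add Tl tendsto_const ln_poly_dim_asymp)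
      then show "(\<lambda>k. T k + ln E + ln (real (?N k)) / real k) \<longlonglongrightarrow> l * inverse c + ln E" by simp
    qed
    then have "(\<lambda>k. exp (L k)) \<longlonglongrightarrow> exp (l * inverse c + ln E)" by (rule tendsto_exp)
    then show ?thesis unfolding root by (rule convergentI)
  next
    assume bot: "filterlim (\<lambda>k. total k / real k ^ Suc ?n) at_bot sequentially"
    have "filterlim T at_bot sequentially"
      unfolding T[abs_def] using filterlim_tendsto_pos_mult_at_bot[OF ci _ bot] c by (simp add: mult.commute)
    moreover have "(\<lambda>k. ln E + ln (real (?N k)) / real k) \<longlonglongrightarrow> ln E + 0"
      by (intro tendsto_add tendsto_const ln_poly_dim_asymp)
    ultimately have "filterlim (\<lambda>k. (ln E + ln (real (?N k)) / real k) + T k) at_bot sequentially"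
      by (simp add: filterlim_tendsto_add_at_bot_iff)
    then have "filterlim L at_bot sequentially"
      by (rule filterlim_at_bot_mono)
        (use bounds(2) in \<open>auto simp: algebra_simps intro!: eventually_mono[OF eventually_gt_at_top[of 0]]\<close>)
    then have "(\<lambda>k. exp (L k)) \<longlonglongrightarrow> 0" by (rule filterlim_compose[OF exp_at_bot])
    then show ?thesis unfolding root by (rule convergentI)
  qed
qed

section \<open>Weak-* neighbourhoods and the upper bound\<close>

lemma integrable_prob_measures:
  fixes f :: "'a::t2_space \<Rightarrow> real"
  assumes "compact K" "\<nu> \<in> prob_measures K" "continuous_on K f"
  shows "integrable \<nu> f"
proof -
  interpret prob_space \<nu> using assms(2) by (simp add: prob_measures_def)
  have s: "sets \<nu> = sets (restrict_space borel K)" using assms(2) by (simp add: prob_measures_def)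
  then have sp: "space \<nu> = K" using sets_eq_imp_space_eq[OF s] by (simp add: space_restrict_space)
  have "f \<in> borel_measurable \<nu>"
    using borel_measurable_continuous_on_restrict[OF assms(3)] measurable_cong_sets[OF s refl] by blast
  moreover obtain B where "\<And>x. x \<in> K \<Longrightarrow> \<bar>f x\<bar> \<le> B"
    using compact_imp_bounded[OF compact_continuous_image[OF assms(3,1)]] by (auto simp: bounded_iff)
  ultimately show ?thesis using sp by (intro integrable_const_bound[of _ B]) auto
qed

text \<open>The empirical measure is the image under \<open>a\<close> of the uniform measure on the
  indices.\<close>

lemma integral_empirical_measure:
  fixes f :: "'a::t2_space \<Rightarrow> real"
  assumes s: "s > 0" and a: "\<And>j. j < s \<Longrightarrow> a j \<in> K" and f: "continuous_on K f"
  shows "(LINT x|empirical_measure K s a. f x) = (\<Sum>j<s. f (a j)) / real s"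
proof -
  let ?B = "restrict_space borel K" and ?U = "uniform_count_measure {..<s}"
  have am: "a \<in> measurable ?U ?B"
    using a by (auto simp: measurable_def space_restrict_space sets_uniform_count_measure space_uniform_count_measure)
  note em = empirical_measure_in_prob_measures[of s a K, OF s a]
  have "empirical_measure K s a = distr ?U ?B a"
  proof (rule measure_eqI)
    show st: "sets (empirical_measure K s a) = sets (distr ?U ?B a)"
      using em(1) by (simp add: prob_measures_def)
    fix A assume "A \<in> sets (empirical_measure K s a)"
    then have A: "A \<in> sets ?B" using st by simp
    have "emeasure (distr ?U ?B a) A = emeasure ?U (a -` A \<inter> {..<s})"
      using A am by (simp add: emeasure_distr space_uniform_count_measure)
    also have "\<dots> = of_nat (card (a -` A \<inter> {..<s})) / of_nat s"
      using s by (simp add: emeasure_uniform_count_measure divide_ennreal[symmetric] ennreal_of_nat_eq_real_of_nat)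
    also have "of_nat (card (a -` A \<inter> {..<s})) = (\<Sum>j<s. indicator A (a j) :: ennreal)"
      by (simp add: indicator_def sum.If_cases Int_def vimage_def conj_commute)
    finally show "emeasure (empirical_measure K s a) A = emeasure (distr ?U ?B a) A"
      using em(2)[OF _ A] by simp
  qed
  then have "(LINT x|empirical_measure K s a. f x) = (LINT j|?U. f (a j))"
    using am borel_measurable_continuous_on_restrict[OF f] by (simp add: integral_distr)
  also have "\<dots> = (\<Sum>j<s. f (a j)) / real s" by (subst integral_uniform_count_measure) simp_all
  finally show ?thesis .
qed

lemma openin_weak_star_nbhd:
  fixes f :: "'a::topological_space \<Rightarrow> real"
  assumes "continuous_on K f"
  shows "openin (weak_star_topology K) {\<nu> \<in> prob_measures K. \<bar>(LINT x|\<nu>. f x) - c\<bar> < \<eta>}"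
proof -
  have "{\<nu> \<in> prob_measures K. \<bar>(LINT x|\<nu>. f x) - c\<bar> < \<eta>} = {\<nu> \<in> prob_measures K. (LINT x|\<nu>. f x) \<in> {c - \<eta><..<c + \<eta>}}"
    by (auto simp: abs_less_iff)
  also have "openin (weak_star_topology K) \<dots>"
    unfolding weak_star_topology_def
    by (intro topology_generated_by_Basis CollectI exI[of _ f] exI[of _ "{c - \<eta><..<c + \<eta>}"] conjI refl assms
        open_greaterThanLessThan)
  finally show ?thesis .
qed

text \<open>Induction over the generation of the topology; an intersection unites the test functions
  and takes the smaller tolerance.\<close>

lemma weak_star_nbhd_basis:
  fixes \<mu> :: "'a::topological_space measure"
  assumes "openin (weak_star_topology K) G" "\<mu> \<in> G"
  shows "\<exists>(F :: ('a \<Rightarrow> real) set) \<epsilon>. finite F \<and> \<epsilon> > 0 \<and> (\<forall>f\<in>F. continuous_on K f) \<and>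
    (\<forall>\<nu>\<in>prob_measures K. (\<forall>f\<in>F. \<bar>(LINT x|\<nu>. f x) - (LINT x|\<mu>. f x)\<bar> < \<epsilon>) \<longrightarrow> \<nu> \<in> G)"
proof -
  let ?S = "{{\<mu> \<in> prob_measures K. (LINT x|\<mu>. f x) \<in> U} | (f :: 'a \<Rightarrow> real) U. continuous_on K f \<and> open U}"
  define nb where "nb G F \<epsilon> \<longleftrightarrow> finite F \<and> \<epsilon> > 0 \<and> (\<forall>f\<in>F. continuous_on K f) \<and>
    (\<forall>\<nu>\<in>prob_measures K. (\<forall>f\<in>F. \<bar>(LINT x|\<nu>. f x) - (LINT x|\<mu>. f x)\<bar> < \<epsilon>) \<longrightarrow> \<nu> \<in> G)"
    for G and F :: "('a \<Rightarrow> real) set" and \<epsilon> :: real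
  have "generate_topology_on ?S G"
    using assms(1) unfolding weak_star_topology_def openin_topology_generated_by_iff .
  then have "\<mu> \<in> G \<longrightarrow> (\<exists>F \<epsilon>. nb G F \<epsilon>)"
  proof (induction rule: generate_topology_on.induct)
    case Empty
    then show ?case by simp
  next
    case (Int a b)
    show ?case
    proof
      assume "\<mu> \<in> a \<inter> b"
      with Int obtain F \<epsilon> F' \<epsilon>' where 1: "nb a F \<epsilon>" "nb b F' \<epsilon>'" by blast
      have "nb (a \<inter> b) (F \<union> F') (min \<epsilon> \<epsilon>')" using 1 unfolding nb_def by (simp add: ball_Un)
      then show "\<exists>F \<epsilon>. nb (a \<inter> b) F \<epsilon>" by blast
    qed
  next
    case (UN k)
    show ?case
    proof
      assume "\<mu> \<in> \<Union>k"
      then obtain a where a: "a \<in> k" "\<mu> \<in> a" by blast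
      with UN obtain F \<epsilon> where "nb a F \<epsilon>" by blast
      then have "nb (\<Union>k) F \<epsilon>" using a(1) unfolding nb_def by blast
      then show "\<exists>F \<epsilon>. nb (\<Union>k) F \<epsilon>" by blast
    qed
  next
    case (Basis s)
    then obtain f :: "'a \<Rightarrow> real" and U where s: "s = {\<mu> \<in> prob_measures K. (LINT x|\<mu>. f x) \<in> U}"
      "continuous_on K f" "open U" by blast
    show ?case
    proof
      assume "\<mu> \<in> s"
      then have "(LINT x|\<mu>. f x) \<in> U" unfolding s(1) by simp
      then obtain e where e: "e > 0" "\<And>y. \<bar>y - (LINT x|\<mu>. f x)\<bar> < e \<Longrightarrow> y \<in> U"
        using s(3) unfolding open_real by blast
      then have "nb s {f} e" using s(2) unfolding nb_def s(1) by simp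
      then show "\<exists>F \<epsilon>. nb s F \<epsilon>" by blast
    qed
  qed
  with assms(2) show ?thesis unfolding nb_def by blast
qed

section \<open>Maxima of weighted determinants and their limits\<close>

lemma weighted_compactI:
  fixes K :: "(complex ^ 'n::finite) set"
  assumes "compact K" "K \<noteq> {}" "continuous_on K v"
  shows "\<exists>R C key. weighted_compact K v R C key"
proof -
  obtain B where B: "\<And>z. z \<in> K \<Longrightarrow> norm z \<le> B"
    using compact_imp_bounded[OF assms(1)] by (auto simp: bounded_iff)
  obtain C where C: "\<And>z. z \<in> K \<Longrightarrow> \<bar>v z\<bar> \<le> C"
    using compact_imp_bounded[OF compact_continuous_image[OF assms(3,1)]] by (auto simp: bounded_iff)
  obtain key :: "('n \<Rightarrow> nat) \<Rightarrow> nat" where "inj key" "\<forall>\<alpha> \<beta>. key (\<lambda>i. \<alpha> i + \<beta> i) = key \<alpha> * key \<beta>" "\<forall>\<alpha>. key \<alpha> > 0"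
    using ex_monomial_order[where ?'n = 'n] by blast
  moreover have "cmod (vec_nth z l) \<le> max 1 B" if "z \<in> K" for z l
    using B[OF that] Finite_Cartesian_Product.norm_nth_le[of z l] by linarith
  moreover have "\<bar>v z\<bar> \<le> max 0 C" if "z \<in> K" for z using C[OF that] by linarith
  ultimately have "weighted_compact K v (max 1 B) (max 0 C) key" using assms(2) by unfold_locales auto
  then show ?thesis by blast
qed

lemma max_VDM_upper:
  fixes K :: "(complex ^ 'n::finite) set"
  assumes "compact K" "K \<noteq> {}" "continuous_on K v" "x \<in> {..<poly_dim TYPE('n) k} \<rightarrow>\<^sub>E K"
  shows "cmod (weighted_VDM v k x) \<le> max_VDM K v k"
proof -
  obtain R C key where "weighted_compact K v R C key" using weighted_compactI[OF assms(1-3)] by blast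
  then interpret weighted_compact K v R C key .
  show ?thesis using max_VDM_bounds(3)[OF assms(4)] .
qed

lemma max_VDM_least:
  fixes K :: "(complex ^ 'n::finite) set"
  assumes "K \<noteq> {}" "\<And>x. x \<in> {..<poly_dim TYPE('n) k} \<rightarrow>\<^sub>E K \<Longrightarrow> cmod (weighted_VDM v k x) \<le> C"
  shows "max_VDM K v k \<le> C"
  unfolding max_VDM_def using assms by (intro cSUP_least) (auto simp: PiE_eq_empty_iff)

lemma max_VDM_nonneg:
  fixes K :: "(complex ^ 'n::finite) set"
  assumes "compact K" "K \<noteq> {}" "continuous_on K v"
  shows "max_VDM K v k \<ge> 0"
proof -
  obtain x where "x \<in> {..<poly_dim TYPE('n) k} \<rightarrow>\<^sub>E K" using assms(2) by (meson PiE_eq_empty_iff ex_in_conv)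
  from max_VDM_upper[OF assms this] show ?thesis using norm_ge_zero order_trans by blast
qed

text \<open>\<open>lim\<close> is meaningful only for convergent sequences; here the convergence
  theorem enters.\<close>

lemma weighted_transfinite_diameter_lim:
  fixes K :: "(complex ^ 'n::finite) set"
  assumes "compact K" "K \<noteq> {}" "continuous_on K v"
  shows "(\<lambda>k. max_VDM K v k powr (1 / (real k * real (poly_dim TYPE('n) k)))) \<longlonglongrightarrow> weighted_transfinite_diameter K v"
proof -
  obtain R C key where "weighted_compact K v R C key" using weighted_compactI[OF assms] by blast
  then interpret weighted_compact K v R C key .
  show ?thesis
    using max_VDM_root_convergent
    unfolding weighted_transfinite_diameter_def max_VDM_def convergent_LIMSEQ_iff .
qed

lemma weighted_transfinite_diameter_nonneg:
  fixes K :: "(complex ^ 'n::finite) set"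
  assumes "compact K" "K \<noteq> {}" "continuous_on K v"
  shows "weighted_transfinite_diameter K v \<ge> 0"
  by (rule LIMSEQ_le_const[OF weighted_transfinite_diameter_lim[OF assms]]) auto

lemma cmod_weighted_VDM_change:
  fixes a :: "nat \<Rightarrow> complex ^ 'n::finite"
  shows "cmod (weighted_VDM v k a) =
    cmod (weighted_VDM u k a) * exp (real k * (\<Sum>j<poly_dim TYPE('n) k. u (a j) - v (a j)))"
proof -
  have "exp (real k * (\<Sum>j<poly_dim TYPE('n) k. u (a j) - v (a j))) =
      (\<Prod>j<poly_dim TYPE('n) k. exp (real k * (u (a j) - v (a j))))"
    by (simp add: sum_distrib_left exp_sum)
  then show ?thesis
    by (simp add: weighted_VDM_def norm_mult prod_norm[symmetric] prod.distrib[symmetric] mult.assoc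
        exp_add[symmetric] algebra_simps)
qed

lemma cmod_weighted_VDM_change_root:
  fixes a :: "nat \<Rightarrow> complex ^ 'n::finite"
  defines "N \<equiv> \<lambda>k. poly_dim TYPE('n) k"
  assumes "k > 0"
  shows "cmod (weighted_VDM v k a) powr (1 / (real k * real (N k))) =
    cmod (weighted_VDM u k a) powr (1 / (real k * real (N k))) * exp ((\<Sum>j<N k. u (a j) - v (a j)) / real (N k))"
proof -
  have N: "real (N k) > 0" using poly_dim_pos[where ?'n = 'n, of k] by (simp add: N_def)
  show ?thesis
    unfolding cmod_weighted_VDM_change[of v k a u] N_def[symmetric]
    using assms(2) N by (simp add: powr_mult exp_powr_real)
qed

lemma prob_measures_nonempty: "\<mu> \<in> prob_measures K \<Longrightarrow> K \<noteq> {}"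
proof
  assume m: "\<mu> \<in> prob_measures K" and "K = {}"
  then have "space \<mu> = {}" using sets_eq_imp_space_eq[of \<mu> "restrict_space borel K"]
    by (simp add: prob_measures_def space_restrict_space)
  moreover have "prob_space \<mu>" using m by (simp add: prob_measures_def)
  ultimately show False using prob_space.not_empty by blast
qed

lemma weighted_W_upper_le:
  fixes K :: "(complex ^ 'n::finite) set"
  assumes K: "compact K" and Q: "continuous_on K Q" and v: "continuous_on K v" and \<mu>: "\<mu> \<in> prob_measures K"
  shows "weighted_W_upper K Q \<mu> \<le>
    ennreal (weighted_transfinite_diameter K v * exp ((LINT x|\<mu>. v x) - (LINT x|\<mu>. Q x)))"
proof -
  let ?N = "\<lambda>k. poly_dim TYPE('n) k" and ?I = "(LINT x|\<mu>. v x) - (LINT x|\<mu>. Q x)"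
  let ?\<delta> = "weighted_transfinite_diameter K v"
  note ne = prob_measures_nonempty[OF \<mu>]
  have vQ: "continuous_on K (\<lambda>x. v x - Q x)" using v Q by (intro continuous_intros)
  have I: "(LINT x|\<mu>. v x - Q x) = ?I"
    using integrable_prob_measures[OF K \<mu>] v Q by (intro Bochner_Integration.integral_diff) auto
  have main: "weighted_W_upper K Q \<mu> \<le> ennreal (?\<delta> * exp (?I + \<eta>))" if \<eta>: "\<eta> > 0" for \<eta>
  proof -
    \<comment> \<open>The single test function \<open>v - Q\<close> suffices: its empirical average
      determines the factor between the two weights.\<close>
    let ?G = "{\<nu> \<in> prob_measures K. \<bar>(LINT x|\<nu>. v x - Q x) - ?I\<bar> < \<eta>}"
    have G: "openin (weak_star_topology K) ?G" by (rule openin_weak_star_nbhd[OF vQ])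
    have "\<mu> \<in> ?G" using \<mu> \<eta> I by simp
    then have "weighted_W_upper K Q \<mu> \<le> limsup (\<lambda>k. weighted_W_sup K Q k ?G)"
      unfolding weighted_W_upper_def using G by (intro INF_lower) auto
    also have "\<dots> \<le> limsup (\<lambda>k. ennreal (max_VDM K v k powr (1 / (real k * real (?N k))) * exp (?I + \<eta>)))"
    proof (intro Limsup_mono eventually_mono[OF eventually_gt_at_top[of 0]])
      fix k :: nat assume k: "k > 0"
      show "weighted_W_sup K Q k ?G \<le> ennreal (max_VDM K v k powr (1 / (real k * real (?N k))) * exp (?I + \<eta>))"
        unfolding weighted_W_sup_def
      proof (rule SUP_least)
        fix a assume "a \<in> configurations K ?G (?N k)"
        then have a: "a \<in> {..<?N k} \<rightarrow>\<^sub>E K" and aG: "empirical_measure K (?N k) a \<in> ?G"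
          by (auto simp: configurations_def)
        have "(LINT x|empirical_measure K (?N k) a. v x - Q x) = (\<Sum>j<?N k. v (a j) - Q (a j)) / real (?N k)"
          using a by (intro integral_empirical_measure poly_dim_pos vQ) (auto simp: PiE_iff)
        then have le: "(\<Sum>j<?N k. v (a j) - Q (a j)) / real (?N k) \<le> ?I + \<eta>" using aG by auto
        show "ennreal (cmod (weighted_VDM Q k a) powr (1 / (real k * real (?N k))))
            \<le> ennreal (max_VDM K v k powr (1 / (real k * real (?N k))) * exp (?I + \<eta>))"
          unfolding cmod_weighted_VDM_change_root[OF k, of Q a v]
          using le max_VDM_upper[OF K ne v a] by (intro ennreal_leI mult_mono powr_mono2) auto
      qed
    qed
    also have "\<dots> = ennreal (?\<delta> * exp (?I + \<eta>))"
      by (intro lim_imp_Limsup tendsto_ennrealI tendsto_intros weighted_transfinite_diameter_lim K ne v) simp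
    finally show ?thesis .
  qed
  have "(\<lambda>n. ennreal (?\<delta> * exp (?I + 1 / real (Suc n)))) \<longlonglongrightarrow> ennreal (?\<delta> * exp (?I + 0))"
    by (intro tendsto_ennrealI tendsto_intros LIMSEQ_Suc[OF lim_1_over_n])
  then show ?thesis using main by (intro LIMSEQ_le_const[where X = "\<lambda>n. ennreal (?\<delta> * exp (?I + 1 / real (Suc n)))"]) auto
qed

section \<open>The lower bound\<close>

text \<open>The multipliers \<open>l i = s * g i\<close> range over a grid whose mesh \<open>s = t / (2 k)\<close> changes the weight
  \<open>exp (- 2 k v)\<close> by a factor \<open>exp (- t f\<^sub>i)\<close> per step. At a minimizer \<open>g\<close> of
  \<open>ln Z(g) / (2 k N) + \<Sum>i. l i * x i\<close> the defect \<open>d i\<close> between the mean of \<open>f i\<close> and its target \<open>x i\<close>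
  vanishes up to \<open>t\<close>, unless \<open>l i\<close> lies on the boundary of the grid and has the sign of \<open>d i\<close>.\<close>

lemma configuration_near_target:
  fixes K :: "(complex ^ 'n::finite) set" and f :: "nat \<Rightarrow> complex ^ 'n \<Rightarrow> real" and x :: "nat \<Rightarrow> real"
    and k m J :: nat and t \<delta> c s :: real
  defines "N \<equiv> poly_dim TYPE('n) k" and "v \<equiv> \<lambda>(l :: nat \<Rightarrow> real) z. \<Sum>i<m. l i * f i z"
  assumes K: "compact K" "K \<noteq> {}" and f: "\<And>i. i < m \<Longrightarrow> continuous_on K (f i)"
    and f1: "\<And>i z. i < m \<Longrightarrow> z \<in> K \<Longrightarrow> \<bar>f i z\<bar> \<le> 1"
    and k: "k > 0" and t: "0 < t" "t \<le> 1" and \<delta>: "0 < \<delta>" "\<delta> \<le> 1" and s: "s = t / (2 * real k)"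
    and large: "2 * real m * exp (- real N * \<delta>\<^sup>2 / 4) \<le> 1 / 2"
    and lower: "\<And>l. (\<And>i. i < m \<Longrightarrow> \<bar>l i\<bar> \<le> s * real J) \<Longrightarrow>
      max_VDM K (v l) k > 0 \<and> c \<le> ln (max_VDM K (v l) k) / (real k * real N) + (\<Sum>i<m. l i * x i)"
  shows "\<exists>a\<in>{..<N} \<rightarrow>\<^sub>E K. \<exists>d. VDM k a \<noteq> 0 \<and>
    (\<forall>i<m. \<bar>(\<Sum>j<N. f i (a j)) / real N - x i - d i\<bar> \<le> \<delta>) \<and>
    ln (cmod (VDM k a)) / (real k * real N) \<ge> c - (2 * ln 2 / real k + ln (real N * real (2 * J + 1) ^ m) / (2 * real k))
       + s * real J * (\<Sum>i<m. \<bar>d i\<bar>) - 2 * real m * (s * real J) * t - real m * (s * real J) * \<delta>"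
proof -
  define \<Gamma> where "\<Gamma> = {..<m} \<rightarrow>\<^sub>E {- int J..int J}"
  define l where "l = (\<lambda>(g :: nat \<Rightarrow> int) i. s * of_int (g i))"
  define w where "w = (\<lambda>g z. exp (- 2 * real k * v (l g) z))"
  have N: "real N > 0" "N > 0" using poly_dim_pos[where ?'n = 'n, of k] by (auto simp: N_def)
  have s0: "s > 0" using t k by (simp add: s)
  have fin\<Gamma>: "finite \<Gamma>" unfolding \<Gamma>_def by (intro finite_PiE) auto
  have lb: "\<bar>l g i\<bar> \<le> s * real J" if "g \<in> \<Gamma>" "i < m" for g i
  proof -
    have "\<bar>g i\<bar> \<le> int J" using that by (force simp: \<Gamma>_def PiE_iff abs_le_iff)
    then have "\<bar>real_of_int (g i)\<bar> \<le> real J" by linarith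
    then show ?thesis using s0 by (simp add: l_def abs_mult)
  qed
  define mv where "mv = (\<lambda>g. max_VDM K (v (l g)) k)"
  have mv: "mv g > 0" "c \<le> ln (mv g) / (real k * real N) + (\<Sum>i<m. l g i * x i)" if "g \<in> \<Gamma>" for g
    using lower[of "l g"] lb[OF that] by (auto simp: mv_def)
  \<comment> \<open>Half of the maximum is enough: the loss \<open>ln 2\<close> vanishes after
    normalization.\<close>
  have "\<exists>a. a \<in> {..<N} \<rightarrow>\<^sub>E K \<and> mv g / 2 \<le> cmod (weighted_VDM (v (l g)) k a)" if g: "g \<in> \<Gamma>" for g
  proof (rule ccontr)
    assume neg: "\<not> ?thesis"
    have "mv g \<le> mv g / 2"
      unfolding mv_def by (rule max_VDM_least[OF K(2)]) (use neg in \<open>force simp: mv_def N_def not_le\<close>)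
    then show False using mv(1)[OF g] by simp
  qed
  then obtain fek where fek: "fek g \<in> {..<N} \<rightarrow>\<^sub>E K" "mv g / 2 \<le> cmod (weighted_VDM (v (l g)) k (fek g))" if "g \<in> \<Gamma>" for g
    by metis
  \<comment> \<open>One set \<open>X\<close> for the whole grid, so that partition functions at
    neighbouring grid points run over the same tuples.\<close>
  define X where "X = (\<Union>g\<in>\<Gamma>. fek g ` {..<N})"
  have X: "finite X" "X \<subseteq> K" unfolding X_def using fin\<Gamma> fek(1) by (auto simp: PiE_iff)
  have card\<Gamma>: "card \<Gamma> = (2 * J + 1) ^ m"
    unfolding \<Gamma>_def by (subst card_PiE) (auto simp: nat_add_distrib nat_mult_distrib)
  have "card X \<le> (\<Sum>g\<in>\<Gamma>. card (fek g ` {..<N}))" unfolding X_def by (rule card_UN_le[OF fin\<Gamma>])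
  also have "\<dots> \<le> (\<Sum>g\<in>\<Gamma>. N)" by (intro sum_mono) (metis card_image_le finite_lessThan card_lessThan)
  also have "\<dots> = N * (2 * J + 1) ^ m" by (simp add: card\<Gamma>)
  finally have "real (card X) \<le> real (N * (2 * J + 1) ^ m)" by (simp only: of_nat_le_iff)
  then have cardX: "real (card X) \<le> real N * real (2 * J + 1) ^ m" by (simp only: of_nat_mult of_nat_power)
  let ?E = "{..<N} \<rightarrow>\<^sub>E X"
  define W where "W = (\<lambda>u (a :: nat \<Rightarrow> complex ^ 'n). (cmod (VDM k a))\<^sup>2 * (\<Prod>j<N. u (a j) :: real))"
  define Z where "Z = (\<lambda>u. \<Sum>a\<in>?E. W u a)"
  have W_eq: "W = (\<lambda>u a. (cmod (Determinant.det (mat N N (\<lambda>(i, j). monomial_basis k i (a j)))))\<^sup>2 * (\<Prod>j<N. u (a j)))"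
    unfolding W_def VDM_def N_def ..
  have w_square: "w g z = (exp (- real k * v (l g) z))\<^sup>2" for g z
    unfolding w_def by (simp add: power2_eq_square exp_add[symmetric])
  have Wpos: "W (w g) a = (cmod (weighted_VDM (v (l g)) k a))\<^sup>2" for g a
    unfolding W_def w_square prod_power_distrib[symmetric] weighted_VDM_def N_def[symmetric]
    by (simp add: norm_mult prod_norm[symmetric] power_mult_distrib)
  have W0: "W (w g) a \<ge> 0" for g a unfolding Wpos by simp
  have Zge: "(mv g / 2)\<^sup>2 \<le> Z (w g)" if g: "g \<in> \<Gamma>" for g
  proof -
    have "fek g \<in> ?E" using fek(1)[OF g] g by (auto simp: X_def PiE_iff)
    then have "W (w g) (fek g) \<le> Z (w g)"
      unfolding Z_def using X(1) W0 by (intro member_le_sum finite_PiE) auto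
    moreover have "(mv g / 2)\<^sup>2 \<le> W (w g) (fek g)"
      unfolding Wpos using fek(2)[OF g] mv(1)[OF g] by (intro power_mono) auto
    ultimately show ?thesis by linarith
  qed
  have Zpos: "Z (w g) > 0" if "g \<in> \<Gamma>" for g using Zge[OF that] mv(1)[OF that] by (auto intro: less_le_trans[rotated])
  \<comment> \<open>The additional factor 2 in the denominator is there because \<open>Z\<close>
    sums squares of determinants.\<close>
  define H where "H = (\<lambda>g. ln (Z (w g)) / (2 * real k * real N) + (\<Sum>i<m. l g i * x i))"
  have "(\<lambda>i\<in>{..<m}. 0) \<in> \<Gamma>" by (auto simp: \<Gamma>_def)
  then have "\<Gamma> \<noteq> {}" by blast
  then obtain g where g: "g \<in> \<Gamma>" and min: "\<And>g'. g' \<in> \<Gamma> \<Longrightarrow> H g \<le> H g'"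
    using ex_min_if_finite[of "H ` \<Gamma>"] fin\<Gamma> by (force simp: not_less)
  obtain y a where ya:
    "\<And>i u. i < m \<Longrightarrow> \<bar>u\<bar> \<le> 1 \<Longrightarrow> Z (\<lambda>z. w g z * exp (u * f i z)) \<le> Z (w g) * exp (real N * (u * y i + u\<^sup>2))"
    "a \<in> ?E" "\<And>i. i < m \<Longrightarrow> \<bar>(\<Sum>j<N. f i (a j)) / real N - y i\<bar> \<le> \<delta>"
    "W (w g) a \<ge> Z (w g) / (2 * real (card X) ^ N)"
  proof (rule determinantal_selection[where X = X and N = N and \<phi> = "monomial_basis k" and w = "w g" and m = m and f = f and \<delta> = \<delta>])
    show "0 < (\<Sum>a\<in>{..<N} \<rightarrow>\<^sub>E X. (cmod (Determinant.det (mat N N (\<lambda>(i, j). monomial_basis k i (a j)))))\<^sup>2 * (\<Prod>j<N. w g (a j)))"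
      using Zpos[OF g] unfolding Z_def W_eq .
    show "\<bar>f i z\<bar> \<le> 1" if "i < m" "z \<in> X" for i z using f1 X(2) that by blast
  qed (use X(1) N \<delta> large that in \<open>auto simp: w_def Z_def W_eq\<close>)
  define d where "d = (\<lambda>i. y i - x i)"
  \<comment> \<open>The moment bound with \<open>u = - t * r\<close> limits the change of
    \<open>H\<close> on this step to \<open>t / (2 k)\<close> times \<open>- r * d i + t\<close>. At
    a minimizer this cannot be negative.\<close>
  have step: "0 \<le> - r * d i + t" if i: "i < m" and r: "r = 1 \<or> r = -1" and g': "g(i := g i + r) \<in> \<Gamma>" for i and r :: int
  proof -
    let ?g = "g(i := g i + r)"
    have lg: "l ?g j = l g j + (if j = i then s * of_int r else 0)" for j by (simp add: l_def distrib_left)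
    have vl: "v (l ?g) z = v (l g) z + s * of_int r * f i z" for z
      unfolding v_def lg distrib_right sum.distrib using i by (simp add: if_distrib[of "\<lambda>u. u * _"] cong: if_cong)
    have wg: "w ?g = (\<lambda>z. w g z * exp ((- t * of_int r) * f i z))"
    proof -
      have ts: "t = 2 * real k * s" using k by (simp add: s)
      show ?thesis unfolding w_def vl exp_add[symmetric] ts by (simp add: algebra_simps)
    qed
    have "\<bar>- t * of_int r\<bar> \<le> 1" using t r by auto
    then have "Z (w ?g) \<le> Z (w g) * exp (real N * ((- t * of_int r) * y i + (- t * of_int r)\<^sup>2))"
      unfolding wg by (rule ya(1)[OF i])
    then have "ln (Z (w ?g)) \<le> ln (Z (w g) * exp (real N * ((- t * of_int r) * y i + (- t * of_int r)\<^sup>2)))"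
      using Zpos[OF g'] Zpos[OF g] by (subst ln_le_cancel_iff) auto
    also have "\<dots> = ln (Z (w g)) + real N * ((- t * of_int r) * y i + (- t * of_int r)\<^sup>2)"
      using Zpos[OF g] by (subst ln_mult_pos) auto
    also have "(- t * of_int r)\<^sup>2 = t\<^sup>2" using r by auto
    finally have "ln (Z (w ?g)) / (2 * real k * real N) \<le>
        (ln (Z (w g)) + real N * ((- t * of_int r) * y i + t\<^sup>2)) / (2 * real k * real N)"
      by (rule divide_right_mono) simp
    also have "\<dots> = ln (Z (w g)) / (2 * real k * real N) + ((- t * of_int r) * y i + t\<^sup>2) / (2 * real k)"
      using N by (simp add: add_divide_distrib)
    finally have 1: "ln (Z (w ?g)) / (2 * real k * real N) \<le>
        ln (Z (w g)) / (2 * real k * real N) + ((- t * of_int r) * y i + t\<^sup>2) / (2 * real k)" .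
    have 2: "(\<Sum>j<m. l ?g j * x j) = (\<Sum>j<m. l g j * x j) + s * of_int r * x i"
      unfolding lg distrib_right sum.distrib using i by (simp add: if_distrib[of "\<lambda>u. u * _"] cong: if_cong)
    have "0 \<le> ((- t * of_int r) * y i + t\<^sup>2) / (2 * real k) + s * of_int r * x i"
      using min[OF g'] 1 2 unfolding H_def by linarith
    also have "\<dots> = (t / (2 * real k)) * (- of_int r * d i + t)"
      by (simp add: s d_def power2_eq_square algebra_simps add_divide_distrib diff_divide_distrib)
    finally have "0 \<le> (t / (2 * real k)) * (- of_int r * d i + t)" .
    moreover have "t / (2 * real k) > 0" using t k by simp
    ultimately have "0 \<le> - of_int r * d i + t" by (metis mult_pos_neg not_le)
    then show ?thesis by simp
  qed
  have gm: "- int J \<le> g i" "g i \<le> int J" if "i < m" for i using g that by (auto simp: \<Gamma>_def PiE_iff)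
  have upd: "g(i := u) \<in> \<Gamma>" if "i < m" "- int J \<le> u" "u \<le> int J" for i u
    using g that by (auto simp: \<Gamma>_def PiE_iff extensional_def)
  \<comment> \<open>If \<open>d i > t\<close>, an upward step is impossible and \<open>g i\<close>
    is at the top of the grid; \<open>d i < - t\<close> is symmetric. Otherwise both sides differ by
    at most \<open>2 * (s * J) * t\<close>.\<close>
  have boundary: "l g i * d i \<ge> s * real J * \<bar>d i\<bar> - 2 * (s * real J) * t" if i: "i < m" for i
  proof -
    have sJ: "s * real J \<ge> 0" using s0 by simp
    consider "\<bar>d i\<bar> \<le> t" | "d i > t" | "d i < - t" by linarith
    then show ?thesis
    proof cases
      case 1
      have "\<bar>l g i * d i\<bar> \<le> (s * real J) * t"
        unfolding abs_mult using lb[OF g i] 1 sJ by (intro mult_mono) auto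
      moreover have "s * real J * \<bar>d i\<bar> \<le> (s * real J) * t" using 1 sJ by (intro mult_left_mono) auto
      ultimately show ?thesis by linarith
    next
      case 2
      have "g i = int J"
      proof (rule ccontr)
        assume "g i \<noteq> int J"
        then have "g(i := g i + 1) \<in> \<Gamma>" using gm[OF i] by (intro upd i) auto
        then show False using step[OF i, of 1] 2 by simp
      qed
      then show ?thesis using 2 t sJ by (simp add: l_def)
    next
      case 3
      have "g i = - int J"
      proof (rule ccontr)
        assume "g i \<noteq> - int J"
        then have "g(i := g i + -1) \<in> \<Gamma>" using gm[OF i] by (intro upd i) auto
        then show False using step[OF i, of "-1"] 3 by simp
      qed
      then show ?thesis using 3 t sJ by (simp add: l_def)
    qed
  qed
  have aK: "a \<in> {..<N} \<rightarrow>\<^sub>E K" using ya(2) X(2) by (auto simp: PiE_iff)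
  have "X \<noteq> {}" using ya(2) N(2) by (auto simp: PiE_iff)
  then have cX: "card X > 0" using X(1) by (simp add: card_gt_0_iff)
  then have "Z (w g) / (2 * real (card X) ^ N) > 0" using Zpos[OF g] by simp
  then have Wa: "W (w g) a > 0" using ya(4) by linarith
  then have V: "VDM k a \<noteq> 0" by (auto simp: W_def)
  define A where "A = (\<lambda>i. (\<Sum>j<N. f i (a j)) / real N)"
  have lnW: "ln (W (w g) a) / (2 * real k * real N) = ln (cmod (VDM k a)) / (real k * real N) - (\<Sum>i<m. l g i * A i)"
  proof -
    have "ln (W (w g) a) = 2 * ln (cmod (VDM k a)) + ln (\<Prod>j<N. w g (a j))"
      unfolding W_def using V by (subst ln_mult_pos) (auto simp: w_def ln_realpow intro!: prod_pos)
    also have "ln (\<Prod>j<N. w g (a j)) = (\<Sum>j<N. - 2 * real k * v (l g) (a j))"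
      by (subst ln_prod) (auto simp: w_def)
    also have "\<dots> = - 2 * real k * (\<Sum>i<m. l g i * (\<Sum>j<N. f i (a j)))"
      unfolding v_def sum_distrib_left by (subst sum.swap) (simp add: mult_ac)
    also have "(\<Sum>i<m. l g i * (\<Sum>j<N. f i (a j))) = real N * (\<Sum>i<m. l g i * A i)"
    proof -
      have NA: "real N * A i = (\<Sum>j<N. f i (a j))" for i using N by (simp add: A_def)
      show ?thesis unfolding NA[symmetric] sum_distrib_left by (simp add: mult.left_commute)
    qed
    finally show ?thesis using k N by (simp add: field_simps)
  qed
  have lnWge: "ln (W (w g) a) \<ge> 2 * ln (mv g / 2) - ln 2 - real N * ln (real N * real (2 * J + 1) ^ m)"
  proof -
    have "ln (Z (w g) / (2 * real (card X) ^ N)) \<le> ln (W (w g) a)"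
      using ya(4) \<open>Z (w g) / (2 * real (card X) ^ N) > 0\<close> Wa by (subst ln_le_cancel_iff)
    moreover have "ln (Z (w g) / (2 * real (card X) ^ N)) = ln (Z (w g)) - (ln 2 + real N * ln (real (card X)))"
      using Zpos[OF g] cX by (simp add: ln_div ln_mult_pos ln_realpow)
    moreover have "ln (real (card X)) \<le> ln (real N * real (2 * J + 1) ^ m)"
      using cardX cX by (subst ln_le_cancel_iff) auto
    then have "real N * ln (real (card X)) \<le> real N * ln (real N * real (2 * J + 1) ^ m)" by (intro mult_left_mono) auto
    moreover have "2 * ln (mv g / 2) \<le> ln (Z (w g))"
    proof -
      have "ln ((mv g / 2)\<^sup>2) \<le> ln (Z (w g))"
        using Zge[OF g] Zpos[OF g] mv(1)[OF g] by (subst ln_le_cancel_iff) auto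
      then show ?thesis using mv(1)[OF g] by (simp add: ln_realpow)
    qed
    ultimately show ?thesis by linarith
  qed
  define B where "B = ln (real N * real (2 * J + 1) ^ m)"
  have "ln (mv g / 2) = ln (mv g) - ln 2" using mv(1)[OF g] by (simp add: ln_div)
  then have "(2 * ln (mv g) - 3 * ln 2 - real N * B) / (2 * real k * real N) \<le> ln (W (w g) a) / (2 * real k * real N)"
    using lnWge k N unfolding B_def by (intro divide_right_mono) auto
  moreover have "(2 * ln (mv g) - 3 * ln 2 - real N * B) / (2 * real k * real N) =
      ln (mv g) / (real k * real N) - 3 * ln 2 / (2 * real k * real N) - B / (2 * real k)"
    using k N by (simp add: diff_divide_distrib)
  \<comment> \<open>Three factors 2: two from squaring half the maximum, one from the good half of
    the weight.\<close>
  moreover have "3 * ln 2 / (2 * real k * real N) \<le> 2 * ln 2 / real k"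
  proof -
    have "3 * ln 2 / (2 * real k * real N) \<le> 3 * ln 2 / (2 * real k * 1)"
      using k N by (intro divide_left_mono mult_left_mono mult_pos_pos) auto
    also have "\<dots> \<le> 2 * ln 2 / real k" using k by (simp add: field_simps)
    finally show ?thesis .
  qed
  ultimately have ge1: "ln (cmod (VDM k a)) / (real k * real N) - (\<Sum>i<m. l g i * A i) \<ge>
      ln (mv g) / (real k * real N) - 2 * ln 2 / real k - B / (2 * real k)"
    unfolding lnW by linarith
  \<comment> \<open>The averages split into target, defect and fluctuation:
    \<open>A i = x i + d i + (A i - y i)\<close>.\<close>
  have "(\<Sum>i<m. l g i * A i) - (\<Sum>i<m. l g i * x i) = (\<Sum>i<m. l g i * d i) + (\<Sum>i<m. l g i * (A i - y i))"
    by (simp add: sum_subtractf[symmetric] sum.distrib[symmetric] d_def algebra_simps)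
  moreover have "(\<Sum>i<m. l g i * d i) \<ge> (\<Sum>i<m. s * real J * \<bar>d i\<bar> - 2 * (s * real J) * t)"
    by (intro sum_mono boundary) auto
  moreover have "(\<Sum>i<m. s * real J * \<bar>d i\<bar> - 2 * (s * real J) * t) = s * real J * (\<Sum>i<m. \<bar>d i\<bar>) - 2 * real m * (s * real J) * t"
    by (simp add: sum_subtractf sum_distrib_left)
  moreover have "(\<Sum>i<m. l g i * (A i - y i)) \<ge> (\<Sum>i<m. - (s * real J * \<delta>))"
  proof (intro sum_mono)
    fix i assume "i \<in> {..<m}"
    then have i: "i < m" by simp
    have "\<bar>l g i * (A i - y i)\<bar> \<le> s * real J * \<delta>"
      unfolding abs_mult using lb[OF g i] ya(3)[OF i] s0 by (intro mult_mono) (auto simp: A_def)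
    then show "- (s * real J * \<delta>) \<le> l g i * (A i - y i)" by linarith
  qed
  moreover have "(\<Sum>i<m. - (s * real J * \<delta>)) = - (real m * (s * real J) * \<delta>)" by simp
  ultimately have "ln (cmod (VDM k a)) / (real k * real N) \<ge> c - (2 * ln 2 / real k + B / (2 * real k))
       + s * real J * (\<Sum>i<m. \<bar>d i\<bar>) - 2 * real m * (s * real J) * t - real m * (s * real J) * \<delta>"
    using ge1 mv(2)[OF g] by linarith
  moreover have "\<bar>(\<Sum>j<N. f i (a j)) / real N - x i - d i\<bar> \<le> \<delta>" if "i < m" for i
    using ya(3)[OF that] by (simp add: d_def)
  ultimately show ?thesis using aK V unfolding B_def by blast
qed

section \<open>Bounds uniform over a box of multipliers\<close>

lemma max_VDM_change:
  fixes K :: "(complex ^ 'n::finite) set"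
  assumes K: "compact K" "K \<noteq> {}" and u: "continuous_on K u" and le: "\<And>z. z \<in> K \<Longrightarrow> u z - v z \<le> \<sigma>"
  shows "max_VDM K v k \<le> max_VDM K u k * exp (real k * (real (poly_dim TYPE('n) k) * \<sigma>))"
proof (rule max_VDM_least[OF K(2)])
  fix a assume a: "a \<in> {..<poly_dim TYPE('n) k} \<rightarrow>\<^sub>E K"
  have "(\<Sum>j<poly_dim TYPE('n) k. u (a j) - v (a j)) \<le> (\<Sum>j<poly_dim TYPE('n) k. \<sigma>)"
    using a by (intro sum_mono le) (auto simp: PiE_iff)
  then have "exp (real k * (\<Sum>j<poly_dim TYPE('n) k. u (a j) - v (a j))) \<le> exp (real k * (real (poly_dim TYPE('n) k) * \<sigma>))"
    by (simp add: mult_left_mono)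
  then show "cmod (weighted_VDM v k a) \<le> max_VDM K u k * exp (real k * (real (poly_dim TYPE('n) k) * \<sigma>))"
    unfolding cmod_weighted_VDM_change[of v k a u]
    using max_VDM_upper[OF K u a] max_VDM_nonneg[OF K u] by (intro mult_mono) auto
qed

lemma ln_max_VDM_lim:
  fixes K :: "(complex ^ 'n::finite) set"
  assumes K: "compact K" "K \<noteq> {}" "continuous_on K v" and pos: "weighted_transfinite_diameter K v > 0"
  shows "\<forall>\<^sub>F k in sequentially. max_VDM K v k > 0"
    "(\<lambda>k. ln (max_VDM K v k) / (real k * real (poly_dim TYPE('n) k))) \<longlonglongrightarrow> ln (weighted_transfinite_diameter K v)"
proof -
  let ?N = "\<lambda>k. poly_dim TYPE('n) k"
  note lim = weighted_transfinite_diameter_lim[OF K]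
  show ev: "\<forall>\<^sub>F k in sequentially. max_VDM K v k > 0"
    using order_tendstoD(1)[OF lim pos]
  proof eventually_elim
    case (elim k)
    then have "max_VDM K v k \<noteq> 0" by auto
    then show ?case using max_VDM_nonneg[OF K, of k] by linarith
  qed
  have "(\<lambda>k. ln (max_VDM K v k powr (1 / (real k * real (?N k))))) \<longlonglongrightarrow> ln (weighted_transfinite_diameter K v)"
    using lim pos by (intro tendsto_ln) auto
  then show "(\<lambda>k. ln (max_VDM K v k) / (real k * real (?N k))) \<longlonglongrightarrow> ln (weighted_transfinite_diameter K v)"
    by (rule Lim_transform_eventually) (use ev in \<open>auto elim!: eventually_mono simp: ln_powr\<close>)
qed

text \<open>The normalized logarithm of the maximum and the linear term are Lipschitz in
  \<open>l\<close> uniformly in \<open>k\<close>, so convergence on a finite net of the box is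
  enough.\<close>

lemma max_VDM_uniform_lower_bound:
  fixes K :: "(complex ^ 'n::finite) set" and f :: "nat \<Rightarrow> complex ^ 'n \<Rightarrow> real" and x :: "nat \<Rightarrow> real"
    and c R \<eta> :: real and m :: nat
  defines "v \<equiv> \<lambda>(l :: nat \<Rightarrow> real) z. \<Sum>i<m. l i * f i z"
  assumes K: "compact K" "K \<noteq> {}" and f: "\<And>i. i < m \<Longrightarrow> continuous_on K (f i)"
    and f1: "\<And>i z. i < m \<Longrightarrow> z \<in> K \<Longrightarrow> \<bar>f i z\<bar> \<le> 1" and x1: "\<And>i. i < m \<Longrightarrow> \<bar>x i\<bar> \<le> 1"
    and pos: "\<And>l. weighted_transfinite_diameter K (v l) > 0"
    and c: "\<And>l. c \<le> ln (weighted_transfinite_diameter K (v l)) + (\<Sum>i<m. l i * x i)"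
    and \<eta>: "\<eta> > 0"
  shows "\<forall>\<^sub>F k in sequentially. \<forall>l. (\<forall>i<m. \<bar>l i\<bar> \<le> R) \<longrightarrow> max_VDM K (v l) k > 0 \<and>
    c - \<eta> \<le> ln (max_VDM K (v l) k) / (real k * real (poly_dim TYPE('n) k)) + (\<Sum>i<m. l i * x i)"
proof -
  let ?N = "\<lambda>k. real (poly_dim TYPE('n) k)"
  \<comment> \<open>Two Lipschitz errors of at most \<open>m * \<rho>\<close> use half of
    \<open>\<eta>\<close>; convergence on the net uses the other half. The summand 1 covers
    \<open>m = 0\<close>.\<close>
  define \<rho> where "\<rho> = \<eta> / (4 * (real m + 1))"
  have \<rho>: "\<rho> > 0" "2 * (real m * \<rho>) \<le> \<eta> / 2" using \<eta> by (auto simp: \<rho>_def field_simps)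
  define L where "L = \<lceil>R / \<rho>\<rceil>"
  define net where "net = (\<lambda>g i. \<rho> * of_int (g i :: int)) ` ({..<m} \<rightarrow>\<^sub>E {- L..L})"
  have "finite net" unfolding net_def by (intro finite_imageI finite_PiE) auto
  have vc: "continuous_on K (v l)" for l unfolding v_def by (intro continuous_intros f) auto
  have "\<forall>\<^sub>F k in sequentially. max_VDM K (v l) k > 0 \<and> c - \<eta> / 2 \<le> ln (max_VDM K (v l) k) / (real k * ?N k) + (\<Sum>i<m. l i * x i)" for l
  proof -
    have "ln (weighted_transfinite_diameter K (v l)) > c - \<eta> / 2 - (\<Sum>i<m. l i * x i)" using c[of l] \<eta> by linarith
    from order_tendstoD(1)[OF ln_max_VDM_lim(2)[OF K vc pos] this] ln_max_VDM_lim(1)[OF K vc pos[of l]]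
    show ?thesis by eventually_elim auto
  qed
  then have "\<forall>\<^sub>F k in sequentially. \<forall>l\<in>net. max_VDM K (v l) k > 0 \<and>
      c - \<eta> / 2 \<le> ln (max_VDM K (v l) k) / (real k * ?N k) + (\<Sum>i<m. l i * x i)"
    by (intro eventually_ball_finite \<open>finite net\<close> ballI)
  then show ?thesis using eventually_gt_at_top[of 0]
  proof eventually_elim
    case (elim k)
    have N: "?N k > 0" using poly_dim_pos[where ?'n = 'n, of k] by simp
    show ?case
    proof (intro allI impI)
      fix l :: "nat \<Rightarrow> real" assume l: "\<forall>i<m. \<bar>l i\<bar> \<le> R"
      define g where "g = (\<lambda>i\<in>{..<m}. \<lfloor>l i / \<rho>\<rfloor>)"
      define l' where "l' = (\<lambda>i. \<rho> * of_int (g i))"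
      have "g \<in> {..<m} \<rightarrow>\<^sub>E {- L..L}"
      proof -
        have "- L \<le> \<lfloor>l i / \<rho>\<rfloor> \<and> \<lfloor>l i / \<rho>\<rfloor> \<le> L" if "i < m" for i
        proof -
          have b: "\<bar>l i\<bar> \<le> R" using l that by blast
          have "l i / \<rho> \<le> R / \<rho>" "- (R / \<rho>) \<le> l i / \<rho>"
            using b \<rho> divide_right_mono[of "l i" R \<rho>] divide_right_mono[of "- R" "l i" \<rho>] by auto
          moreover have "R / \<rho> \<le> of_int L" unfolding L_def by (rule le_of_int_ceiling)
          ultimately have "l i / \<rho> \<le> of_int L" "of_int (- L) \<le> l i / \<rho>" by auto
          then show ?thesis by (meson floor_le_iff floor_mono floor_of_int le_floor_iff order_trans of_int_floor_le of_int_le_iff)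
        qed
        then show ?thesis by (auto simp: g_def)
      qed
      then have l': "l' \<in> net" unfolding net_def l'_def by blast
      have close: "\<bar>l i - l' i\<bar> \<le> \<rho>" if "i < m" for i
      proof -
        have "of_int \<lfloor>l i / \<rho>\<rfloor> \<le> l i / \<rho>" "l i / \<rho> \<le> of_int \<lfloor>l i / \<rho>\<rfloor> + 1" by linarith+
        then have "\<rho> * of_int \<lfloor>l i / \<rho>\<rfloor> \<le> \<rho> * (l i / \<rho>)" "\<rho> * (l i / \<rho>) \<le> \<rho> * (of_int \<lfloor>l i / \<rho>\<rfloor> + 1)"
          using \<rho>(1) by (intro mult_left_mono; simp)+
        then have "\<rho> * of_int \<lfloor>l i / \<rho>\<rfloor> \<le> l i" "l i \<le> \<rho> * of_int \<lfloor>l i / \<rho>\<rfloor> + \<rho>"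
          using \<rho>(1) by (simp_all add: distrib_left)
        then show ?thesis using that by (simp add: l'_def g_def abs_le_iff)
      qed
      have sum_close: "(\<Sum>i<m. (l i - l' i) * y i) \<le> real m * \<rho>" "(\<Sum>i<m. (l' i - l i) * y i) \<le> real m * \<rho>"
        if "\<And>i. i < m \<Longrightarrow> \<bar>y i\<bar> \<le> 1" for y
      proof -
        have b: "\<bar>(l i - l' i) * y i\<bar> \<le> \<rho> * 1" if "i < m" for i
          unfolding abs_mult using close[OF that] \<open>\<And>i. i < m \<Longrightarrow> \<bar>y i\<bar> \<le> 1\<close>[OF that] \<rho> by (intro mult_mono) auto
        have "(l i - l' i) * y i \<le> \<rho>" "(l' i - l i) * y i \<le> \<rho>" if "i < m" for i
          using b[OF that] by (auto simp: left_diff_distrib abs_le_iff)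
        then have "(\<Sum>i<m. (l i - l' i) * y i) \<le> (\<Sum>i<m. \<rho>)" "(\<Sum>i<m. (l' i - l i) * y i) \<le> (\<Sum>i<m. \<rho>)"
          by (auto intro!: sum_mono simp del: sum_constant)
        then show "(\<Sum>i<m. (l i - l' i) * y i) \<le> real m * \<rho>" "(\<Sum>i<m. (l' i - l i) * y i) \<le> real m * \<rho>" by simp_all
      qed
      have "v l z - v l' z \<le> real m * \<rho>" if "z \<in> K" for z
        using sum_close(1)[of "\<lambda>i. f i z"] f1 that by (simp add: v_def sum_subtractf left_diff_distrib)
      from max_VDM_change[OF K vc this]
      have ch: "max_VDM K (v l') k \<le> max_VDM K (v l) k * exp (real k * (?N k * (real m * \<rho>)))" .
      have p': "max_VDM K (v l') k > 0" and c': "c - \<eta> / 2 \<le> ln (max_VDM K (v l') k) / (real k * ?N k) + (\<Sum>i<m. l' i * x i)"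
        using elim(1) l' by auto
      have p: "max_VDM K (v l) k > 0"
        using ch p' max_VDM_nonneg[OF K vc, of l k] by (cases "max_VDM K (v l) k = 0") auto
      have "ln (max_VDM K (v l') k) \<le> ln (max_VDM K (v l) k * exp (real k * (?N k * (real m * \<rho>))))"
        using ch p p' by (subst ln_le_cancel_iff) auto
      also have "\<dots> = ln (max_VDM K (v l) k) + real k * (?N k * (real m * \<rho>))" using p by (subst ln_mult_pos) auto
      finally have "ln (max_VDM K (v l') k) / (real k * ?N k) \<le>
          (ln (max_VDM K (v l) k) + real k * (?N k * (real m * \<rho>))) / (real k * ?N k)"
        by (intro divide_right_mono) auto
      also have "\<dots> = ln (max_VDM K (v l) k) / (real k * ?N k) + real m * \<rho>"
        using elim(2) N by (simp add: add_divide_distrib)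
      finally have "ln (max_VDM K (v l') k) / (real k * ?N k) \<le> ln (max_VDM K (v l) k) / (real k * ?N k) + real m * \<rho>" .
      moreover have "(\<Sum>i<m. l' i * x i) \<le> (\<Sum>i<m. l i * x i) + real m * \<rho>"
        using sum_close(2)[of x] x1 by (simp add: sum_subtractf left_diff_distrib)
      ultimately show "max_VDM K (v l) k > 0 \<and> c - \<eta> \<le> ln (max_VDM K (v l) k) / (real k * ?N k) + (\<Sum>i<m. l i * x i)"
        using p c' \<rho>(2) by linarith
    qed
  qed
qed

lemma poly_dim_at_top: "filterlim (\<lambda>k. real (poly_dim TYPE('n::finite) k)) at_top sequentially"
proof (rule filterlim_at_top_mono[OF filterlim_real_sequentially])
  have "k \<le> poly_dim TYPE('n) k" for k
  proof (cases "k = 0")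
    case False
    have "k \<le> Suc k choose k" by simp
    also have "\<dots> \<le> (CARD('n) + k) choose k"
      using zero_less_card_finite[where 'a = 'n] by (intro binomial_right_mono) simp
    finally show ?thesis by (simp add: poly_dim_def)
  qed simp
  then show "\<forall>\<^sub>F k in sequentially. real k \<le> real (poly_dim TYPE('n) k)" by simp
qed

text \<open>A large defect would make the determinant too large: its lower bound contains
  \<open>(R - 1) * (\<Sum>i<m. \<bar>d i\<bar>)\<close>, while the unweighted maximum over
  \<open>K\<close> bounds it from above.\<close>

lemma eventually_configuration_near_target:
  fixes K :: "(complex ^ 'n::finite) set" and f :: "nat \<Rightarrow> complex ^ 'n \<Rightarrow> real" and x :: "nat \<Rightarrow> real"
    and c \<epsilon> \<eta> :: real and m :: nat
  defines "v \<equiv> \<lambda>(l :: nat \<Rightarrow> real) z. \<Sum>i<m. l i * f i z" and "N \<equiv> poly_dim TYPE('n)"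
  assumes K: "compact K" "K \<noteq> {}" and f: "\<And>i. i < m \<Longrightarrow> continuous_on K (f i)"
    and f1: "\<And>i z. i < m \<Longrightarrow> z \<in> K \<Longrightarrow> \<bar>f i z\<bar> \<le> 1" and x1: "\<And>i. i < m \<Longrightarrow> \<bar>x i\<bar> \<le> 1"
    and pos: "\<And>l. weighted_transfinite_diameter K (v l) > 0"
    and c: "\<And>l. c \<le> ln (weighted_transfinite_diameter K (v l)) + (\<Sum>i<m. l i * x i)"
    and \<epsilon>: "\<epsilon> > 0" and \<eta>: "\<eta> > 0" "\<eta> \<le> 1"
  shows "\<forall>\<^sub>F k in sequentially. \<exists>a\<in>{..<N k} \<rightarrow>\<^sub>E K. VDM k a \<noteq> 0 \<and>
    (\<forall>i<m. \<bar>(\<Sum>j<N k. f i (a j)) / real (N k) - x i\<bar> < \<epsilon>) \<and>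
    ln (cmod (VDM k a)) / (real k * real (N k)) \<ge> c - \<eta>"
proof -
  \<comment> \<open>\<open>M\<close> eventually bounds the normalized logarithm of the unweighted
    maximum; \<open>M \<ge> c\<close> ensures \<open>R \<ge> 2\<close>.\<close>
  define M where "M = max c (ln (weighted_transfinite_diameter K (v (\<lambda>_. 0))) + 1)"
  define R where "R = 2 + 2 * (M - c + 1) / \<epsilon>"
  have R2: "R \<ge> 2" using \<epsilon> by (simp add: R_def M_def)
  have Reps: "(M - c + 1) / (R - 1) < \<epsilon> / 2"
  proof -
    have "R - 1 > 2 * (M - c + 1) / \<epsilon>" by (simp add: R_def)
    then have "2 * (M - c + 1) < (R - 1) * \<epsilon>" using \<epsilon> by (simp add: divide_less_eq)
    then show ?thesis using R2 by (simp add: divide_less_eq mult.commute)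
  qed
  \<comment> \<open>The three bounds serve the concentration estimate, the distance to the target,
    and the error terms, which amount to at most \<open>3 * m * R * \<delta>\<close>.\<close>
  define \<delta> where "\<delta> = min 1 (min (\<epsilon> / 2) (\<eta> / (8 * (real m + 1) * R)))"
  have \<delta>: "0 < \<delta>" "\<delta> \<le> 1" using \<epsilon> \<eta> R2 by (auto simp: \<delta>_def)
  have \<delta>\<epsilon>: "\<delta> \<le> \<epsilon> / 2" unfolding \<delta>_def by (rule min.coboundedI2[OF min.cobounded1])
  have m\<delta>: "real m * R * \<delta> \<le> \<eta> / 8"
  proof -
    have "\<delta> \<le> \<eta> / (8 * (real m + 1) * R)" by (simp add: \<delta>_def)
    then have "real m * R * \<delta> \<le> (real m + 1) * R * (\<eta> / (8 * (real m + 1) * R))"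
      using R2 \<delta> by (intro mult_mono) auto
    also have "\<dots> = \<eta> / 8"
    proof -
      define B where "B = (real m + 1) * R"
      have "B > 0" unfolding B_def using R2 by (intro mult_pos_pos) auto
      then have "B * (\<eta> / (8 * B)) = \<eta> / 8" by simp
      then show ?thesis by (simp only: B_def mult.assoc)
    qed
    finally show ?thesis .
  qed
  define s where "s = (\<lambda>k. \<delta> / (2 * real k))"
  \<comment> \<open>\<open>s * J\<close> is \<open>R\<close> rounded down to the mesh, hence at
    least \<open>R - 1\<close>, and \<open>J\<close> grows only linearly in
    \<open>k\<close>.\<close>
  define J where "J = (\<lambda>k. nat \<lfloor>R / s k\<rfloor>)"
  have sJ: "s k * real (J k) \<le> R" "R - 1 \<le> s k * real (J k)" "real (J k) \<le> 2 * real k * R / \<delta>" if k: "k > 0" for k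
  proof -
    have s: "0 < s k" "s k \<le> 1" using k \<delta> by (auto simp: s_def field_simps)
    have "R / s k \<ge> 0" using s R2 by simp
    then have "real (J k) \<le> R / s k" "R / s k \<le> real (J k) + 1" unfolding J_def by linarith+
    then have "s k * real (J k) \<le> R" "R \<le> s k * real (J k) + s k" using s by (auto simp: field_simps)
    then show "s k * real (J k) \<le> R" "R - 1 \<le> s k * real (J k)" using s by auto
    show "real (J k) \<le> 2 * real k * R / \<delta>"
      using \<open>real (J k) \<le> R / s k\<close> k \<delta> by (simp add: s_def field_simps)
  qed
  define E where "E = (\<lambda>k. 2 * ln 2 / real k + ln (real (N k) * real (2 * J k + 1) ^ m) / (2 * real k))"
  have E: "\<forall>\<^sub>F k in sequentially. E k < \<eta> / 4"
  proof -
    have l1: "(\<lambda>k. 2 * ln 2 / real k) \<longlonglongrightarrow> 0" by real_asymp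
    have l2: "(\<lambda>k. ln (real (N k)) / real k) \<longlonglongrightarrow> 0" unfolding N_def by (rule ln_poly_dim_asymp)
    define q where "q = 4 * R / \<delta>"
    have q: "q > 0" using R2 \<delta> by (simp add: q_def)
    then have "(\<lambda>k. ln (q * real k + 1) / (2 * real k)) \<longlonglongrightarrow> 0" by real_asymp
    then have l3: "(\<lambda>k. ln (4 * real k * R / \<delta> + 1) / (2 * real k)) \<longlonglongrightarrow> 0" by (simp add: q_def mult_ac)
    have lim: "(\<lambda>k. 2 * ln 2 / real k + (ln (real (N k)) / real k) / 2 + real m * (ln (4 * real k * R / \<delta> + 1) / (2 * real k))) \<longlonglongrightarrow> 0 + 0 / 2 + real m * 0"
      by (intro tendsto_add tendsto_divide[OF l2 tendsto_const] tendsto_mult[OF tendsto_const l3] l1) simp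
    have "\<forall>\<^sub>F k in sequentially. 2 * ln 2 / real k + (ln (real (N k)) / real k) / 2 + real m * (ln (4 * real k * R / \<delta> + 1) / (2 * real k)) < \<eta> / 4"
      using order_tendstoD(2)[OF lim, of "\<eta> / 4"] \<eta> by simp
    then show ?thesis using eventually_gt_at_top[of 0]
    proof eventually_elim
      case (elim k)
      have Npos: "real (N k) > 0" using poly_dim_pos[where ?'n = 'n, of k] by (simp add: N_def)
      have "ln (real (N k) * real (2 * J k + 1) ^ m) = ln (real (N k)) + real m * ln (real (2 * J k + 1))"
        using Npos by (subst ln_mult_pos) (auto simp: ln_realpow)
      also have "ln (real (2 * J k + 1)) \<le> ln (4 * real k * R / \<delta> + 1)"
        using sJ(3)[OF elim(2)] by (subst ln_le_cancel_iff) (auto simp: add_pos_nonneg)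
      finally have "ln (real (N k) * real (2 * J k + 1) ^ m) \<le> ln (real (N k)) + real m * ln (4 * real k * R / \<delta> + 1)"
        by (simp add: mult_left_mono)
      then have "ln (real (N k) * real (2 * J k + 1) ^ m) / (2 * real k) \<le>
          (ln (real (N k)) + real m * ln (4 * real k * R / \<delta> + 1)) / (2 * real k)"
        by (rule divide_right_mono) simp
      also have "\<dots> = (ln (real (N k)) / real k) / 2 + real m * (ln (4 * real k * R / \<delta> + 1) / (2 * real k))"
        by (simp add: add_divide_distrib)
      finally show ?case using elim(1) unfolding E_def by linarith
    qed
  qed
  have large: "\<forall>\<^sub>F k in sequentially. 2 * real m * exp (- real (N k) * \<delta>\<^sup>2 / 4) \<le> 1 / 2"
  proof -
    define q where "q = \<delta>\<^sup>2 / 4"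
    have "q > 0" using \<delta> by (simp add: q_def)
    then have "((\<lambda>u. 2 * real m * exp (- u * q)) \<longlongrightarrow> 0) at_top" by real_asymp
    from filterlim_compose[OF this poly_dim_at_top[where ?'n = 'n]]
    have "(\<lambda>k. 2 * real m * exp (- real (N k) * \<delta>\<^sup>2 / 4)) \<longlonglongrightarrow> 0" by (simp add: N_def q_def)
    from order_tendstoD(2)[OF this, of "1 / 2"] show ?thesis by (auto elim: eventually_mono)
  qed
  have upper: "\<forall>\<^sub>F k in sequentially. max_VDM K (v (\<lambda>_. 0)) k > 0 \<and> ln (max_VDM K (v (\<lambda>_. 0)) k) / (real k * real (N k)) < M"
  proof -
    have vc: "continuous_on K (v (\<lambda>_. 0))" unfolding v_def by (intro continuous_intros f) auto
    have "ln (weighted_transfinite_diameter K (v (\<lambda>_. 0))) < M" by (simp add: M_def)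
    from order_tendstoD(2)[OF ln_max_VDM_lim(2)[OF K vc pos] this] ln_max_VDM_lim(1)[OF K vc pos]
    show ?thesis unfolding N_def by eventually_elim auto
  qed
  have "\<eta> / 8 > 0" using \<eta> by simp
  from max_VDM_uniform_lower_bound[where R = R, OF K f f1 x1 pos[unfolded v_def] c[unfolded v_def] this]
  have lower: "\<forall>\<^sub>F k in sequentially. \<forall>l. (\<forall>i<m. \<bar>l i\<bar> \<le> R) \<longrightarrow> max_VDM K (v l) k > 0 \<and>
    c - \<eta> / 8 \<le> ln (max_VDM K (v l) k) / (real k * real (N k)) + (\<Sum>i<m. l i * x i)"
    unfolding v_def N_def by simp
  from lower upper large E eventually_gt_at_top[of 0] show ?thesis
  proof eventually_elim
    case (elim k)
    note k = elim(5)
    have s: "s k = \<delta> / (2 * real k)" by (simp add: s_def)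
    let ?N = "poly_dim TYPE('n) k"
    have big: "2 * real m * exp (- real ?N * \<delta>\<^sup>2 / 4) \<le> 1 / 2" using elim(3) by (simp add: N_def)
    have box: "0 < max_VDM K (\<lambda>z. \<Sum>i<m. l i * f i z) k \<and>
          c - \<eta> / 8 \<le> ln (max_VDM K (\<lambda>z. \<Sum>i<m. l i * f i z) k) / (real k * real ?N) + (\<Sum>i<m. l i * x i)"
      if "\<And>i. i < m \<Longrightarrow> \<bar>l i\<bar> \<le> s k * real (J k)" for l
    proof -
      have "\<forall>i<m. \<bar>l i\<bar> \<le> R" using that sJ(1)[OF k] order_trans by blast
      then show ?thesis using elim(1) unfolding v_def N_def by blast
    qed
    obtain a d where ad: "a \<in> {..<?N} \<rightarrow>\<^sub>E K" "VDM k a \<noteq> 0"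
      "\<And>i. i < m \<Longrightarrow> \<bar>(\<Sum>j<?N. f i (a j)) / real ?N - x i - d i\<bar> \<le> \<delta>"
      "ln (cmod (VDM k a)) / (real k * real ?N) \<ge> (c - \<eta> / 8)
         - (2 * ln 2 / real k + ln (real ?N * real (2 * J k + 1) ^ m) / (2 * real k))
         + s k * real (J k) * (\<Sum>i<m. \<bar>d i\<bar>) - 2 * real m * (s k * real (J k)) * \<delta> - real m * (s k * real (J k)) * \<delta>"
      using configuration_near_target[OF K f f1 k \<delta>(1,2) \<delta>(1,2) s big box] by blast
    note ad = ad[folded N_def]
    have ad4: "ln (cmod (VDM k a)) / (real k * real (N k)) \<ge> (c - \<eta> / 8) - E k
         + s k * real (J k) * (\<Sum>i<m. \<bar>d i\<bar>) - 2 * real m * (s k * real (J k)) * \<delta> - real m * (s k * real (J k)) * \<delta>"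
      using ad(4) unfolding E_def .
    have "real m * (s k * real (J k)) * \<delta> \<le> real m * R * \<delta>"
      using sJ(1)[OF k] \<delta> by (intro mult_right_mono mult_left_mono) auto
    moreover have "2 * real m * (s k * real (J k)) * \<delta> = 2 * (real m * (s k * real (J k)) * \<delta>)" by simp
    moreover have "(R - 1) * (\<Sum>i<m. \<bar>d i\<bar>) \<le> s k * real (J k) * (\<Sum>i<m. \<bar>d i\<bar>)"
      using sJ(2)[OF k] by (intro mult_right_mono sum_nonneg) auto
    \<comment> \<open>The losses are \<open>\<eta> / 8\<close> from the uniform bound,
      \<open>\<eta> / 4\<close> from \<open>E k\<close>, and three times
      \<open>\<eta> / 8\<close>.\<close>
    ultimately have ge: "ln (cmod (VDM k a)) / (real k * real (N k)) \<ge> c - \<eta> + (R - 1) * (\<Sum>i<m. \<bar>d i\<bar>)"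
      using ad4 m\<delta> elim(4) \<eta> by linarith
    have "cmod (VDM k a) \<le> max_VDM K (v (\<lambda>_. 0)) k"
    proof -
      have "cmod (weighted_VDM (v (\<lambda>_. 0)) k a) \<le> max_VDM K (v (\<lambda>_. 0)) k"
        by (rule max_VDM_upper[OF K]) (use ad(1) in \<open>auto simp: N_def v_def\<close>)
      then show ?thesis by (simp add: weighted_VDM_def v_def)
    qed
    then have "ln (cmod (VDM k a)) / (real k * real (N k)) \<le> ln (max_VDM K (v (\<lambda>_. 0)) k) / (real k * real (N k))"
      using ad(2) elim(2) by (intro divide_right_mono) (auto simp: ln_le_cancel_iff)
    then have "c - \<eta> + (R - 1) * (\<Sum>i<m. \<bar>d i\<bar>) < M" using ge elim(2) by linarith
    then have sumd: "(\<Sum>i<m. \<bar>d i\<bar>) < \<epsilon> / 2"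
    proof -
      assume "c - \<eta> + (R - 1) * (\<Sum>i<m. \<bar>d i\<bar>) < M"
      then have "(R - 1) * (\<Sum>i<m. \<bar>d i\<bar>) \<le> M - c + 1" using \<eta> by linarith
      then have "(\<Sum>i<m. \<bar>d i\<bar>) \<le> (M - c + 1) / (R - 1)" using R2 by (simp add: le_divide_eq mult.commute)
      then show ?thesis using Reps by linarith
    qed
    have near: "\<bar>(\<Sum>j<N k. f i (a j)) / real (N k) - x i\<bar> < \<epsilon>" if i: "i < m" for i
    proof -
      have "\<bar>d i\<bar> \<le> (\<Sum>i<m. \<bar>d i\<bar>)" using i by (intro member_le_sum) auto
      then show ?thesis using ad(3)[OF i] sumd \<delta>\<epsilon> by linarith
    qed
    have "(R - 1) * (\<Sum>i<m. \<bar>d i\<bar>) \<ge> 0" using R2 by (intro mult_nonneg_nonneg sum_nonneg) auto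
    then have "ln (cmod (VDM k a)) / (real k * real (N k)) \<ge> c - \<eta>" using ge by linarith
    then show ?case using ad(1,2) near by blast
  qed
qed

lemma weighted_W_lower_ge:
  fixes K :: "(complex ^ 'n::finite) set"
  assumes K: "compact K" and Q: "continuous_on K Q" and \<mu>: "\<mu> \<in> prob_measures K"
    and pos: "\<And>v. continuous_on K v \<Longrightarrow> weighted_transfinite_diameter K v > 0"
    and c: "\<And>v. continuous_on K v \<Longrightarrow> c \<le> ln (weighted_transfinite_diameter K v) + (LINT x|\<mu>. v x)"
  shows "ennreal (exp (c - (LINT x|\<mu>. Q x))) \<le> weighted_W_lower K Q \<mu>"
  unfolding weighted_W_lower_def
proof (rule INF_greatest)
  fix G assume "G \<in> {G. openin (weak_star_topology K) G \<and> \<mu> \<in> G}"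
  then have G: "openin (weak_star_topology K) G" "\<mu> \<in> G" by auto
  let ?N = "\<lambda>k. poly_dim TYPE('n) k" and ?I = "LINT x|\<mu>. Q x"
  note ne = prob_measures_nonempty[OF \<mu>]
  interpret prob_space \<mu> using \<mu> by (simp add: prob_measures_def)
  have sp: "space \<mu> = K"
    using \<mu> sets_eq_imp_space_eq[of \<mu> "restrict_space borel K"] by (simp add: prob_measures_def space_restrict_space)
  note int = integrable_prob_measures[OF K \<mu>]
  obtain F :: "(complex ^ 'n \<Rightarrow> real) set" and \<epsilon> where F: "finite F" "\<epsilon> > 0" "\<forall>f\<in>F. continuous_on K f"
    "\<forall>\<nu>\<in>prob_measures K. (\<forall>f\<in>F. \<bar>(LINT x|\<nu>. f x) - (LINT x|\<mu>. f x)\<bar> < \<epsilon>) \<longrightarrow> \<nu> \<in> G"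
    using weak_star_nbhd_basis[OF G] by auto
  \<comment> \<open>Including \<open>Q\<close> controls the factor between \<open>VDM\<close> and
    \<open>weighted_VDM\<close> on the same configuration.\<close>
  define F' where "F' = insert Q F"
  have F': "finite F'" "\<And>f. f \<in> F' \<Longrightarrow> continuous_on K f" using F Q by (auto simp: F'_def)
  obtain h where h: "bij_betw h {..<card F'} F'"
    using ex_bij_betw_nat_finite[OF F'(1)] by (auto simp: atLeast0LessThan)
  let ?m = "card F'"
  have hF: "h i \<in> F'" if "i < ?m" for i using h that by (auto simp: bij_betw_def)
  have "\<exists>B. \<forall>z\<in>K. \<bar>f z\<bar> \<le> B" if "f \<in> F'" for f
    using compact_imp_bounded[OF compact_continuous_image[OF F'(2)[OF that] K]] by (auto simp: bounded_iff)
  then obtain b where b: "\<And>f z. f \<in> F' \<Longrightarrow> z \<in> K \<Longrightarrow> \<bar>f z\<bar> \<le> b f" by metis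
  define B where "B = 1 + (\<Sum>f\<in>F'. \<bar>b f\<bar>)"
  have B1: "B > 0" unfolding B_def by (intro add_pos_nonneg sum_nonneg) auto
  have B: "\<bar>f z\<bar> \<le> B" if "f \<in> F'" "z \<in> K" for f z
  proof -
    have "\<bar>b f\<bar> \<le> (\<Sum>f\<in>F'. \<bar>b f\<bar>)" using that F'(1) by (intro member_le_sum) auto
    then show ?thesis using b[OF that] by (simp add: B_def)
  qed
  \<comment> \<open>Division by the common bound \<open>B\<close> makes the test functions at most 1
    in absolute value; the tolerance below is divided by \<open>B\<close> too.\<close>
  define f where "f = (\<lambda>i z. h i z / B)"
  define x where "x = (\<lambda>i. LINT z|\<mu>. f i z)"
  have fc: "continuous_on K (f i)" if "i < ?m" for i
    unfolding f_def using F'(2)[OF hF[OF that]] B1 by (intro continuous_intros) auto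
  have f1: "\<bar>f i z\<bar> \<le> 1" if "i < ?m" "z \<in> K" for i z
    using B[OF hF[OF that(1)] that(2)] B1 by (simp add: f_def divide_le_eq)
  have x1: "\<bar>x i\<bar> \<le> 1" if i: "i < ?m" for i
  proof -
    have "x i \<le> 1" unfolding x_def using f1[OF i] sp by (intro integral_le_const int fc i AE_I2) (auto simp: abs_le_iff)
    moreover have "- 1 \<le> x i" unfolding x_def
      by (intro integral_ge_const int fc i AE_I2) (use f1[OF i] sp in \<open>force simp: abs_le_iff\<close>)
    ultimately show ?thesis by linarith
  qed
  have xB: "x i = (LINT z|\<mu>. h i z) / B" for i by (simp add: x_def f_def)
  have vc: "continuous_on K (\<lambda>z. \<Sum>i<?m. l i * f i z)" for l by (intro continuous_intros fc) auto
  have vint: "(LINT z|\<mu>. (\<Sum>i<?m. l i * f i z)) = (\<Sum>i<?m. l i * x i)" for l :: "nat \<Rightarrow> real"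
  proof -
    have "(LINT z|\<mu>. (\<Sum>i<?m. l i * f i z)) = (\<Sum>i<?m. LINT z|\<mu>. l i * f i z)"
      by (intro Bochner_Integration.integral_sum integrable_mult_right int fc) auto
    then show ?thesis by (simp add: x_def)
  qed
  \<comment> \<open>One \<open>\<eta>\<close> is lost on the determinant, the other on the average
    of \<open>Q\<close>.\<close>
  have main: "ennreal (exp (c - ?I - 2 * \<eta>)) \<le> liminf (\<lambda>k. weighted_W_sup K Q k G)" if \<eta>: "0 < \<eta>" "\<eta> \<le> 1" for \<eta>
  proof (rule Liminf_bounded)
    have "min \<epsilon> \<eta> / B > 0" using F(2) \<eta> B1 by simp
    have posv: "weighted_transfinite_diameter K (\<lambda>z. \<Sum>i<?m. l i * f i z) > 0" for l by (rule pos[OF vc])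
    have cv: "c \<le> ln (weighted_transfinite_diameter K (\<lambda>z. \<Sum>i<?m. l i * f i z)) + (\<Sum>i<?m. l i * x i)" for l
      using c[OF vc[of l]] unfolding vint .
    have near: "\<forall>\<^sub>F k in sequentially. \<exists>a\<in>{..<?N k} \<rightarrow>\<^sub>E K. VDM k a \<noteq> 0 \<and>
        (\<forall>i<?m. \<bar>(\<Sum>j<?N k. f i (a j)) / real (?N k) - x i\<bar> < min \<epsilon> \<eta> / B) \<and>
        ln (cmod (VDM k a)) / (real k * real (?N k)) \<ge> c - \<eta>"
      by (rule eventually_configuration_near_target[OF K ne fc f1 x1 posv cv \<open>min \<epsilon> \<eta> / B > 0\<close> \<eta>])
    show "\<forall>\<^sub>F k in sequentially. ennreal (exp (c - ?I - 2 * \<eta>)) \<le> weighted_W_sup K Q k G"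
      using near eventually_gt_at_top[of 0]
    proof eventually_elim
      case (elim k)
      then obtain a where a: "a \<in> {..<?N k} \<rightarrow>\<^sub>E K" "VDM k a \<noteq> 0"
        "\<And>i. i < ?m \<Longrightarrow> \<bar>(\<Sum>j<?N k. f i (a j)) / real (?N k) - x i\<bar> < min \<epsilon> \<eta> / B"
        "ln (cmod (VDM k a)) / (real k * real (?N k)) \<ge> c - \<eta>" by blast
      have N: "?N k > 0" by (rule poly_dim_pos)
      have avg: "\<bar>(\<Sum>j<?N k. g (a j)) / real (?N k) - (LINT z|\<mu>. g z)\<bar> < min \<epsilon> \<eta>" if g: "g \<in> F'" for g
      proof -
        obtain i where i: "i < ?m" "g = h i" using h g by (auto simp: bij_betw_def)
        have "(\<Sum>j<?N k. f i (a j)) / real (?N k) - x i = ((\<Sum>j<?N k. g (a j)) / real (?N k) - (LINT z|\<mu>. g z)) / B"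
          unfolding xB f_def i(2) by (simp add: sum_divide_distrib[symmetric] diff_divide_distrib)
        then show ?thesis using a(3)[OF i(1)] B1 by (simp add: abs_divide divide_less_cancel)
      qed
      have aK: "\<And>j. j < ?N k \<Longrightarrow> a j \<in> K" using a(1) by (auto simp: PiE_iff)
      have "empirical_measure K (?N k) a \<in> G"
      proof (rule F(4)[rule_format])
        show "empirical_measure K (?N k) a \<in> prob_measures K"
          by (rule empirical_measure_in_prob_measures[OF N aK])
        fix g assume g: "g \<in> F"
        have "(LINT z|empirical_measure K (?N k) a. g z) = (\<Sum>j<?N k. g (a j)) / real (?N k)"
          by (rule integral_empirical_measure[OF N aK F(3)[rule_format, OF g]])
        then show "\<bar>(LINT z|empirical_measure K (?N k) a. g z) - (LINT z|\<mu>. g z)\<bar> < \<epsilon>"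
          using avg[of g] g by (simp add: F'_def)
      qed
      then have conf: "a \<in> configurations K G (?N k)" using a(1) by (simp add: configurations_def)
      have VDM0: "weighted_VDM (\<lambda>_. 0) k a = VDM k a" by (simp add: weighted_VDM_def)
      have "(\<Sum>j<?N k. Q (a j)) / real (?N k) \<le> ?I + \<eta>"
      proof -
        have "Q \<in> F'" by (simp add: F'_def)
        from avg[OF this] show ?thesis by linarith
      qed
      then have "- ?I - \<eta> \<le> (\<Sum>j<?N k. 0 - Q (a j)) / real (?N k)" by (simp add: sum_negf)
      then have "exp (c - \<eta>) * exp (- ?I - \<eta>) \<le>
          cmod (VDM k a) powr (1 / (real k * real (?N k))) * exp ((\<Sum>j<?N k. 0 - Q (a j)) / real (?N k))"
        using a(2,4) by (intro mult_mono) (auto simp: powr_def)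
      also have "\<dots> = cmod (weighted_VDM Q k a) powr (1 / (real k * real (?N k)))"
        using cmod_weighted_VDM_change_root[OF elim(2), of Q a "\<lambda>_. 0"] unfolding VDM0 by simp
      finally have "exp (c - ?I - 2 * \<eta>) \<le> cmod (weighted_VDM Q k a) powr (1 / (real k * real (?N k)))"
        by (simp add: exp_add[symmetric] algebra_simps)
      then have "ennreal (exp (c - ?I - 2 * \<eta>)) \<le> ennreal (cmod (weighted_VDM Q k a) powr (1 / (real k * real (?N k))))"
        by (rule ennreal_leI)
      also have "\<dots> \<le> weighted_W_sup K Q k G" unfolding weighted_W_sup_def by (rule SUP_upper[OF conf])
      finally show ?case .
    qed
  qed
  have "(\<lambda>n. ennreal (exp (c - ?I - 2 * (1 / real (Suc n))))) \<longlonglongrightarrow> ennreal (exp (c - ?I - 2 * 0))"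
    by (intro tendsto_ennrealI tendsto_intros LIMSEQ_Suc[OF lim_1_over_n])
  then have "ennreal (exp (c - ?I - 2 * 0)) \<le> liminf (\<lambda>k. weighted_W_sup K Q k G)"
    by (rule LIMSEQ_le_const2) (intro exI allI impI main; simp)
  then show "ennreal (exp (c - ?I)) \<le> liminf (\<lambda>k. weighted_W_sup K Q k G)" by simp
qed

section \<open>The two bounds combined\<close>

lemma weighted_W_lower_le_upper: "weighted_W_lower K Q \<mu> \<le> weighted_W_upper K Q \<mu>"
  unfolding weighted_W_lower_def weighted_W_upper_def
  by (intro INF_mono) (auto intro!: Liminf_le_Limsup)

lemma ext_log_mono: "x \<le> y \<Longrightarrow> ext_log x \<le> ext_log y"
proof -
  assume le: "x \<le> y"
  consider "x = 0" | "y = \<infinity>" | "x > 0" "y < \<infinity>" by (metis infinity_ennreal_def less_top zero_less_iff_neq_zero)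
  then show ?thesis
  proof cases
    case 3
    then have "enn2real x > 0" "enn2real x \<le> enn2real y"
      using le by (auto simp: enn2real_positive_iff intro: enn2real_mono)
    then show ?thesis using 3 le by (auto simp: ext_log_def)
  qed (auto simp: ext_log_def)
qed

lemma ext_log_ennreal: "r > 0 \<Longrightarrow> ext_log (ennreal r) = ereal (ln r)" "ext_log 0 = -\<infinity>"
  by (auto simp: ext_log_def)

lemma weighted_W_eq:
  fixes K :: "(complex ^ 'n::finite) set"
  assumes K: "compact K" and Q: "continuous_on K Q" and \<mu>: "\<mu> \<in> prob_measures K"
  shows "ext_log (weighted_W_upper K Q \<mu>) = ext_log (weighted_W_lower K Q \<mu>)"
    "ext_log (weighted_W_lower K Q \<mu>) = (INF v \<in> {v. continuous_on K v}.
       ext_log (ennreal (weighted_transfinite_diameter K v)) + ereal (LINT x|\<mu>. v x)) - ereal (LINT x|\<mu>. Q x)"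
proof -
  let ?I = "LINT x|\<mu>. Q x" and ?\<delta> = "weighted_transfinite_diameter K"
  let ?S = "\<lambda>v. ext_log (ennreal (?\<delta> v)) + ereal (LINT x|\<mu>. v x)"
  let ?inf = "INF v \<in> {v. continuous_on K v}. ?S v"
  note ne = prob_measures_nonempty[OF \<mu>]
  have upper: "ext_log (weighted_W_upper K Q \<mu>) \<le> ?inf - ereal ?I"
  proof -
    have "ext_log (weighted_W_upper K Q \<mu>) + ereal ?I \<le> ?inf"
    proof (rule INF_greatest)
      fix v :: "complex ^ 'n \<Rightarrow> real" assume "v \<in> {v. continuous_on K v}"
      then have v: "continuous_on K v" by simp
      have "ext_log (weighted_W_upper K Q \<mu>) \<le> ext_log (ennreal (?\<delta> v * exp ((LINT x|\<mu>. v x) - ?I)))"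
        by (intro ext_log_mono weighted_W_upper_le K Q v \<mu>)
      also have "\<dots> = ?S v - ereal ?I"
        using weighted_transfinite_diameter_nonneg[OF K ne v]
        by (cases "?\<delta> v = 0") (simp_all add: ext_log_ennreal ln_mult_pos)
      finally show "ext_log (weighted_W_upper K Q \<mu>) + ereal ?I \<le> ?S v" by (subst (asm) ereal_le_minus) auto
    qed
    then show ?thesis by (subst ereal_le_minus) auto
  qed
  have lower: "?inf - ereal ?I \<le> ext_log (weighted_W_lower K Q \<mu>)"
  proof (cases ?inf)
    case MInf
    then show ?thesis by simp
  next
    case PInf
    have "?inf \<le> ?S (\<lambda>_. 0)" by (rule INF_lower) simp
    also have "\<dots> < \<infinity>" by (simp add: ext_log_def)
    finally show ?thesis using PInf by simp
  next
    case (real c)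
    have cS: "ereal c \<le> ?S v" if "continuous_on K v" for v :: "complex ^ 'n \<Rightarrow> real"
      unfolding real[symmetric] by (rule INF_lower) (use that in simp)
    have pos: "?\<delta> v > 0" if v: "continuous_on K v" for v
      using cS[OF v] weighted_transfinite_diameter_nonneg[OF K ne v]
      by (cases "?\<delta> v = 0") (simp_all add: ext_log_ennreal)
    have "c \<le> ln (?\<delta> v) + (LINT x|\<mu>. v x)" if v: "continuous_on K v" for v
      using cS[OF v] pos[OF v] by (simp add: ext_log_ennreal)
    from ext_log_mono[OF weighted_W_lower_ge[OF K Q \<mu> pos this]]
    show ?thesis unfolding real by (simp add: ext_log_ennreal)
  qed
  have "ext_log (weighted_W_lower K Q \<mu>) \<le> ext_log (weighted_W_upper K Q \<mu>)"
    by (intro ext_log_mono weighted_W_lower_le_upper)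
  then show "ext_log (weighted_W_upper K Q \<mu>) = ext_log (weighted_W_lower K Q \<mu>)"
    "ext_log (weighted_W_lower K Q \<mu>) = ?inf - ereal ?I"
    using upper lower by order+
qed

theorem theorem4p4:
  fixes K :: "(complex ^ 'n) set" and Q :: "complex ^ 'n \<Rightarrow> real" and \<mu> :: "(complex ^ 'n) measure"
  assumes "compact K" and "\<not> pluripolar K"
    and "continuous_on K Q"
    and "\<mu> \<in> prob_measures K"
  shows "ext_log (W_upper K \<mu>) = ext_log (W_lower K \<mu>)
    \<and> ext_log (W_lower K \<mu>) =
        (INF v \<in> {v. continuous_on K v}.
           ext_log (ennreal (weighted_transfinite_diameter K v)) + ereal (LINT x|\<mu>. v x))
    \<and> ext_log (weighted_W_upper K Q \<mu>) = ext_log (weighted_W_lower K Q \<mu>)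
    \<and> ext_log (weighted_W_lower K Q \<mu>) =
        (INF v \<in> {v. continuous_on K v}.
           ext_log (ennreal (weighted_transfinite_diameter K v)) + ereal (LINT x|\<mu>. v x))
        - ereal (LINT x|\<mu>. Q x)"
proof -
  \<comment> \<open>The unweighted formula is the case \<open>Q = 0\<close>, where the integral of
    \<open>Q\<close> vanishes.\<close>
  have "weighted_W_sup K (\<lambda>_. 0) = W_sup K"
    by (intro ext) (simp add: weighted_W_sup_def W_sup_def weighted_VDM_def)
  then have unweighted: "weighted_W_upper K (\<lambda>_. 0) \<mu> = W_upper K \<mu>" "weighted_W_lower K (\<lambda>_. 0) \<mu> = W_lower K \<mu>"
    by (simp_all add: weighted_W_upper_def W_upper_def weighted_W_lower_def W_lower_def)
  note zero = weighted_W_eq[OF assms(1) continuous_on_const assms(4), of 0, unfolded unweighted]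
  show ?thesis
    using zero weighted_W_eq[OF assms(1,3,4)] by simp
qed

end
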